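(* Let $d\ge 1$, $0<\alpha\le 2$, and suppose $V\in L^{\infty}(\mathbb{R}^d)\cap L^{1}(\mathbb{R}^d)$. Assume that $V$ is also uniformly Hölder continuous of order $\gamma$, that is, there exists a positive constant $M$ such that $|V(x)-V(y)|\le M|x-y|^\gamma$ for all $x,y\in\mathbb{R}^d$, with $0<\gamma<\min\{1,\alpha\}$. Then, for all $t>0$, $$\Bigl|Q_V^{(\alpha)}(t)+t\int_{\mathbb{R}^d}V(x)\,dx-\frac{t^2}{2}\int_{\mathbb{R}^d}V^2(x)\,dx\Bigr|\le C(\gamma,\alpha)\,\|V\|_1\Bigl(\|V\|_\infty^2\,e^{t\|V\|_\infty}\,t^3+t^{\frac{\gamma}{\alpha}+2}\Bigr),$$ where $C(\gamma,\alpha)$ is a constant depending only on $\gamma$ and $\alpha$. In particular, $$Q_V^{(\alpha)}(t)=-t\int_{\mathbb{R}^d}V(x)\,dx+\frac{t^2}{2}\int_{\mathbb{R}^d}V^2(x)\,dx+\mathcal{O}\bigl(t^{\frac{\gamma}{\alpha}+2}\bigr)\quad\text{as }t\downarrow0.$$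
   Context: $X=\{X_t\}_{t\ge0}$ is the rotationally invariant $\alpha$-stable process on $\mathbb{R}^d$, with transition densities $p_t^{(\alpha)}(x,y)=p_t^{(\alpha)}(x-y)$ determined by $e^{-t|\xi|^\alpha}=\int_{\mathbb{R}^d}e^{-i y\cdot\xi}p_t^{(\alpha)}(y)\,dy$ for $t>0$, $\xi\in\mathbb{R}^d$. $\mathbb{E}^t_{x,y}$ denotes expectation with respect to the stable bridge, i.e. the process started at $x$ and conditioned to be at $y$ at time $t$; for $1=\lambda_0>\lambda_1>\dots>\lambda_k>\lambda_{k+1}=0$, $z_0=x$, $z_{k+1}=y$, the law of $(X_{t\lambda_1},\dots,X_{t\lambda_k})$ under it has density $\frac{1}{p_t^{(\alpha)}(x,y)}\prod_{j=0}^{k}p^{(\alpha)}_{t(\lambda_j-\lambda_{j+1})}(z_j,z_{j+1})$. The fractional Schrödinger operator $H_V=(-\Delta)^{\alpha/2}+V$ is self-adjoint, and the heat kernel of $e^{-tH_V}$ is given by the Feynman–Kac formula $p_t^{H_V}(x,y)=p_t^{(\alpha)}(x,y)\,\mathbb{E}^t_{x,y}\bigl[e^{-\int_0^tV(X_s)ds}\bigr]$. The heat content is $$Q_V^{(\alpha)}(t)=\int_{\mathbb{R}^d}\int_{\mathbb{R}^d}\bigl\{p_t^{H_V}(x,y)-p_t^{(\alpha)}(x,y)\bigr\}dx\,dy=\int_{\mathbb{R}^d}\int_{\mathbb{R}^d}p_t^{(\alpha)}(x,y)\,\mathbb{E}^t_{x,y}\bigl[e^{-\int_0^tV(X_s)ds}-1\bigr]dx\,dy.$$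 $\|\cdot\|_1,\|\cdot\|_\infty$ are the $L^1(\mathbb{R}^d)$ and $L^\infty(\mathbb{R}^d)$ norms.
   Formalization: The printed bound with C depending only on γ and α is false (rescale V(x)=φ(x/L), t=L^α, L→0); the right-hand side here carries the extra factor max{1,M}, where M is the Hölder constant, so for M≤1 it is the printed inequality. *)

theory Defs
  imports "HOL-Probability.Probability" "HOL-Library.Landau_Symbols"
begin

text \<open>
  The dimension \<open>d\<close> has to range inside the scope of the existential quantifier over the constant
  \<open>C(\<gamma>, \<alpha>)\<close>, so it cannot be a type. The Euclidean space of dimension \<open>d\<close> is therefore the finite
  product measure space below: its points are the functions \<open>nat \<Rightarrow> real\<close> that are \<open>undefined\<close>
  outside \<open>{..<d}\<close>. On this carrier the topology of the type \<open>nat \<Rightarrow> real\<close> is the Euclidean one.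
\<close>

definition euclid :: "nat \<Rightarrow> (nat \<Rightarrow> real) measure" where
  "euclid d = (\<Pi>\<^sub>M i\<in>{..<d}. lborel)"

definition vdiff :: "nat \<Rightarrow> (nat \<Rightarrow> real) \<Rightarrow> (nat \<Rightarrow> real) \<Rightarrow> nat \<Rightarrow> real" where
  "vdiff d x y = (\<lambda>i\<in>{..<d}. x i - y i)"

definition vnorm :: "nat \<Rightarrow> (nat \<Rightarrow> real) \<Rightarrow> real" where
  "vnorm d x = L2_set x {..<d}"

definition vinner :: "nat \<Rightarrow> (nat \<Rightarrow> real) \<Rightarrow> (nat \<Rightarrow> real) \<Rightarrow> real" where
  "vinner d x y = (\<Sum>i<d. x i * y i)"

definition L1_norm :: "nat \<Rightarrow> ((nat \<Rightarrow> real) \<Rightarrow> real) \<Rightarrow> real" where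
  "L1_norm d V = (\<integral>x. \<bar>V x\<bar> \<partial>euclid d)"

definition in_Linfty :: "nat \<Rightarrow> ((nat \<Rightarrow> real) \<Rightarrow> real) \<Rightarrow> bool" where
  "in_Linfty d V \<longleftrightarrow>
     V \<in> borel_measurable (euclid d) \<and> esssup (euclid d) (\<lambda>x. ereal \<bar>V x\<bar>) < \<infinity>"

definition Linfty_norm :: "nat \<Rightarrow> ((nat \<Rightarrow> real) \<Rightarrow> real) \<Rightarrow> real" where
  "Linfty_norm d V = real_of_ereal (esssup (euclid d) (\<lambda>x. ereal \<bar>V x\<bar>))"

definition uniformly_Hoelder :: "nat \<Rightarrow> real \<Rightarrow> real \<Rightarrow> ((nat \<Rightarrow> real) \<Rightarrow> real) \<Rightarrow> bool" where
  "uniformly_Hoelder d M \<gamma> V \<longleftrightarrow>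
     (\<forall>x\<in>space (euclid d). \<forall>y\<in>space (euclid d).
        \<bar>V x - V y\<bar> \<le> M * vnorm d (vdiff d x y) powr \<gamma>)"

text \<open>
  The transition densities are the continuous nonnegative functions with the prescribed Fourier
  transform. Continuity makes them unique pointwise on the carrier, and not only up to null sets.
\<close>

definition stable_densities ::
    "nat \<Rightarrow> real \<Rightarrow> (real \<Rightarrow> (nat \<Rightarrow> real) \<Rightarrow> real) \<Rightarrow> bool" where
  "stable_densities d \<alpha> p \<longleftrightarrow>
     (\<forall>t>0.
        integrable (euclid d) (p t) \<and>
        continuous_on (space (euclid d)) (p t) \<and>
        (\<forall>x\<in>space (euclid d). 0 \<le> p t x) \<and>
        (\<forall>\<xi>\<in>space (euclid d).
           (\<integral>y. exp (- \<i> * complex_of_real (vinner d y \<xi>)) * complex_of_real (p t y) \<partial>euclid d)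
             = complex_of_real (exp (- t * vnorm d \<xi> powr \<alpha>))))"

definition cadlag_on :: "real \<Rightarrow> (real \<Rightarrow> nat \<Rightarrow> real) \<Rightarrow> bool" where
  "cadlag_on t \<omega> \<longleftrightarrow>
     (\<forall>s. 0 \<le> s \<and> s < t \<longrightarrow> (\<omega> \<longlongrightarrow> \<omega> s) (at_right s)) \<and>
     (\<forall>s. 0 < s \<and> s \<le> t \<longrightarrow> (\<exists>l. (\<omega> \<longlongrightarrow> l) (at_left s)))"

text \<open>
  A bridge from \<open>x\<close> to \<open>y\<close> of length \<open>t\<close> is a probability measure on a set of cadlag paths, with the
  coordinate process. The times \<open>0 = s 0 < s 1 < \<dots> < s (k + 1) = t\<close> are listed in increasing order,
  so that \<open>z 0 = x\<close> is the position at time \<open>0\<close> and \<open>z (k + 1) = y\<close> the one at time \<open>t\<close>. (Listing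
  the times in decreasing order with the same endpoints gives the law of the time-reversed bridge,
  which by symmetry of \<open>p\<close> is the bridge from \<open>y\<close> to \<open>x\<close>.)
\<close>

definition stable_bridge ::
    "nat \<Rightarrow> (real \<Rightarrow> (nat \<Rightarrow> real) \<Rightarrow> real) \<Rightarrow> real \<Rightarrow> (nat \<Rightarrow> real) \<Rightarrow> (nat \<Rightarrow> real) \<Rightarrow>
     (real \<Rightarrow> nat \<Rightarrow> real) measure \<Rightarrow> bool" where
  "stable_bridge d p t x y P \<longleftrightarrow>
     prob_space P \<and>
     (\<forall>\<omega>\<in>space P. cadlag_on t \<omega>) \<and>
     (\<forall>s\<in>{0..t}. (\<lambda>\<omega>. \<omega> s) \<in> P \<rightarrow>\<^sub>M euclid d) \<and>
     (AE \<omega> in P. \<omega> 0 = x) \<and> (AE \<omega> in P. \<omega> t = y) \<and>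
     (\<forall>k\<ge>1. \<forall>s :: nat \<Rightarrow> real.
        s 0 = 0 \<and> s (k + 1) = t \<and> (\<forall>j\<le>k. s j < s (j + 1)) \<longrightarrow>
        distributed P (\<Pi>\<^sub>M j\<in>{1..k}. euclid d) (\<lambda>\<omega>. \<lambda>j\<in>{1..k}. \<omega> (s j))
          (\<lambda>w. let z = w(0 := x, k + 1 := y) in
             ennreal (1 / p t (vdiff d x y) *
               (\<Prod>j\<le>k. p (s (j + 1) - s j) (vdiff d (z j) (z (j + 1)))))))"

definition stable_bridges ::
    "nat \<Rightarrow> (real \<Rightarrow> (nat \<Rightarrow> real) \<Rightarrow> real) \<Rightarrow>
     (real \<Rightarrow> (nat \<Rightarrow> real) \<Rightarrow> (nat \<Rightarrow> real) \<Rightarrow> (real \<Rightarrow> nat \<Rightarrow> real) measure) \<Rightarrow> bool" where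
  "stable_bridges d p P \<longleftrightarrow>
     (\<forall>t>0. \<forall>x\<in>space (euclid d). \<forall>y\<in>space (euclid d). stable_bridge d p t x y (P t x y))"

text \<open>The heat kernel of the Schroedinger semigroup, given by the Feynman-Kac formula.\<close>

definition schroedinger_kernel ::
    "nat \<Rightarrow> (real \<Rightarrow> (nat \<Rightarrow> real) \<Rightarrow> real) \<Rightarrow>
     (real \<Rightarrow> (nat \<Rightarrow> real) \<Rightarrow> (nat \<Rightarrow> real) \<Rightarrow> (real \<Rightarrow> nat \<Rightarrow> real) measure) \<Rightarrow>
     ((nat \<Rightarrow> real) \<Rightarrow> real) \<Rightarrow> real \<Rightarrow> (nat \<Rightarrow> real) \<Rightarrow> (nat \<Rightarrow> real) \<Rightarrow> real" where
  "schroedinger_kernel d p P V t x y =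
     p t (vdiff d x y) * (\<integral>\<omega>. exp (- (LINT s:{0..t}|lborel. V (\<omega> s))) \<partial>P t x y)"

definition heat_content ::
    "nat \<Rightarrow> (real \<Rightarrow> (nat \<Rightarrow> real) \<Rightarrow> real) \<Rightarrow>
     (real \<Rightarrow> (nat \<Rightarrow> real) \<Rightarrow> (nat \<Rightarrow> real) \<Rightarrow> (real \<Rightarrow> nat \<Rightarrow> real) measure) \<Rightarrow>
     ((nat \<Rightarrow> real) \<Rightarrow> real) \<Rightarrow> real \<Rightarrow> real" where
  "heat_content d p P V t =
     (\<integral>y. (\<integral>x. schroedinger_kernel d p P V t x y - p t (vdiff d x y) \<partial>euclid d) \<partial>euclid d)"

end

theory Submission
  imports Defs
begin

text \<open>
  Expanding \<open>exp (- A)\<close> for the action \<open>A\<close>, the integral of \<open>V\<close> along the bridge, to second order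
  leaves a cubic remainder, which gives the term with \<open>t ^ 3\<close>. Integrating out the end points turns
  the mean of \<open>V (X s) * V (X r)\<close> into the integral \<open>I u\<close> of the autocorrelation of \<open>V\<close> against the
  density \<open>p u\<close> with \<open>u = \<bar>s - r\<bar>\<close>, so that everything rests on the bound
  \<open>\<integral>V\<^sup>2 - I u \<le> c * M * \<parallel>V\<parallel>\<^sub>1 * u powr (\<gamma> / \<alpha>)\<close> with \<open>c\<close> independent of the dimension.

  Estimating \<open>\<bar>V x - V y\<bar>\<close> by \<open>M * \<bar>x - y\<bar> powr \<gamma>\<close> under the integral is not enough, since the moment
  of order \<open>\<gamma>\<close> of \<open>p u\<close> grows with the dimension. For Gaussian increments of scale \<open>\<tau>\<close> the bound
  (with \<open>\<tau> powr \<gamma>\<close>) follows instead from concentration of measure. Cut \<open>V\<close> at the height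
  \<open>c = M * \<tau> powr \<gamma>\<close>. The part below \<open>c\<close> has squared norm at most \<open>c * \<parallel>V\<parallel>\<^sub>1\<close>. The part above lives on
  a set of measure at most \<open>\<parallel>V\<parallel>\<^sub>1 / c\<close>, and Maurey's property \<open>(\<tau>)\<close> of the Gaussian measure bounds
  its local variance by a multiple of \<open>c\<^sup>2\<close> times the Gaussian mass of this set. Finally,
  \<open>1 - exp (- \<bar>\<xi>\<bar> powr \<alpha>)\<close> is at most a convergent dyadic sum of the functions \<open>1 - exp (- \<tau>\<^sup>2 * \<bar>\<xi>\<bar>\<^sup>2)\<close>, and since
  the autocorrelation is positive definite this carries the bound from Gaussian to stable increments.
\<close>

section \<open>Lebesgue measure on the finite product space\<close>

text \<open>What makes property (\<tau>) fit Hoelder functions is the inequality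
  \<open>q powr \<gamma> \<le> 1 + q\<^sup>2 / 4\<close>: the quadratic part is exactly the cost
  that the property allows, and the excess 1 is charged only on the support of the function, so the
  price is the mass of that support and no dimension enters. Averaged over all base points the local
  variance becomes, up to a factor, \<open>\<integral>V\<^sup>2\<close> minus the mean
  autocorrelation. This is affine in the law of the increment, so comparing two increments is a
  question of signs of Fourier transforms. The dyadic weights are
  \<open>2 powr (- \<alpha> * k / 2)\<close> at scales growing like \<open>2 powr (k / 2)\<close>;
  the resulting errors have ratio \<open>2 powr ((\<gamma> - \<alpha>) / 2)\<close>, less than 1
  because \<open>\<gamma> < \<alpha>\<close>, and this ratio is the only way \<gamma> and \<alpha>
  enter the constant. A separate obstacle is measurability: nothing is assumed about how
  \<open>P t x y\<close> depends on \<open>x\<close> and \<open>y\<close>, and coordinates are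
  measurable only at fixed times. Right continuity reduces everything to finitely many times, where
  the explicit densities settle it.\<close>

definition vadd :: "nat \<Rightarrow> (nat \<Rightarrow> real) \<Rightarrow> (nat \<Rightarrow> real) \<Rightarrow> nat \<Rightarrow> real" where
  "vadd d x z = (\<lambda>i\<in>{..<d}. x i + z i)"

interpretation lborel_product: product_sigma_finite "\<lambda>_::nat. lborel :: real measure"
  by (simp add: product_sigma_finite_def lborel.sigma_finite_measure_axioms)

lemma space_euclid: "space (euclid d) = extensional {..<d}"
  by (simp add: euclid_def space_PiM PiE_UNIV_domain PiE_def)

lemma sigma_finite_euclid: "sigma_finite_measure (euclid d)"
  unfolding euclid_def by (rule lborel_product.sigma_finite) simp

interpretation euclid: sigma_finite_measure "euclid d" for d
  by (rule sigma_finite_euclid)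

interpretation euclid2: pair_sigma_finite "euclid d" "euclid d" for d
  by standard

lemma measurable_euclid_component [measurable]:
  "i < d \<Longrightarrow> (\<lambda>x. x i) \<in> borel_measurable (euclid d)"
  unfolding euclid_def by (rule measurable_component_singleton[where M="\<lambda>_. lborel", simplified]) simp

lemma measurable_euclidI:
  assumes "\<And>i. i < d \<Longrightarrow> (\<lambda>x. f x i) \<in> borel_measurable M"
    and "\<And>x. x \<in> space M \<Longrightarrow> f x \<in> extensional {..<d}"
  shows "f \<in> M \<rightarrow>\<^sub>M euclid d"
  unfolding euclid_def using assms
  by (intro measurable_PiM_single') (auto simp: PiE_def)

lemma measurable_euclid_compose:
  assumes "f \<in> M \<rightarrow>\<^sub>M euclid d" "i < d"
  shows "(\<lambda>x. f x i) \<in> borel_measurable M"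
  using measurable_compose[OF assms(1) measurable_euclid_component[OF assms(2)]] .

lemma measurable_vdiff [measurable (raw)]:
  assumes "f \<in> M \<rightarrow>\<^sub>M euclid d" "g \<in> M \<rightarrow>\<^sub>M euclid d"
  shows "(\<lambda>x. vdiff d (f x) (g x)) \<in> M \<rightarrow>\<^sub>M euclid d"
proof (rule measurable_euclidI)
  fix i assume "i < d"
  then have [measurable]: "(\<lambda>x. f x i) \<in> borel_measurable M" "(\<lambda>x. g x i) \<in> borel_measurable M"
    using assms measurable_euclid_compose by blast+
  show "(\<lambda>x. vdiff d (f x) (g x) i) \<in> borel_measurable M"
    using \<open>i < d\<close> by (simp add: vdiff_def)
qed (simp add: vdiff_def)

lemma measurable_vadd [measurable (raw)]:
  assumes "f \<in> M \<rightarrow>\<^sub>M euclid d" "g \<in> M \<rightarrow>\<^sub>M euclid d"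
  shows "(\<lambda>x. vadd d (f x) (g x)) \<in> M \<rightarrow>\<^sub>M euclid d"
proof (rule measurable_euclidI)
  fix i assume "i < d"
  then have [measurable]: "(\<lambda>x. f x i) \<in> borel_measurable M" "(\<lambda>x. g x i) \<in> borel_measurable M"
    using assms measurable_euclid_compose by blast+
  show "(\<lambda>x. vadd d (f x) (g x) i) \<in> borel_measurable M"
    using \<open>i < d\<close> by (simp add: vadd_def)
qed (simp add: vadd_def)

lemma measurable_vinner [measurable (raw)]:
  assumes "f \<in> M \<rightarrow>\<^sub>M euclid d" "g \<in> M \<rightarrow>\<^sub>M euclid d"
  shows "(\<lambda>x. vinner d (f x) (g x)) \<in> borel_measurable M"
  unfolding vinner_def
  by (intro borel_measurable_sum borel_measurable_times measurable_euclid_compose[OF assms(1)]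
      measurable_euclid_compose[OF assms(2)]) auto

lemma measurable_vnorm [measurable (raw)]:
  assumes "f \<in> M \<rightarrow>\<^sub>M euclid d"
  shows "(\<lambda>x. vnorm d (f x)) \<in> borel_measurable M"
  unfolding vnorm_def L2_set_def
  using measurable_euclid_compose[OF assms]
  by (auto intro!: measurable_compose[OF _ borel_measurable_sqrt] borel_measurable_sum borel_measurable_power)

lemma vdiff_in_euclid [simp, intro]: "vdiff d x y \<in> space (euclid d)"
  by (simp add: space_euclid vdiff_def)

lemma vadd_in_euclid [simp, intro]: "vadd d x y \<in> space (euclid d)"
  by (simp add: space_euclid vadd_def)

lemma vnorm_nonneg [simp]: "0 \<le> vnorm d x"
  by (simp add: vnorm_def L2_set_nonneg)

lemma vnorm_power2: "(vnorm d x)\<^sup>2 = (\<Sum>i<d. (x i)\<^sup>2)"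
  by (simp add: vnorm_def L2_set_def sum_nonneg)

lemma vadd_vdiff_cancel: "x \<in> space (euclid d) \<Longrightarrow> vdiff d (vadd d x y) y = x"
  by (auto simp: vdiff_def vadd_def fun_eq_iff space_euclid extensional_def)

text \<open>Boxes determine a product of sigma-finite measures, and the preimage of a box under a
  map acting coordinate by coordinate is again a box. With shifts and reflections on each axis this
  yields the translation and reflection invariance of \<open>euclid d\<close>.\<close>

lemma distr_PiM_componentwise:
  fixes M :: "'i \<Rightarrow> 'a measure"
  assumes "product_sigma_finite M" and I: "finite I"
    and T: "\<And>i. i \<in> I \<Longrightarrow> T i \<in> M i \<rightarrow>\<^sub>M M i" "\<And>i. i \<in> I \<Longrightarrow> distr (M i) (M i) (T i) = M i"
  shows "distr (PiM I M) (PiM I M) (\<lambda>x. \<lambda>i\<in>I. T i (x i)) = PiM I M"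
proof -
  interpret product_sigma_finite M by fact
  have meas: "(\<lambda>x. \<lambda>i\<in>I. T i (x i)) \<in> PiM I M \<rightarrow>\<^sub>M PiM I M"
    by (intro measurable_restrict measurable_compose[OF measurable_component_singleton]) (auto intro: T(1))
  show ?thesis
  proof (rule PiM_eqI[OF I])
    fix A assume A: "\<And>i. i \<in> I \<Longrightarrow> A i \<in> sets (M i)"
    have "emeasure (distr (PiM I M) (PiM I M) (\<lambda>x. \<lambda>i\<in>I. T i (x i))) (Pi\<^sub>E I A)
        = emeasure (PiM I M) (Pi\<^sub>E I (\<lambda>i. T i -` A i \<inter> space (M i)))"
      using A T(1)[THEN measurable_space]
      by (subst emeasure_distr[OF meas])
         (auto intro!: sets_PiM_I_finite I arg_cong[where f="emeasure _"]
           simp: space_PiM PiE_iff extensional_def split: if_splits)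
    also have "\<dots> = (\<Prod>i\<in>I. emeasure (M i) (T i -` A i \<inter> space (M i)))"
      using A T(1) by (intro emeasure_PiM I) (auto intro: measurable_sets)
    also have "\<dots> = (\<Prod>i\<in>I. emeasure (M i) (A i))"
      using A T by (intro prod.cong refl) (metis emeasure_distr)
    finally show "emeasure (distr (PiM I M) (PiM I M) (\<lambda>x. \<lambda>i\<in>I. T i (x i))) (Pi\<^sub>E I A)
        = (\<Prod>i\<in>I. emeasure (M i) (A i))" .
  qed simp
qed

lemma distr_lborel_reflect: "distr lborel lborel (\<lambda>y. c - y) = (lborel :: real measure)"
  using lborel_real_affine[of "-1" c]
  by (simp add: density_1 one_ennreal_def[symmetric] cong: distr_cong)

lemma distr_lborel_shift: "distr lborel lborel (\<lambda>y. y + c) = (lborel :: real measure)"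
  using lborel_real_affine[of 1 c]
  by (simp add: density_1 one_ennreal_def[symmetric] add.commute cong: distr_cong)

lemma distr_euclid_vadd: "distr (euclid d) (euclid d) (\<lambda>x. vadd d x z) = euclid d"
  unfolding euclid_def vadd_def
  by (rule distr_PiM_componentwise)
     (auto simp: distr_lborel_shift lborel_product.product_sigma_finite_axioms)

lemma distr_euclid_vdiff1: "distr (euclid d) (euclid d) (\<lambda>x. vdiff d x z) = euclid d"
  unfolding euclid_def vdiff_def diff_conv_add_uminus
  by (rule distr_PiM_componentwise)
     (auto simp: distr_lborel_shift simp del: add_uminus_conv_diff simp: lborel_product.product_sigma_finite_axioms)

lemma distr_euclid_vdiff2: "distr (euclid d) (euclid d) (\<lambda>x. vdiff d z x) = euclid d"
  unfolding euclid_def vdiff_def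
  by (rule distr_PiM_componentwise)
     (auto simp: distr_lborel_reflect lborel_product.product_sigma_finite_axioms)

lemmas distr_euclid = distr_euclid_vadd distr_euclid_vdiff1 distr_euclid_vdiff2

lemma
  shows measurable_vadd_const [measurable]: "(\<lambda>x. vadd d x z) \<in> euclid d \<rightarrow>\<^sub>M euclid d"
    and measurable_vadd_const' [measurable]: "(\<lambda>x. vadd d z x) \<in> euclid d \<rightarrow>\<^sub>M euclid d"
    and measurable_vdiff1_const [measurable]: "(\<lambda>x. vdiff d x z) \<in> euclid d \<rightarrow>\<^sub>M euclid d"
    and measurable_vdiff2_const [measurable]: "(\<lambda>x. vdiff d z x) \<in> euclid d \<rightarrow>\<^sub>M euclid d"
  by (rule measurable_euclidI; simp add: vadd_def vdiff_def)+

lemma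
  assumes f: "f \<in> borel_measurable (euclid d)"
  shows nn_integral_euclid_vadd: "(\<integral>\<^sup>+x. f (vadd d x z) \<partial>euclid d) = (\<integral>\<^sup>+x. f x \<partial>euclid d)"
    and nn_integral_euclid_vdiff2: "(\<integral>\<^sup>+x. f (vdiff d z x) \<partial>euclid d) = (\<integral>\<^sup>+x. f x \<partial>euclid d)"
  using f nn_integral_distr[of "\<lambda>x. vadd d x z" "euclid d" "euclid d" f]
    nn_integral_distr[of "\<lambda>x. vdiff d z x" "euclid d" "euclid d" f]
  by (simp_all add: distr_euclid measurable_vadd_const measurable_vdiff1_const measurable_vdiff2_const)

lemma
  fixes f :: "(nat \<Rightarrow> real) \<Rightarrow> real"
  assumes f: "f \<in> borel_measurable (euclid d)"
  shows integral_euclid_vadd: "(\<integral>x. f (vadd d x z) \<partial>euclid d) = (\<integral>x. f x \<partial>euclid d)"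
    and integral_euclid_vdiff1: "(\<integral>x. f (vdiff d x z) \<partial>euclid d) = (\<integral>x. f x \<partial>euclid d)"
    and integral_euclid_vdiff2: "(\<integral>x. f (vdiff d z x) \<partial>euclid d) = (\<integral>x. f x \<partial>euclid d)"
  using f integral_distr[of "\<lambda>x. vadd d x z" "euclid d" "euclid d" f]
    integral_distr[of "\<lambda>x. vdiff d x z" "euclid d" "euclid d" f]
    integral_distr[of "\<lambda>x. vdiff d z x" "euclid d" "euclid d" f]
  by (simp_all add: distr_euclid measurable_vadd_const measurable_vdiff1_const measurable_vdiff2_const)

lemma
  fixes f :: "(nat \<Rightarrow> real) \<Rightarrow> real"
  assumes f: "integrable (euclid d) f"
  shows integrable_euclid_vadd: "integrable (euclid d) (\<lambda>x. f (vadd d x z))"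
    and integrable_euclid_vdiff1: "integrable (euclid d) (\<lambda>x. f (vdiff d x z))"
    and integrable_euclid_vdiff2: "integrable (euclid d) (\<lambda>x. f (vdiff d z x))"
  using f integrable_distr[of "\<lambda>x. vadd d x z" "euclid d" "euclid d" f]
    integrable_distr[of "\<lambda>x. vdiff d x z" "euclid d" "euclid d" f]
    integrable_distr[of "\<lambda>x. vdiff d z x" "euclid d" "euclid d" f]
  by (simp_all add: distr_euclid measurable_vadd_const measurable_vdiff1_const measurable_vdiff2_const)

section \<open>Maurey's property for the Gaussian measure\<close>

text \<open>The supremum of \<open>A\<close> need not be attained, so the hypothesis asks only for
  cuts at points of \<open>A\<close>. The cuts at \<open>s - 1 / Suc n\<close> exhaust
  \<open>A\<close> except possibly for the single point \<open>s\<close>, which has measure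
  0.\<close>

lemma emeasure_lborel_le_by_initial_segments:
  fixes A :: "real set"
  assumes A [measurable]: "A \<in> sets borel" and "A \<noteq> {}" "bdd_above A"
    and le: "\<And>a. a \<in> A \<Longrightarrow> emeasure lborel (A \<inter> {..a}) + c \<le> Y"
  shows "emeasure lborel A + c \<le> Y"
proof -
  define s where "s = Sup A"
  define F where "F n = A \<inter> {..s - 1 / real (Suc n)}" for n
  have F_le: "emeasure lborel (F n) + c \<le> Y" for n
  proof -
    obtain a where a: "a \<in> A" "s - 1 / real (Suc n) < a"
      using assms(2,3) less_cSup_iff[of A "s - 1 / real (Suc n)"] by (auto simp: s_def)
    have "emeasure lborel (F n) \<le> emeasure lborel (A \<inter> {..a})"
      using a by (intro emeasure_mono) (auto simp: F_def)
    then show ?thesis using le[OF a(1)] by (meson add_right_mono order_trans)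
  qed
  have inc: "incseq F"
  proof (rule incseq_SucI)
    fix n
    have "1 / real (Suc (Suc n)) \<le> 1 / real (Suc n)" by (intro frac_le) auto
    then show "F n \<subseteq> F (Suc n)" by (fastforce simp: F_def)
  qed
  have U: "(\<Union>n. F n) = A \<inter> {..<s}"
  proof (intro equalityI subsetI)
    fix x assume x: "x \<in> A \<inter> {..<s}"
    then obtain n where "1 / real (Suc n) < s - x"
      using reals_Archimedean[of "s - x"] by (auto simp: inverse_eq_divide)
    then show "x \<in> (\<Union>n. F n)" using x by (auto simp: F_def intro!: exI[of _ n])
  next
    fix x assume "x \<in> (\<Union>n. F n)"
    then obtain n where n: "x \<in> A" "x \<le> s - 1 / real (Suc n)" by (auto simp: F_def)
    have "0 < 1 / real (Suc n)" by simp
    with n show "x \<in> A \<inter> {..<s}" by (auto intro: le_less_trans[OF n(2)])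
  qed
  have "(\<lambda>n. emeasure lborel (F n)) \<longlonglongrightarrow> emeasure lborel (\<Union>n. F n)"
    using inc by (intro Lim_emeasure_incseq) (auto simp: F_def[abs_def])
  then have lim: "(\<lambda>n. emeasure lborel (F n) + c) \<longlonglongrightarrow> emeasure lborel (A \<inter> {..<s}) + c"
    unfolding U by (intro tendsto_add tendsto_const)
  have "emeasure lborel A \<le> emeasure lborel ((A \<inter> {..<s}) \<union> {s})"
    using cSup_upper[OF _ \<open>bdd_above A\<close>] by (intro emeasure_mono) (force simp: s_def)+
  also have "\<dots> \<le> emeasure lborel (A \<inter> {..<s}) + emeasure lborel {s}"
    by (intro emeasure_subadditive) auto
  finally have "emeasure lborel A + c \<le> emeasure lborel (A \<inter> {..<s}) + c"
    by (simp add: add_right_mono)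
  also have "\<dots> \<le> Y"
    using lim F_le by (intro LIMSEQ_le_const2[OF lim]) auto
  finally show ?thesis .
qed

lemma emeasure_lborel_reflect:
  assumes "A \<in> sets borel"
  shows "emeasure lborel (uminus -` A :: real set) = emeasure lborel A"
proof -
  have "emeasure lborel A = emeasure (distr lborel borel uminus) A"
    by (simp add: lborel_distr_uminus)
  also have "\<dots> = emeasure lborel (uminus -` A)"
    using assms by (subst emeasure_distr) auto
  finally show ?thesis ..
qed

lemma emeasure_lborel_translate:
  assumes "A \<in> sets borel"
  shows "emeasure lborel ((\<lambda>x. x + c) -` A :: real set) = emeasure lborel A"
proof -
  have "emeasure lborel A = emeasure (distr lborel lborel (\<lambda>y. y + c)) A"
    by (simp add: distr_lborel_shift)
  also have "\<dots> = emeasure lborel ((\<lambda>x. x + c) -` A)"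
    using assms by (subst emeasure_distr) auto
  finally show ?thesis ..
qed

text \<open>The two translates below overlap in one point only.\<close>

lemma brunn_minkowski_1D:
  fixes A B I :: "real set"
  assumes [measurable]: "A \<in> sets borel" "B \<in> sets borel" "I \<in> sets borel"
    and ne: "A \<noteq> {}" "B \<noteq> {}" and bdd: "bdd_above A" "bdd_below B"
    and mid: "\<And>a b. a \<in> A \<Longrightarrow> b \<in> B \<Longrightarrow> (a + b) / 2 \<in> I"
  shows "emeasure lborel A + emeasure lborel B \<le> 2 * emeasure lborel I"
proof -
  \<comment> \<open>\<open>J\<close> is the dilate of \<open>I\<close> by 2; it contains every sum
    \<open>a + b\<close>, so translates of pieces of \<open>A\<close> and \<open>B\<close> can be
    packed into it.\<close>
  define J where "J = (\<lambda>x::real. x / 2) -` I"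
  have J [measurable]: "J \<in> sets borel"
    unfolding J_def by (rule measurable_sets_borel[where M=borel]) auto
  have J_eq: "emeasure lborel J = 2 * emeasure lborel I"
  proof -
    have "emeasure lborel I = (\<integral>\<^sup>+x. indicator I x \<partial>lborel)" by simp
    also have "\<dots> = ennreal (1/2) * (\<integral>\<^sup>+x. indicator I (0 + (1/2) * x) \<partial>lborel)"
      by (subst nn_integral_real_affine[of _ "1/2" 0]) (simp_all add: divide_ennreal_def)
    also have "(\<integral>\<^sup>+x. indicator I (0 + (1/2) * x) \<partial>lborel) = (\<integral>\<^sup>+x. indicator J x \<partial>lborel)"
      by (auto intro!: nn_integral_cong simp: J_def indicator_def)
    finally have "emeasure lborel I = ennreal (1/2) * emeasure lborel J" by simp
    then have "2 * emeasure lborel I = (ennreal 2 * ennreal (1/2)) * emeasure lborel J"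
      by (simp add: mult.assoc)
    also have "ennreal 2 * ennreal (1/2) = 1"
      by (subst ennreal_mult[symmetric]) auto
    finally show ?thesis by simp
  qed
  \<comment> \<open>Shifted by \<open>b\<close>, the part of \<open>A\<close> up to \<open>a\<close>
    ends at \<open>a + b\<close>; shifted by \<open>a\<close>, the part of \<open>B\<close> from
    \<open>b\<close> on starts there. Both lie in \<open>J\<close>, so their measures add
    up.\<close>
  have key: "emeasure lborel (A \<inter> {..a}) + emeasure lborel (B \<inter> {b..}) \<le> emeasure lborel J"
    if a: "a \<in> A" and b: "b \<in> B" for a b
  proof -
    let ?P = "(\<lambda>x. x + (- b)) -` (A \<inter> {..a})" and ?Q = "(\<lambda>x. x + (- a)) -` (B \<inter> {b..})"
    have [measurable]: "?P \<in> sets borel" "?Q \<in> sets borel"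
      by (rule measurable_sets_borel[where M=borel]; simp)+
    have sub: "?P \<union> ?Q \<subseteq> J"
    proof (intro Un_least subsetI)
      fix x assume "x \<in> ?P"
      then have "x - b \<in> A" by simp
      from mid[OF this b] show "x \<in> J" by (simp add: J_def)
    next
      fix x assume "x \<in> ?Q"
      then have "x - a \<in> B" by simp
      from mid[OF a this] show "x \<in> J" by (simp add: J_def)
    qed
    have "emeasure lborel (A \<inter> {..a}) + emeasure lborel (B \<inter> {b..}) = emeasure lborel ?P + emeasure lborel ?Q"
      by (subst (1 2) emeasure_lborel_translate) auto
    also have "emeasure lborel ?P \<le> emeasure lborel (?P - {a + b}) + emeasure lborel {a + b}"
      by (rule order_trans[OF emeasure_mono emeasure_subadditive]) auto
    also have "emeasure lborel (?P - {a + b}) + emeasure lborel {a + b} = emeasure lborel (?P - {a + b})"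
      by simp
    also have "emeasure lborel (?P - {a + b}) + emeasure lborel ?Q = emeasure lborel ((?P - {a + b}) \<union> ?Q)"
      by (intro plus_emeasure) auto
    also have "\<dots> \<le> emeasure lborel J"
      using sub by (intro emeasure_mono) auto
    finally show ?thesis by (simp add: add_right_mono)
  qed
  have 1: "emeasure lborel A + emeasure lborel (B \<inter> {b..}) \<le> emeasure lborel J" if "b \<in> B" for b
    by (rule emeasure_lborel_le_by_initial_segments[OF _ ne(1) bdd(1) key[OF _ that]]) auto
  \<comment> \<open>The infimum of \<open>B\<close> is reached by the same limit lemma after
    reflection at 0, with the full measure of \<open>A\<close> now in the role of the
    constant.\<close>
  let ?B = "uminus -` B"
  have [measurable]: "?B \<in> sets borel"
    by (rule measurable_sets_borel[where M=borel]) auto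
  have "emeasure lborel ?B + emeasure lborel A \<le> emeasure lborel J"
  proof (rule emeasure_lborel_le_by_initial_segments)
    show "?B \<noteq> {}" using ne(2) by (metis minus_minus vimageI2 equals0D equals0I)
    show "bdd_above ?B" 
    proof -
      from bdd(2) obtain m where "\<And>x. x \<in> B \<Longrightarrow> m \<le> x" by (auto simp: bdd_below_def)
      then show ?thesis by (intro bdd_aboveI[of _ "- m"]) (force simp: minus_le_iff)
    qed
    fix a assume "a \<in> ?B"
    then have "emeasure lborel A + emeasure lborel (B \<inter> {- a..}) \<le> emeasure lborel J"
      by (intro 1) auto
    moreover have "?B \<inter> {..a} = uminus -` (B \<inter> {- a..})" by auto
    ultimately show "emeasure lborel (?B \<inter> {..a}) + emeasure lborel A \<le> emeasure lborel J"
      by (simp add: emeasure_lborel_reflect add.commute del: vimage_Int)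
  qed simp
  then show ?thesis
    by (simp add: emeasure_lborel_reflect J_eq add.commute)
qed

text \<open>Only levels in \<open>{0<..<1}\<close> are integrated, because the level set inequality
  is available only below the common supremum 1 of the normalized functions. Hence the truncation
  \<open>min 1\<close>, which leaves \<open>f\<close> and \<open>g\<close> unchanged there and errs
  in the right direction for \<open>h\<close>.\<close>

lemma layer_cake_unit:
  fixes f :: "real \<Rightarrow> real"
  assumes [measurable]: "f \<in> borel_measurable borel" and "\<And>x. 0 \<le> f x"
  shows "(\<integral>\<^sup>+t. indicator {0<..<1} t * emeasure lborel {x. t < f x} \<partial>lborel)
    = (\<integral>\<^sup>+x. ennreal (min 1 (f x)) \<partial>lborel)"
proof -
  have "(\<integral>\<^sup>+t. indicator {0<..<1} t * emeasure lborel {x. t < f x} \<partial>lborel)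
      = (\<integral>\<^sup>+t. \<integral>\<^sup>+x. indicator {0<..<1} t * indicator {x. t < f x} x \<partial>lborel \<partial>lborel)"
    by (subst nn_integral_cmult) (auto simp: nn_integral_indicator)
  also have "\<dots> = (\<integral>\<^sup>+x. \<integral>\<^sup>+t. indicator {0<..<1} t * indicator {x. t < f x} x \<partial>lborel \<partial>lborel)"
    by (rule lborel_pair.Fubini') simp
  also have "\<dots> = (\<integral>\<^sup>+x. \<integral>\<^sup>+t. indicator {0<..<min 1 (f x)} t \<partial>lborel \<partial>lborel)"
    by (intro nn_integral_cong) (auto simp: indicator_def)
  also have "\<dots> = (\<integral>\<^sup>+x. ennreal (min 1 (f x)) \<partial>lborel)"
    using assms(2) by (intro nn_integral_cong) (auto simp: min_def)
  finally show ?thesis .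
qed

text \<open>Normalizing both suprema to 1 makes all level sets below 1 nonempty, so one-dimensional
  Brunn-Minkowski applies level by level: \<open>t < f a\<close> and \<open>t < g b\<close> force
  \<open>t < h\<close> at the midpoint. The result is an additive inequality, which implies the
  usual multiplicative one.\<close>

lemma prekopa_leindler_normalized:
  fixes f g h :: "real \<Rightarrow> real"
  assumes [measurable]: "f \<in> borel_measurable borel" "g \<in> borel_measurable borel" "h \<in> borel_measurable borel"
    and f: "\<And>x. 0 \<le> f x" "\<And>x. f x \<le> 1" "\<And>t. t < 1 \<Longrightarrow> \<exists>x. t < f x"
    and g: "\<And>x. 0 \<le> g x" "\<And>x. g x \<le> 1" "\<And>t. t < 1 \<Longrightarrow> \<exists>x. t < g x"
    and h: "\<And>x. 0 \<le> h x" "\<And>t. 0 < t \<Longrightarrow> bounded {x. t < h x}"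
    and le: "\<And>x y. f x * g y \<le> (h ((x + y) / 2))\<^sup>2"
  shows "(\<integral>\<^sup>+x. f x \<partial>lborel) + (\<integral>\<^sup>+x. g x \<partial>lborel) \<le> 2 * (\<integral>\<^sup>+x. h x \<partial>lborel)"
proof -
  have lev: "emeasure lborel {x. t < f x} + emeasure lborel {x. t < g x} \<le> 2 * emeasure lborel {x. t < h x}"
    if t: "0 < t" "t < 1" for t
  proof (rule brunn_minkowski_1D)
    show ne: "{x. t < f x} \<noteq> {}" "{x. t < g x} \<noteq> {}" using f(3) g(3) t by auto
    have mid: "t < h ((a + b) / 2)" if "t < f a" "t < g b" for a b
    proof -
      have "t\<^sup>2 < f a * g b"
        using that t by (simp add: power2_eq_square mult_strict_mono)
      also have "\<dots> \<le> (h ((a + b) / 2))\<^sup>2" by (rule le)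
      finally show ?thesis using h(1) by (rule power2_less_imp_less)
    qed
    then show "\<And>a b. a \<in> {x. t < f x} \<Longrightarrow> b \<in> {x. t < g x} \<Longrightarrow> (a + b) / 2 \<in> {x. t < h x}" by auto
    \<comment> \<open>Bounded levels of \<open>h\<close> bound all midpoints; holding one point
      fixed bounds the other level set.\<close>
    obtain r where r: "\<And>x. t < h x \<Longrightarrow> \<bar>x\<bar> \<le> r"
      using h(2)[OF t(1)] by (auto simp: bounded_iff)
    obtain a0 b0 where ab: "t < f a0" "t < g b0" using ne by auto
    show "bdd_above {x. t < f x}"
    proof (rule bdd_aboveI)
      fix x assume "x \<in> {x. t < f x}"
      then have "\<bar>(x + b0) / 2\<bar> \<le> r" using ab by (intro r mid) auto
      then show "x \<le> 2 * r - b0" by (simp add: abs_le_iff)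
    qed
    show "bdd_below {x. t < g x}"
    proof (rule bdd_belowI)
      fix x assume "x \<in> {x. t < g x}"
      then have "\<bar>(a0 + x) / 2\<bar> \<le> r" using ab by (intro r mid) auto
      then show "- 2 * r - a0 \<le> x" by (simp add: abs_le_iff)
    qed
  qed simp_all
  have "(\<integral>\<^sup>+x. f x \<partial>lborel) + (\<integral>\<^sup>+x. g x \<partial>lborel)
      = (\<integral>\<^sup>+x. ennreal (min 1 (f x)) \<partial>lborel) + (\<integral>\<^sup>+x. ennreal (min 1 (g x)) \<partial>lborel)"
    using f g by (simp add: min_absorb2)
  also have "\<dots> = (\<integral>\<^sup>+t. indicator {0<..<1} t * emeasure lborel {x. t < f x}
       + indicator {0<..<1} t * emeasure lborel {x. t < g x} \<partial>lborel)"
    by (subst nn_integral_add) (simp_all add: layer_cake_unit f g)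
  also have "\<dots> \<le> (\<integral>\<^sup>+t. 2 * (indicator {0<..<1} t * emeasure lborel {x. t < h x}) \<partial>lborel)"
    using lev by (intro nn_integral_mono) (auto simp: indicator_def)
  also have "\<dots> = 2 * (\<integral>\<^sup>+x. ennreal (min 1 (h x)) \<partial>lborel)"
    by (subst nn_integral_cmult) (simp_all add: layer_cake_unit h)
  also have "\<dots> \<le> 2 * (\<integral>\<^sup>+x. h x \<partial>lborel)"
    by (intro mult_left_mono nn_integral_mono ennreal_leI) auto
  finally show ?thesis .
qed

section \<open>Property (\<tau>) on the real line\<close>

lemma bounded_level_normal_density:
  assumes "0 < \<tau>" "0 < t" "0 \<le> c"
  shows "bounded {x. t < c * normal_density 0 \<tau> x}"
proof -
  define C where "C = c * (1 / sqrt (2 * pi * \<tau>\<^sup>2))"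
  have C: "0 \<le> C" using assms by (simp add: C_def)
  have "x\<^sup>2 \<le> 2 * \<tau>\<^sup>2 * (C / t)" if "t < c * normal_density 0 \<tau> x" for x
  proof -
    define y where "y = x\<^sup>2 / (2 * \<tau>\<^sup>2)"
    have y: "0 \<le> y" by (simp add: y_def)
    have "t < C * exp (- y)"
      using that by (simp add: C_def normal_density_def y_def)
    then have "t * exp y < C" by (simp add: exp_minus field_simps)
    moreover have "t * y \<le> t * exp y"
      using assms exp_ge_add_one_self[of y] y by (intro mult_left_mono) linarith+
    ultimately have "t * y \<le> C" by simp
    then show ?thesis using assms by (simp add: y_def field_simps)
  qed
  then have "\<bar>x\<bar> \<le> sqrt (2 * \<tau>\<^sup>2 * (C / t))" if "t < c * normal_density 0 \<tau> x" for x
    using real_sqrt_le_mono[OF \<open>\<And>x. _ \<Longrightarrow> x\<^sup>2 \<le> _\<close>[OF that]] by simp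
  then show ?thesis by (auto simp: bounded_iff)
qed


definition normal_measure :: "real \<Rightarrow> real measure" where
  "normal_measure \<tau> = density lborel (\<lambda>x. ennreal (normal_density 0 \<tau> x))"

lemma sets_normal_measure [simp, measurable_cong]: "sets (normal_measure \<tau>) = sets borel"
  by (simp add: normal_measure_def)

lemma space_normal_measure [simp]: "space (normal_measure \<tau>) = UNIV"
  by (simp add: normal_measure_def)

lemma prob_space_normal_measure: "0 < \<tau> \<Longrightarrow> prob_space (normal_measure \<tau>)"
  unfolding normal_measure_def by (rule prob_space_normal_density)

text \<open>
  Maurey's property \<open>(\<tau>)\<close>: the Prekopa-Leindler inequality for the three functions
  \<open>u \<cdot> \<phi>\<close>, \<open>v \<cdot> \<phi>\<close> and \<open>\<phi>\<close>, where \<open>\<phi>\<close> is the normal density.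
\<close>

lemma normal_measure_property_tau:
  fixes u v :: "real \<Rightarrow> ennreal"
  assumes \<tau>: "0 < \<tau>" and [measurable]: "u \<in> borel_measurable borel" "v \<in> borel_measurable borel"
    and le: "\<And>x y. u x * v y \<le> ennreal (exp ((x - y)\<^sup>2 / (4 * \<tau>\<^sup>2)))"
  shows "(\<integral>\<^sup>+x. u x \<partial>normal_measure \<tau>) * (\<integral>\<^sup>+x. v x \<partial>normal_measure \<tau>) \<le> 1"
proof -
  define \<phi> where "\<phi> = normal_density 0 \<tau>"
  have [measurable]: "\<phi> \<in> borel_measurable borel" by (simp add: \<phi>_def)
  have \<phi>_pos: "0 < \<phi> x" for x using \<tau> by (simp add: \<phi>_def normal_density_pos)
  \<comment> \<open>The parallelogram identity: the cost with denominator
    \<open>4 * \<tau>\<^sup>2\<close> is exactly the gap between the product of two Gaussian weights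
    and the squared weight at the midpoint.\<close>
  have \<phi>_mid: "\<phi> x * \<phi> y * exp ((x - y)\<^sup>2 / (4 * \<tau>\<^sup>2)) = (\<phi> ((x + y) / 2))\<^sup>2" for x y
  proof -
    have "exp (- (x\<^sup>2 / (2 * \<tau>\<^sup>2))) * exp (- (y\<^sup>2 / (2 * \<tau>\<^sup>2))) * exp ((x - y)\<^sup>2 / (4 * \<tau>\<^sup>2))
        = (exp (- (((x + y) / 2)\<^sup>2 / (2 * \<tau>\<^sup>2))))\<^sup>2"
      using \<tau> unfolding exp_double[symmetric] exp_add[symmetric]
      by (auto simp: field_simps power2_eq_square)
    then show ?thesis by (simp add: \<phi>_def normal_density_def power2_eq_square)
  qed
  define \<Phi> where "\<Phi> = 1 / sqrt (2 * pi * \<tau>\<^sup>2)"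
  have \<phi>_le: "\<phi> x \<le> \<Phi>" for x
    using \<tau> by (simp add: \<phi>_def normal_density_def \<Phi>_def divide_right_mono)
  define U where "U x = ennreal (\<phi> x) * u x" for x
  define V where "V x = ennreal (\<phi> x) * v x" for x
  have [measurable]: "U \<in> borel_measurable borel" "V \<in> borel_measurable borel"
    by (simp_all add: U_def[abs_def] V_def[abs_def])
  have UV: "U x * V y \<le> ennreal ((\<phi> ((x + y) / 2))\<^sup>2)" for x y
  proof -
    have "U x * V y = ennreal (\<phi> x * \<phi> y) * (u x * v y)"
      using \<phi>_pos[of x] \<phi>_pos[of y] by (simp add: U_def V_def ennreal_mult ac_simps)
    also have "\<dots> \<le> ennreal (\<phi> x * \<phi> y) * ennreal (exp ((x - y)\<^sup>2 / (4 * \<tau>\<^sup>2)))"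
      by (intro mult_left_mono le) auto
    also have "\<dots> = ennreal ((\<phi> ((x + y) / 2))\<^sup>2)"
      using \<phi>_pos[of x] \<phi>_pos[of y] by (simp add: ennreal_mult[symmetric] \<phi>_mid)
    finally show ?thesis .
  qed
  have int: "(\<integral>\<^sup>+x. u x \<partial>normal_measure \<tau>) = (\<integral>\<^sup>+x. U x \<partial>lborel)"
    "(\<integral>\<^sup>+x. v x \<partial>normal_measure \<tau>) = (\<integral>\<^sup>+x. V x \<partial>lborel)"
    unfolding normal_measure_def U_def V_def \<phi>_def by (simp_all add: nn_integral_density)
  show ?thesis
  proof (cases "(\<forall>x. U x = 0) \<or> (\<forall>x. V x = 0)")
    case True
    then show ?thesis by (auto simp: int)
  next
    case False
    then obtain x0 y0 where nz: "U x0 \<noteq> 0" "V y0 \<noteq> 0" by auto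
    \<comment> \<open>The bound holds for all pairs of points, so a single nonzero value of
      \<open>V\<close> bounds \<open>U\<close>, and vice versa. This makes both suprema finite
      although \<open>u\<close> and \<open>v\<close> themselves may be unbounded.\<close>
    have UV_le: "U x * V y \<le> ennreal (\<Phi>\<^sup>2)" for x y
      using UV[of x y] \<phi>_le[of "(x + y) / 2"] \<phi>_pos[of "(x + y) / 2"]
      by (meson ennreal_leI less_imp_le order_trans power_mono)
    define A where "A = (SUP x. U x)"
    define B where "B = (SUP x. V x)"
    have "A * V y0 = (SUP x. U x * V y0)" unfolding A_def by (simp add: SUP_mult_right_ennreal)
    also have "\<dots> \<le> ennreal (\<Phi>\<^sup>2)" by (intro SUP_least UV_le)
    finally have "A * V y0 < \<top>" by (simp add: order_le_less_trans)
    then have A_fin: "A < \<top>" using nz(2) by (auto simp: ennreal_mult_less_top)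
    have "U x0 * B = (SUP x. U x0 * V x)" unfolding B_def by (simp add: SUP_mult_left_ennreal)
    also have "\<dots> \<le> ennreal (\<Phi>\<^sup>2)" by (intro SUP_least UV_le)
    finally have "U x0 * B < \<top>" by (simp add: order_le_less_trans)
    then have B_fin: "B < \<top>" using nz(1) by (auto simp: ennreal_mult_less_top)
    have U_le: "U x \<le> A" and V_le: "V x \<le> B" for x
      by (auto simp: A_def B_def intro: SUP_upper)
    have A_pos: "0 < A" and B_pos: "0 < B"
      using U_le[of x0] V_le[of y0] nz by (auto simp: zero_less_iff_neq_zero)
    obtain a where a: "A = ennreal a" "0 < a"
      using A_fin A_pos by (cases A) auto
    obtain b where b: "B = ennreal b" "0 < b"
      using B_fin B_pos by (cases B) auto
    define f where "f x = enn2real (U x) / a" for x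
    define g where "g x = enn2real (V x) / b" for x
    \<comment> \<open>Dividing \<open>U\<close> and \<open>V\<close> by their suprema
      \<open>a\<close> and \<open>b\<close> forces the factor \<open>1 / sqrt (a * b)\<close> on the
      middle function, since the hypothesis compares a product with a square.\<close>
    define h where "h x = (1 / sqrt (a * b)) * \<phi> x" for x
    have U_f: "U x = ennreal a * ennreal (f x)" and V_g: "V x = ennreal b * ennreal (g x)" for x
      using le_less_trans[OF U_le A_fin, of x] le_less_trans[OF V_le B_fin, of x] a b
      by (simp_all add: f_def g_def ennreal_mult[symmetric])
    have [measurable]: "f \<in> borel_measurable borel" "g \<in> borel_measurable borel" "h \<in> borel_measurable borel"
      by (simp_all add: f_def[abs_def] g_def[abs_def] h_def[abs_def])
    have f0: "0 \<le> f x" and g0: "0 \<le> g x" for x using a b by (simp_all add: f_def g_def)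
    have main: "(\<integral>\<^sup>+x. f x \<partial>lborel) + (\<integral>\<^sup>+x. g x \<partial>lborel) \<le> 2 * (\<integral>\<^sup>+x. h x \<partial>lborel)"
    proof (rule prekopa_leindler_normalized)
      show "f x \<le> 1" for x
      proof -
        have "ennreal (a * f x) \<le> ennreal a"
          using U_le[of x] a f0 by (simp add: U_f ennreal_mult)
        then show ?thesis using a by (simp add: f0)
      qed
      show "g x \<le> 1" for x
      proof -
        have "ennreal (b * g x) \<le> ennreal b"
          using V_le[of x] b g0 by (simp add: V_g ennreal_mult)
        then show ?thesis using b by (simp add: g0)
      qed
      show "\<exists>x. t < f x" if "t < 1" for t
      proof (cases "t < 0")
        case True then show ?thesis using f0 less_le_trans by blast
      next
        case False
        then have "ennreal (a * t) < A" using that a by (simp add: a(1) ennreal_less_iff)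
        then obtain x where "ennreal (a * t) < U x" unfolding A_def by (auto simp: less_SUP_iff)
        then have "ennreal (a * t) < ennreal (a * f x)" using a f0 by (simp add: U_f ennreal_mult)
        then show ?thesis using a False by (auto simp: ennreal_less_iff)
      qed
      show "\<exists>x. t < g x" if "t < 1" for t
      proof (cases "t < 0")
        case True then show ?thesis using g0 less_le_trans by blast
      next
        case False
        then have "ennreal (b * t) < B" using that b by (simp add: b(1) ennreal_less_iff)
        then obtain x where "ennreal (b * t) < V x" unfolding B_def by (auto simp: less_SUP_iff)
        then have "ennreal (b * t) < ennreal (b * g x)" using b g0 by (simp add: V_g ennreal_mult)
        then show ?thesis using b False by (auto simp: ennreal_less_iff)
      qed
      show "0 \<le> h x" for x using a b \<phi>_pos[of x] by (simp add: h_def)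
      show "bounded {x. t < h x}" if "0 < t" for t
        unfolding h_def \<phi>_def using \<tau> that a b by (intro bounded_level_normal_density) auto
      show "f x * g y \<le> (h ((x + y) / 2))\<^sup>2" for x y
      proof -
        have "ennreal ((a * f x) * (b * g y)) \<le> ennreal ((\<phi> ((x + y) / 2))\<^sup>2)"
          using UV[of x y] a b f0 g0 by (simp add: U_f V_g ennreal_mult)
        then have "(a * f x) * (b * g y) \<le> (\<phi> ((x + y) / 2))\<^sup>2" by simp
        then show ?thesis using a b by (simp add: h_def power_divide field_simps)
      qed
    qed (use f0 g0 in auto)
    have "(\<integral>\<^sup>+x. h x \<partial>lborel) = ennreal (1 / sqrt (a * b)) * (\<integral>\<^sup>+x. ennreal (\<phi> x) \<partial>lborel)"
      using a b \<phi>_pos by (subst nn_integral_cmult[symmetric]) (auto simp: h_def ennreal_mult[symmetric] less_imp_le)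
    also have "(\<integral>\<^sup>+x. ennreal (\<phi> x) \<partial>lborel) = 1"
      unfolding \<phi>_def using \<tau> by (subst nn_integral_eq_integral) auto
    finally have h_int: "(\<integral>\<^sup>+x. h x \<partial>lborel) = ennreal (1 / sqrt (a * b))" by simp
    have sum_le: "(\<integral>\<^sup>+x. f x \<partial>lborel) + (\<integral>\<^sup>+x. g x \<partial>lborel) \<le> ennreal (2 / sqrt (a * b))"
      using main a b unfolding h_int by (simp add: ennreal_mult[symmetric] flip: ennreal_numeral)
    then have "(\<integral>\<^sup>+x. f x \<partial>lborel) < \<top>" "(\<integral>\<^sup>+x. g x \<partial>lborel) < \<top>"
      by (auto simp: order_le_less_trans ennreal_add_eq_top less_top[symmetric] top_unique)
    then obtain X Y where X: "(\<integral>\<^sup>+x. f x \<partial>lborel) = ennreal X" "0 \<le> X"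
      and Y: "(\<integral>\<^sup>+x. g x \<partial>lborel) = ennreal Y" "0 \<le> Y"
      by (metis enn2real_nonneg ennreal_enn2real)
    have "X + Y \<le> 2 / sqrt (a * b)"
      using sum_le a b X(2) Y(2) unfolding X(1) Y(1) by (simp flip: ennreal_plus)
    then have "(X + Y)\<^sup>2 \<le> (2 / sqrt (a * b))\<^sup>2" using X Y by (intro power_mono) auto
    then have "(X + Y)\<^sup>2 \<le> 4 / (a * b)" using a b by (simp add: power_divide)
    \<comment> \<open>The arithmetic-geometric mean inequality turns the additive bound into a
      product bound, in which the unknown suprema \<open>a\<close> and \<open>b\<close>
      cancel.\<close>
    moreover have "4 * (X * Y) \<le> (X + Y)\<^sup>2"
      using zero_le_power2[of "X - Y"] by (simp add: power2_eq_square algebra_simps)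
    ultimately have "X * Y \<le> 1 / (a * b)" by simp
    then have "(a * X) * (b * Y) \<le> 1" using a b by (simp add: field_simps)
    moreover have "(\<integral>\<^sup>+x. U x \<partial>lborel) = ennreal (a * X)" "(\<integral>\<^sup>+x. V x \<partial>lborel) = ennreal (b * Y)"
      unfolding U_f V_g using a b X Y by (simp_all add: nn_integral_cmult ennreal_mult)
    ultimately show ?thesis
      using a b X Y by (simp add: int ennreal_mult[symmetric])
  qed
qed

section \<open>The product Gaussian measure and tensorization of property (\<tau>)\<close>

definition gauss :: "nat \<Rightarrow> real \<Rightarrow> (nat \<Rightarrow> real) measure" where
  "gauss d \<tau> = (\<Pi>\<^sub>M i\<in>{..<d}. normal_measure \<tau>)"

lemma sets_gauss [simp, measurable_cong]: "sets (gauss d \<tau>) = sets (euclid d)"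
  unfolding gauss_def euclid_def by (intro sets_PiM_cong) auto

lemma space_gauss [simp]: "space (gauss d \<tau>) = space (euclid d)"
  by (rule sets_eq_imp_space_eq) simp

lemma prob_space_gauss:
  assumes "0 < \<tau>" shows "prob_space (gauss d \<tau>)"
  unfolding gauss_def using prob_space_normal_measure[OF assms] by (rule prob_space_PiM)

lemma measurable_fun_upd_euclid:
  "(\<lambda>(x, s). x(n := s)) \<in> euclid n \<Otimes>\<^sub>M borel \<rightarrow>\<^sub>M euclid (Suc n)"
proof (rule measurable_euclidI)
  fix i assume "i < Suc n"
  then consider "i = n" | "i < n" by linarith
  then show "(\<lambda>p. (case p of (x, s) \<Rightarrow> x(n := s)) i) \<in> borel_measurable (euclid n \<Otimes>\<^sub>M borel)"
    by cases (auto simp: split_beta' intro: measurable_euclid_compose measurable_fst)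
qed (auto simp: space_pair_measure space_euclid extensional_def)

text \<open>Squared distance is additive over coordinates, so the property tensorizes: with the last
  coordinates frozen at \<open>s\<close> and \<open>r\<close>, the induction hypothesis bounds the
  product of the partial integrals, and these satisfy the one-dimensional hypothesis. The constant
  stays 1 in every dimension.\<close>

lemma gauss_property_tau:
  fixes u v :: "(nat \<Rightarrow> real) \<Rightarrow> ennreal"
  assumes \<tau>: "0 < \<tau>" and "u \<in> borel_measurable (euclid d)" "v \<in> borel_measurable (euclid d)"
    and "\<And>x y. x \<in> space (euclid d) \<Longrightarrow> y \<in> space (euclid d) \<Longrightarrow>
      u x * v y \<le> ennreal (exp ((vnorm d (vdiff d x y))\<^sup>2 / (4 * \<tau>\<^sup>2)))"
  shows "(\<integral>\<^sup>+x. u x \<partial>gauss d \<tau>) * (\<integral>\<^sup>+x. v x \<partial>gauss d \<tau>) \<le> 1"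
  using assms(2-)
proof (induction d arbitrary: u v)
  case 0
  have "u (\<lambda>_. undefined) * v (\<lambda>_. undefined) \<le> 1"
    using "0.prems"(3)[of "\<lambda>_. undefined" "\<lambda>_. undefined"] by (simp add: space_euclid vnorm_def)
  then show ?case by (simp add: gauss_def PiM_empty nn_integral_count_space_finite)
next
  case (Suc n)
  interpret N: prob_space "normal_measure \<tau>" by (rule prob_space_normal_measure[OF \<tau>])
  interpret P: product_sigma_finite "\<lambda>_::nat. normal_measure \<tau>" ..
  interpret G: prob_space "gauss n \<tau>" by (rule prob_space_gauss[OF \<tau>])
  note [measurable] = Suc.prems(1,2) measurable_fun_upd_euclid
  have gauss_Suc: "gauss (Suc n) \<tau> = (\<Pi>\<^sub>M i\<in>insert n {..<n}. normal_measure \<tau>)"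
    by (simp add: gauss_def lessThan_Suc)
  have split: "(\<integral>\<^sup>+x. w x \<partial>gauss (Suc n) \<tau>) = (\<integral>\<^sup>+s. (\<integral>\<^sup>+x. w (x(n := s)) \<partial>gauss n \<tau>) \<partial>normal_measure \<tau>)"
    if "w \<in> borel_measurable (euclid (Suc n))" for w
  proof -
    have "w \<in> borel_measurable (gauss (Suc n) \<tau>)" using that by simp
    then show ?thesis
      unfolding gauss_Suc by (subst P.product_nn_integral_insert_rev) (auto simp: gauss_def)
  qed
  have meas: "(\<lambda>(s, x). w (x(n := s))) \<in> borel_measurable (borel \<Otimes>\<^sub>M gauss n \<tau>)"
    if "w \<in> borel_measurable (euclid (Suc n))" for w :: "(nat \<Rightarrow> real) \<Rightarrow> ennreal"
  proof -
    have "(\<lambda>(s, x). (x, s)) \<in> borel \<Otimes>\<^sub>M gauss n \<tau> \<rightarrow>\<^sub>M euclid n \<Otimes>\<^sub>M (borel :: real measure)"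
      by measurable
    from measurable_compose[OF measurable_compose[OF this measurable_fun_upd_euclid] that]
    show ?thesis by (simp add: split_beta')
  qed
  have meas': "(\<lambda>x. w (x(n := s))) \<in> borel_measurable (euclid n)"
    if "w \<in> borel_measurable (euclid (Suc n))" for w :: "(nat \<Rightarrow> real) \<Rightarrow> ennreal" and s
    using measurable_compose[OF measurable_Pair1'[of s borel "gauss n \<tau>"] meas[OF that]]
    by simp
  define U where "U s = (\<integral>\<^sup>+x. u (x(n := s)) \<partial>gauss n \<tau>)" for s
  define V where "V s = (\<integral>\<^sup>+x. v (x(n := s)) \<partial>gauss n \<tau>)" for s
  have [measurable]: "U \<in> borel_measurable borel" "V \<in> borel_measurable borel"
    unfolding U_def[abs_def] V_def[abs_def]
    by (intro G.borel_measurable_nn_integral meas Suc.prems(1,2))+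
  have "U s * V r \<le> ennreal (exp ((s - r)\<^sup>2 / (4 * \<tau>\<^sup>2)))" for s r
  proof -
    \<comment> \<open>The cost of the last coordinate is divided out of \<open>v\<close>, so that
      the cost left over is that of dimension \<open>n\<close>; it is multiplied back
      afterwards.\<close>
    define e where "e = exp ((s - r)\<^sup>2 / (4 * \<tau>\<^sup>2))"
    have e: "0 < e" by (simp add: e_def)
    have "(\<integral>\<^sup>+x. u (x(n := s)) \<partial>gauss n \<tau>) * (\<integral>\<^sup>+x. ennreal (1 / e) * v (x(n := r)) \<partial>gauss n \<tau>) \<le> 1"
    proof (rule Suc.IH[OF meas'[OF Suc.prems(1)]
          borel_measurable_times_ennreal[OF borel_measurable_const meas'[OF Suc.prems(2)]]])
      fix x y assume xy: "x \<in> space (euclid n)" "y \<in> space (euclid n)"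
      have sp: "x(n := s) \<in> space (euclid (Suc n))" "y(n := r) \<in> space (euclid (Suc n))"
        using xy by (auto simp: space_euclid extensional_def)
      have nrm: "(vnorm (Suc n) (vdiff (Suc n) (x(n := s)) (y(n := r))))\<^sup>2
          = (vnorm n (vdiff n x y))\<^sup>2 + (s - r)\<^sup>2"
        by (simp add: vnorm_power2 vdiff_def lessThan_Suc)
      have "u (x(n := s)) * (ennreal (1 / e) * v (y(n := r))) = ennreal (1 / e) * (u (x(n := s)) * v (y(n := r)))"
        by (simp add: ac_simps)
      also have "\<dots> \<le> ennreal (1 / e) * ennreal (exp (((vnorm n (vdiff n x y))\<^sup>2 + (s - r)\<^sup>2) / (4 * \<tau>\<^sup>2)))"
        by (rule mult_left_mono[OF Suc.prems(3)[OF sp, unfolded nrm]]) simp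
      also have "\<dots> = ennreal (exp ((vnorm n (vdiff n x y))\<^sup>2 / (4 * \<tau>\<^sup>2)))"
        using e by (simp add: ennreal_mult[symmetric] e_def add_divide_distrib exp_add)
      finally show "u (x(n := s)) * (ennreal (1 / e) * v (y(n := r)))
          \<le> ennreal (exp ((vnorm n (vdiff n x y))\<^sup>2 / (4 * \<tau>\<^sup>2)))" .
    qed
    then have "U s * (ennreal (1 / e) * V r) \<le> 1"
      using meas'[OF Suc.prems(2), of r] by (simp add: U_def V_def nn_integral_cmult)
    then have "ennreal e * (U s * (ennreal (1 / e) * V r)) \<le> ennreal e * 1"
      by (intro mult_left_mono) auto
    also have "ennreal e * (U s * (ennreal (1 / e) * V r)) = (ennreal e * ennreal (1 / e)) * (U s * V r)"
      by (simp only: ac_simps)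
    also have "ennreal e * ennreal (1 / e) = 1"
      using e by (subst ennreal_mult[symmetric]) auto
    finally show ?thesis by (simp add: e_def)
  qed
  then have "(\<integral>\<^sup>+s. U s \<partial>normal_measure \<tau>) * (\<integral>\<^sup>+s. V s \<partial>normal_measure \<tau>) \<le> 1"
    by (intro normal_measure_property_tau \<tau>) auto
  then show ?case
    by (simp add: split Suc.prems(1,2) U_def V_def)
qed

section \<open>The Gaussian energy of a Hoelder function\<close>

text \<open>For independent copies put \<open>b = X - X' - I\<close>. The hypothesis says that
  \<open>exp b\<close> has mean at most 1, while
  \<open>exp b \<ge> 1 + b + (max 0 b)\<^sup>2 / 2\<close> and \<open>b\<close> has mean minus that
  of \<open>I\<close>, as \<open>X\<close> and \<open>X'\<close> have the same law. Hence
  \<open>(max 0 b)\<^sup>2\<close> has mean at most twice that of \<open>I\<close>. The positive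
  part of \<open>X - X'\<close> is at most \<open>max 0 b + I\<close>, which gives the factor
  \<open>2 * 2 + 2 = 6\<close>, and exchanging the copies doubles it to 12.\<close>

lemma (in prob_space) square_diff_le_of_exp_product:
  fixes X I :: "'a \<Rightarrow> real"
  assumes [measurable]: "X \<in> borel_measurable M" "I \<in> borel_measurable M"
    and X: "\<And>x. x \<in> space M \<Longrightarrow> \<bar>X x\<bar> \<le> K" and I: "\<And>x. x \<in> space M \<Longrightarrow> I x = 0 \<or> I x = 1"
    and tau: "(\<integral>\<^sup>+x. exp (X x - I x) \<partial>M) * (\<integral>\<^sup>+x. exp (- X x) \<partial>M) \<le> 1"
  shows "(\<integral>\<^sup>+x. \<integral>\<^sup>+y. ennreal ((X x - X y)\<^sup>2) \<partial>M \<partial>M) \<le> 12 * (\<integral>\<^sup>+x. ennreal (I x) \<partial>M)"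
proof -
  interpret PP: pair_prob_space M M ..
  define b where "b p = X (fst p) - X (snd p) - I (fst p)" for p
  have [measurable]: "b \<in> borel_measurable (M \<Otimes>\<^sub>M M)" unfolding b_def[abs_def] by measurable
  have bnd: "\<bar>X (fst p)\<bar> \<le> K" "\<bar>X (snd p)\<bar> \<le> K" "\<bar>I (fst p)\<bar> \<le> 1" "0 \<le> I (fst p)"
    if "p \<in> space (M \<Otimes>\<^sub>M M)" for p
    using that X I[of "fst p"] by (auto simp: space_pair_measure)
  have b_bnd: "\<bar>b p\<bar> \<le> 2 * K + 1" if "p \<in> space (M \<Otimes>\<^sub>M M)" for p
    using bnd[OF that] by (auto simp: b_def abs_le_iff)
  have int: "integrable (M \<Otimes>\<^sub>M M) f"
    if [measurable]: "f \<in> borel_measurable (M \<Otimes>\<^sub>M M)" and "\<And>p. p \<in> space (M \<Otimes>\<^sub>M M) \<Longrightarrow> \<bar>f p\<bar> \<le> C"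
    for f :: "'a \<times> 'a \<Rightarrow> real" and C
    using that by (intro PP.integrable_const_bound[of _ C]) auto
  have "ennreal (\<integral>p. exp (b p) \<partial>(M \<Otimes>\<^sub>M M)) = (\<integral>\<^sup>+p. ennreal (exp (b p)) \<partial>(M \<Otimes>\<^sub>M M))"
    using b_bnd by (intro nn_integral_eq_integral[symmetric] int[of _ "exp (2 * K + 1)"]) (auto simp: abs_le_iff)
  also have "\<dots> = (\<integral>\<^sup>+x. \<integral>\<^sup>+y. ennreal (exp (X x - I x)) * ennreal (exp (- X y)) \<partial>M \<partial>M)"
    by (subst nn_integral_fst[symmetric]) (auto simp: b_def ennreal_mult[symmetric] exp_add[symmetric] algebra_simps)
  also have "\<dots> = (\<integral>\<^sup>+x. exp (X x - I x) \<partial>M) * (\<integral>\<^sup>+x. exp (- X x) \<partial>M)"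
    by (simp add: nn_integral_cmult nn_integral_multc)
  finally have exp_le: "(\<integral>p. exp (b p) \<partial>(M \<Otimes>\<^sub>M M)) \<le> 1"
    using tau by (metis ennreal_le_1)
  have X_fst: "(\<integral>p. X (fst p) \<partial>(M \<Otimes>\<^sub>M M)) = (\<integral>p. X (snd p) \<partial>(M \<Otimes>\<^sub>M M))"
  proof -
    have "(\<integral>p. X (fst p) \<partial>(M \<Otimes>\<^sub>M M)) = (\<integral>p. X (snd p) \<partial>(M \<Otimes>\<^sub>M M))"
      using PP.integral_product_swap[of "\<lambda>p. X (fst p)"] by (simp add: split_beta')
    then show ?thesis .
  qed
  have iX: "integrable (M \<Otimes>\<^sub>M M) (\<lambda>p. X (fst p))" "integrable (M \<Otimes>\<^sub>M M) (\<lambda>p. X (snd p))"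
    "integrable (M \<Otimes>\<^sub>M M) (\<lambda>p. I (fst p))"
    by (rule int, measurable, erule bnd)+
  have ib: "integrable (M \<Otimes>\<^sub>M M) b" using b_bnd by (intro int[of _ "2 * K + 1"]) auto
  have ibp: "integrable (M \<Otimes>\<^sub>M M) (\<lambda>p. (max 0 (b p))\<^sup>2)"
  proof (rule int[of _ "(2 * K + 1)\<^sup>2"])
    fix p assume "p \<in> space (M \<Otimes>\<^sub>M M)"
    from b_bnd[OF this] show "\<bar>(max 0 (b p))\<^sup>2\<bar> \<le> (2 * K + 1)\<^sup>2"
      by (simp add: power_mono abs_le_iff)
  qed simp
  have "(\<integral>p. 1 + b p + (max 0 (b p))\<^sup>2 / 2 \<partial>(M \<Otimes>\<^sub>M M)) \<le> (\<integral>p. exp (b p) \<partial>(M \<Otimes>\<^sub>M M))"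
  proof (rule integral_mono)
    show "integrable (M \<Otimes>\<^sub>M M) (\<lambda>p. exp (b p))"
      using b_bnd by (intro int[of _ "exp (2 * K + 1)"]) (auto simp: abs_le_iff)
    show "1 + b p + (max 0 (b p))\<^sup>2 / 2 \<le> exp (b p)" for p
      using exp_lower_Taylor_quadratic[of "b p"] exp_ge_add_one_self[of "b p"]
      by (cases "0 \<le> b p") (auto simp: max_def)
  qed (auto intro!: Bochner_Integration.integrable_add ib ibp integrable_divide)
  also have "(\<integral>p. 1 + b p + (max 0 (b p))\<^sup>2 / 2 \<partial>(M \<Otimes>\<^sub>M M))
      = 1 + (\<integral>p. b p \<partial>(M \<Otimes>\<^sub>M M)) + (\<integral>p. (max 0 (b p))\<^sup>2 \<partial>(M \<Otimes>\<^sub>M M)) / 2"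
    using ib ibp by (simp add: PP.prob_space)
  also have "(\<integral>p. b p \<partial>(M \<Otimes>\<^sub>M M)) = - (\<integral>p. I (fst p) \<partial>(M \<Otimes>\<^sub>M M))"
    unfolding b_def using iX by (simp add: X_fst)
  finally have bp: "(\<integral>p. (max 0 (b p))\<^sup>2 \<partial>(M \<Otimes>\<^sub>M M)) \<le> 2 * (\<integral>p. I (fst p) \<partial>(M \<Otimes>\<^sub>M M))"
    using exp_le by simp
  define D where "D p = (max 0 (X (fst p) - X (snd p)))\<^sup>2" for p
  have [measurable]: "D \<in> borel_measurable (M \<Otimes>\<^sub>M M)" unfolding D_def[abs_def] by measurable
  have iD: "integrable (M \<Otimes>\<^sub>M M) D"
  proof (rule int[of _ "(2 * K)\<^sup>2"])
    fix p assume "p \<in> space (M \<Otimes>\<^sub>M M)"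
    from bnd[OF this] have "max 0 (X (fst p) - X (snd p)) \<le> 2 * K" by linarith
    then show "\<bar>D p\<bar> \<le> (2 * K)\<^sup>2"
      unfolding D_def abs_power2 by (rule power_mono) simp
  qed simp
  have "(\<integral>p. D p \<partial>(M \<Otimes>\<^sub>M M)) \<le> (\<integral>p. 2 * (max 0 (b p))\<^sup>2 + 2 * I (fst p) \<partial>(M \<Otimes>\<^sub>M M))"
  proof (rule integral_mono)
    fix p assume p: "p \<in> space (M \<Otimes>\<^sub>M M)"
    define i where "i = I (fst p)"
    have i: "i\<^sup>2 = i" "0 \<le> i" using p I[of "fst p"] by (auto simp: i_def space_pair_measure)
    have "max 0 (X (fst p) - X (snd p)) \<le> max 0 (b p) + i"
      using i by (simp add: b_def i_def max_def)
    then have "D p \<le> (max 0 (b p) + i)\<^sup>2" unfolding D_def by (intro power_mono) auto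
    also have "\<dots> \<le> 2 * (max 0 (b p))\<^sup>2 + 2 * i\<^sup>2"
      using zero_le_power2[of "max 0 (b p) - i"] by (simp add: power2_eq_square algebra_simps)
    finally show "D p \<le> 2 * (max 0 (b p))\<^sup>2 + 2 * I (fst p)" using i by (simp add: i_def)
  qed (use iD ibp iX in auto)
  also have "\<dots> \<le> 6 * (\<integral>p. I (fst p) \<partial>(M \<Otimes>\<^sub>M M))"
    using bp ibp iX by simp
  finally have D_le: "(\<integral>p. D p \<partial>(M \<Otimes>\<^sub>M M)) \<le> 6 * (\<integral>p. I (fst p) \<partial>(M \<Otimes>\<^sub>M M))" .
  have D_nn: "(\<integral>\<^sup>+p. D p \<partial>(M \<Otimes>\<^sub>M M)) \<le> 6 * (\<integral>\<^sup>+p. I (fst p) \<partial>(M \<Otimes>\<^sub>M M))"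
  proof -
    have "(\<integral>\<^sup>+p. D p \<partial>(M \<Otimes>\<^sub>M M)) = ennreal (\<integral>p. D p \<partial>(M \<Otimes>\<^sub>M M))"
      by (rule nn_integral_eq_integral[OF iD]) (simp add: D_def)
    also have "\<dots> \<le> ennreal (6 * (\<integral>p. I (fst p) \<partial>(M \<Otimes>\<^sub>M M)))"
      using D_le by (rule ennreal_leI)
    also have "\<dots> = 6 * ennreal (\<integral>p. I (fst p) \<partial>(M \<Otimes>\<^sub>M M))"
      using bnd(4) by (subst ennreal_mult) (auto intro!: integral_nonneg_AE)
    also have "ennreal (\<integral>p. I (fst p) \<partial>(M \<Otimes>\<^sub>M M)) = (\<integral>\<^sup>+p. I (fst p) \<partial>(M \<Otimes>\<^sub>M M))"
      using bnd(4) iX(3) by (intro nn_integral_eq_integral[symmetric]) auto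
    finally show ?thesis .
  qed
  have I_fst: "(\<integral>\<^sup>+p. I (fst p) \<partial>(M \<Otimes>\<^sub>M M)) = (\<integral>\<^sup>+x. I x \<partial>M)"
    by (subst nn_integral_fst[symmetric]) (auto simp: emeasure_space_1)
  have "(\<integral>\<^sup>+x. \<integral>\<^sup>+y. ennreal ((X x - X y)\<^sup>2) \<partial>M \<partial>M)
      = (\<integral>\<^sup>+x. \<integral>\<^sup>+y. ennreal (D (x, y)) + ennreal (D (y, x)) \<partial>M \<partial>M)"
    by (intro nn_integral_cong) (auto simp: D_def max_def power2_commute simp flip: ennreal_plus)
  also have "\<dots> = (\<integral>\<^sup>+x. \<integral>\<^sup>+y. ennreal (D (x, y)) \<partial>M \<partial>M) + (\<integral>\<^sup>+x. \<integral>\<^sup>+y. ennreal (D (y, x)) \<partial>M \<partial>M)"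
    by (subst nn_integral_add[symmetric]) (auto intro!: nn_integral_cong nn_integral_add)
  also have "(\<integral>\<^sup>+x. \<integral>\<^sup>+y. ennreal (D (y, x)) \<partial>M \<partial>M) = (\<integral>\<^sup>+x. \<integral>\<^sup>+y. ennreal (D (x, y)) \<partial>M \<partial>M)"
    by (rule PP.Fubini') simp
  also have "(\<integral>\<^sup>+x. \<integral>\<^sup>+y. ennreal (D (x, y)) \<partial>M \<partial>M) = (\<integral>\<^sup>+p. D p \<partial>(M \<Otimes>\<^sub>M M))"
    by (subst nn_integral_fst[symmetric]) auto
  also have "(\<integral>\<^sup>+p. D p \<partial>(M \<Otimes>\<^sub>M M)) + (\<integral>\<^sup>+p. D p \<partial>(M \<Otimes>\<^sub>M M)) \<le> 6 * (\<integral>\<^sup>+x. I x \<partial>M) + 6 * (\<integral>\<^sup>+x. I x \<partial>M)"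
    using D_nn by (intro add_mono) (simp_all add: I_fst)
  also have "\<dots> = (6 + 6) * (\<integral>\<^sup>+x. I x \<partial>M)" by (simp only: distrib_right)
  finally show ?thesis by simp
qed

text \<open>The copies \<open>z\<close> and \<open>z'\<close> express a variance: the inner double
  integral is twice the variance of \<open>f\<close> under the Gaussian centred at \<open>x\<close>.
  Differences of two displaced values, and not differences from \<open>f x\<close>, are what
  property (\<tau>) controls.\<close>

definition gauss_energy :: "nat \<Rightarrow> real \<Rightarrow> ((nat \<Rightarrow> real) \<Rightarrow> real) \<Rightarrow> ennreal" where
  "gauss_energy d \<tau> f = (\<integral>\<^sup>+x. \<integral>\<^sup>+z. \<integral>\<^sup>+z'. ennreal ((f (vadd d x z) - f (vadd d x z'))\<^sup>2)
     \<partial>gauss d \<tau> \<partial>gauss d \<tau> \<partial>euclid d)"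

text \<open>Lebesgue measure is unchanged by convolution with a probability measure. Integrated over
  all centres, the Gaussian mass of a set thus becomes its Lebesgue measure.\<close>

lemma nn_integral_gauss_translate:
  fixes h :: "(nat \<Rightarrow> real) \<Rightarrow> ennreal"
  assumes \<tau>: "0 < \<tau>" and [measurable]: "h \<in> borel_measurable (euclid d)"
  shows "(\<integral>\<^sup>+x. \<integral>\<^sup>+z. h (vadd d x z) \<partial>gauss d \<tau> \<partial>euclid d) = (\<integral>\<^sup>+x. h x \<partial>euclid d)"
proof -
  interpret G: prob_space "gauss d \<tau>" by (rule prob_space_gauss[OF \<tau>])
  interpret PG: pair_sigma_finite "euclid d" "gauss d \<tau>" ..
  have "(\<integral>\<^sup>+x. \<integral>\<^sup>+z. h (vadd d x z) \<partial>gauss d \<tau> \<partial>euclid d) = (\<integral>\<^sup>+z. \<integral>\<^sup>+x. h (vadd d x z) \<partial>euclid d \<partial>gauss d \<tau>)"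
    by (rule PG.Fubini'[symmetric]) measurable
  also have "\<dots> = (\<integral>\<^sup>+z. \<integral>\<^sup>+x. h x \<partial>euclid d \<partial>gauss d \<tau>)"
    by (intro nn_integral_cong nn_integral_euclid_vadd) auto
  finally show ?thesis using G.emeasure_space_1 by simp
qed

text \<open>For \<open>q > 1\<close> this follows from \<open>(q - 2)\<^sup>2 \<ge> 0\<close>. The
  coefficient 1/4 is dictated by the cost in \<open>gauss_property_tau\<close>, and the constant 1
  is what the indicator of the support pays for.\<close>

lemma powr_le_one_plus_square:
  fixes q \<gamma> :: real
  assumes "0 \<le> q" "0 < \<gamma>" "\<gamma> \<le> 1"
  shows "q powr \<gamma> \<le> 1 + q\<^sup>2 / 4"
proof (cases "q \<le> 1")
  case True
  then have "q powr \<gamma> \<le> 1 powr \<gamma>" using assms by (intro powr_mono2) auto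
  then show ?thesis by (simp add: add_increasing2)
next
  case False
  then have "q powr \<gamma> \<le> q powr 1" using assms by (intro powr_mono) auto
  also have "\<dots> \<le> 1 + q\<^sup>2 / 4"
    using False zero_le_power2[of "q - 2"] by (simp add: power2_eq_square algebra_simps)
  finally show ?thesis .
qed

text \<open>Property (\<tau>) is applied at each centre to \<open>exp (X - I)\<close> and
  \<open>exp (- X)\<close>, where \<open>X\<close> is the rescaled function and \<open>I\<close> the
  indicator of its support. The discount \<open>I\<close> absorbs the 1 in
  \<open>powr_le_one_plus_square\<close>, so the local variance is charged to the Gaussian mass of
  the support alone.\<close>

lemma gauss_energy_hoelder_support:
  fixes W :: "(nat \<Rightarrow> real) \<Rightarrow> real"
  assumes [measurable]: "W \<in> borel_measurable (euclid d)"
    and W: "\<And>x. x \<in> space (euclid d) \<Longrightarrow> 0 \<le> W x" "\<And>x. x \<in> space (euclid d) \<Longrightarrow> W x \<le> K"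
    and Hoelder: "\<And>x y. x \<in> space (euclid d) \<Longrightarrow> y \<in> space (euclid d) \<Longrightarrow>
      W x - W y \<le> M * vnorm d (vdiff d x y) powr \<gamma>"
    and pos: "0 < M" "0 < \<gamma>" "\<gamma> \<le> 1" "0 < \<tau>"
  shows "gauss_energy d \<tau> W \<le> ennreal (12 * (M * \<tau> powr \<gamma>)\<^sup>2) * emeasure (euclid d) {x \<in> space (euclid d). W x \<noteq> 0}"
proof -
  define S where "S = {x \<in> space (euclid d). W x \<noteq> 0}"
  have S [measurable]: "S \<in> sets (euclid d)" unfolding S_def by measurable
  \<comment> \<open>Heights are measured in units of the oscillation
    \<open>M * \<tau> powr \<gamma>\<close> over distance \<open>\<tau>\<close>, which turns the
    Hoelder bound into \<open>(r / \<tau>) powr \<gamma>\<close>.\<close>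
  define l where "l = 1 / (M * \<tau> powr \<gamma>)"
  have l: "0 < l" using pos by (simp add: l_def)
  interpret G: prob_space "gauss d \<tau>" by (rule prob_space_gauss[OF pos(4)])
  have local: "(\<integral>\<^sup>+z. \<integral>\<^sup>+z'. ennreal ((W (vadd d x z) - W (vadd d x z'))\<^sup>2) \<partial>gauss d \<tau> \<partial>gauss d \<tau>)
      \<le> ennreal (12 * (M * \<tau> powr \<gamma>)\<^sup>2) * (\<integral>\<^sup>+z. indicator S (vadd d x z) \<partial>gauss d \<tau>)"
    if x [measurable]: "x \<in> space (euclid d)" for x
  proof -
    define X where "X z = l * W (vadd d x z)" for z
    define I where "I z = (indicator S (vadd d x z) :: real)" for z
    have [measurable]: "X \<in> borel_measurable (gauss d \<tau>)" "I \<in> borel_measurable (gauss d \<tau>)"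
      unfolding X_def[abs_def] I_def[abs_def] by measurable
    have "(\<integral>\<^sup>+z. exp (X z - I z) \<partial>gauss d \<tau>) * (\<integral>\<^sup>+z. exp (- X z) \<partial>gauss d \<tau>) \<le> 1"
    proof (rule gauss_property_tau[OF pos(4)])
      fix z z' assume zz: "z \<in> space (euclid d)" "z' \<in> space (euclid d)"
      let ?r = "vnorm d (vdiff d z z')"
      have diff: "vdiff d (vadd d x z) (vadd d x z') = vdiff d z z'"
        by (auto simp: vdiff_def vadd_def)
      have "X z - I z - X z' \<le> ?r\<^sup>2 / (4 * \<tau>\<^sup>2)"
      proof (cases "vadd d x z \<in> S")
        \<comment> \<open>Off the support there is no discount, but \<open>W\<close> vanishes at
          this point and is nonnegative at the other, so the exponent is at most 0. This is why
          \<open>V\<close> is later split into parts of one sign.\<close>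
        case False
        then have "W (vadd d x z) = 0" by (simp add: S_def)
        then have "X z - I z - X z' = - (l * W (vadd d x z'))"
          using False by (simp add: X_def I_def)
        also have "\<dots> \<le> 0" using W(1)[of "vadd d x z'"] l by simp
        finally show ?thesis by (rule order_trans) simp
      next
        case True
        have "X z - X z' = l * (W (vadd d x z) - W (vadd d x z'))" by (simp add: X_def algebra_simps)
        also have "\<dots> \<le> l * (M * ?r powr \<gamma>)"
          using Hoelder[of "vadd d x z" "vadd d x z'"] l by (intro mult_left_mono) (auto simp: diff)
        also have "\<dots> = (?r / \<tau>) powr \<gamma>"
          using pos by (simp add: l_def powr_divide)
        also have "\<dots> \<le> 1 + (?r / \<tau>)\<^sup>2 / 4"
          using pos by (intro powr_le_one_plus_square) auto
        finally show ?thesis using True by (simp add: I_def power_divide field_simps)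
      qed
      then show "ennreal (exp (X z - I z)) * ennreal (exp (- X z')) \<le> ennreal (exp (?r\<^sup>2 / (4 * \<tau>\<^sup>2)))"
        by (simp add: ennreal_mult[symmetric] exp_add[symmetric])
    qed simp_all
    then have "(\<integral>\<^sup>+z. \<integral>\<^sup>+z'. ennreal ((X z - X z')\<^sup>2) \<partial>gauss d \<tau> \<partial>gauss d \<tau>) \<le> 12 * (\<integral>\<^sup>+z. ennreal (I z) \<partial>gauss d \<tau>)"
      using W[of "vadd d x _"] l
      by (intro G.square_diff_le_of_exp_product[where K="l * K"]) (auto simp: X_def I_def abs_mult split: split_indicator)
    then have "ennreal ((M * \<tau> powr \<gamma>)\<^sup>2) * (\<integral>\<^sup>+z. \<integral>\<^sup>+z'. ennreal ((X z - X z')\<^sup>2) \<partial>gauss d \<tau> \<partial>gauss d \<tau>)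
        \<le> ennreal ((M * \<tau> powr \<gamma>)\<^sup>2) * (12 * (\<integral>\<^sup>+z. ennreal (I z) \<partial>gauss d \<tau>))"
      by (rule mult_left_mono) simp
    also have "\<dots> = ennreal (12 * (M * \<tau> powr \<gamma>)\<^sup>2) * (\<integral>\<^sup>+z. ennreal (I z) \<partial>gauss d \<tau>)"
      by (simp add: ennreal_mult ac_simps)
    also have "ennreal ((M * \<tau> powr \<gamma>)\<^sup>2) * (\<integral>\<^sup>+z. \<integral>\<^sup>+z'. ennreal ((X z - X z')\<^sup>2) \<partial>gauss d \<tau> \<partial>gauss d \<tau>)
        = (\<integral>\<^sup>+z. \<integral>\<^sup>+z'. ennreal ((M * \<tau> powr \<gamma>)\<^sup>2) * ennreal ((X z - X z')\<^sup>2) \<partial>gauss d \<tau> \<partial>gauss d \<tau>)"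
      by (simp add: nn_integral_cmult)
    also have "\<dots> = (\<integral>\<^sup>+z. \<integral>\<^sup>+z'. ennreal ((W (vadd d x z) - W (vadd d x z'))\<^sup>2) \<partial>gauss d \<tau> \<partial>gauss d \<tau>)"
      using pos by (intro nn_integral_cong)
        (simp add: X_def l_def ennreal_mult[symmetric] power_mult_distrib[symmetric] right_diff_distrib)
    finally show ?thesis
      by (simp add: I_def ennreal_indicator)
  qed
  have "gauss_energy d \<tau> W
      \<le> (\<integral>\<^sup>+x. ennreal (12 * (M * \<tau> powr \<gamma>)\<^sup>2) * (\<integral>\<^sup>+z. indicator S (vadd d x z) \<partial>gauss d \<tau>) \<partial>euclid d)"
    unfolding gauss_energy_def by (intro nn_integral_mono local)
  also have "\<dots> = ennreal (12 * (M * \<tau> powr \<gamma>)\<^sup>2) * (\<integral>\<^sup>+x. \<integral>\<^sup>+z. indicator S (vadd d x z) \<partial>gauss d \<tau> \<partial>euclid d)"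
    by (rule nn_integral_cmult) measurable
  also have "(\<integral>\<^sup>+x. \<integral>\<^sup>+z. indicator S (vadd d x z) \<partial>gauss d \<tau> \<partial>euclid d) = emeasure (euclid d) S"
    using nn_integral_gauss_translate[OF pos(4), of "indicator S" d] S by simp
  finally show ?thesis by (simp add: S_def)
qed

text \<open>\<open>K\<close> bounds \<open>V\<close> at every point and not merely almost
  everywhere, because paths are evaluated at individual times. For Hoelder functions
  \<open>abs_le_Linfty_norm\<close> shows that the essential supremum is such a bound.\<close>

locale hoelder_potential =
  fixes d :: nat and V :: "(nat \<Rightarrow> real) \<Rightarrow> real" and M \<gamma> K :: real
  assumes V_integrable: "integrable (euclid d) V"
    and V_bound: "\<And>x. x \<in> space (euclid d) \<Longrightarrow> \<bar>V x\<bar> \<le> K"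
    and V_hoelder: "uniformly_Hoelder d M \<gamma> V"
    and M_pos: "0 < M" and \<gamma>_pos: "0 < \<gamma>" and \<gamma>_le_1: "\<gamma> \<le> 1"
begin

lemma V_measurable [measurable]: "V \<in> borel_measurable (euclid d)"
  using V_integrable by (rule borel_measurable_integrable)

lemma V_hoelderD:
  "x \<in> space (euclid d) \<Longrightarrow> y \<in> space (euclid d) \<Longrightarrow> \<bar>V x - V y\<bar> \<le> M * vnorm d (vdiff d x y) powr \<gamma>"
  using V_hoelder by (simp add: uniformly_Hoelder_def)

lemma L1_norm_eq: "(\<integral>\<^sup>+x. ennreal \<bar>V x\<bar> \<partial>euclid d) = ennreal (L1_norm d V)"
  unfolding L1_norm_def using V_integrable by (intro nn_integral_eq_integral) auto

lemma measurable_abs_ennreal: "(\<lambda>x. ennreal \<bar>V x\<bar>) \<in> borel_measurable (euclid d)"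
  by measurable

lemma L1_norm_nonneg: "0 \<le> L1_norm d V"
  by (simp add: L1_norm_def)

lemma K_nonneg: "0 \<le> K"
  using V_bound[of "vdiff d undefined undefined"] by (intro order_trans[OF abs_ge_zero]) auto

text \<open>The excesses over the height \<open>c\<close> inherit the Hoelder bound because
  truncation is 1-Lipschitz, and Markov's inequality bounds the measure of their supports. The
  choice of \<open>c\<close> makes every contribution linear in \<open>c\<close>: 4 for the
  truncated part and 12 for each excess, so that \<open>84 = 3 * (4 + 12 + 12)\<close>.\<close>

lemma gauss_energy_bound:
  assumes \<tau>: "0 < \<tau>"
  shows "gauss_energy d \<tau> V \<le> ennreal (84 * M * \<tau> powr \<gamma> * L1_norm d V)"
proof -
  interpret G: prob_space "gauss d \<tau>" by (rule prob_space_gauss[OF \<tau>])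
  define c where "c = M * \<tau> powr \<gamma>"
  have c: "0 < c" using M_pos \<tau> by (simp add: c_def)
  define T where "T x = max (- c) (min c (V x))" for x
  define W1 where "W1 x = max 0 (V x - c)" for x
  define W2 where "W2 x = max 0 (- V x - c)" for x
  have [measurable]: "T \<in> borel_measurable (euclid d)" "W1 \<in> borel_measurable (euclid d)"
    "W2 \<in> borel_measurable (euclid d)"
    unfolding T_def[abs_def] W1_def[abs_def] W2_def[abs_def] by measurable
  have supp: "emeasure (euclid d) {x \<in> space (euclid d). W x \<noteq> 0} \<le> ennreal (L1_norm d V / c)"
    if [measurable]: "W \<in> borel_measurable (euclid d)"
      and W: "\<And>x. x \<in> space (euclid d) \<Longrightarrow> W x \<noteq> 0 \<Longrightarrow> c \<le> \<bar>V x\<bar>"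
    for W :: "(nat \<Rightarrow> real) \<Rightarrow> real"
  proof -
    have "emeasure (euclid d) {x \<in> space (euclid d). W x \<noteq> 0}
        = (\<integral>\<^sup>+x. indicator {x \<in> space (euclid d). W x \<noteq> 0} x \<partial>euclid d)"
      by (rule nn_integral_indicator[symmetric]) measurable
    also have "\<dots> \<le> (\<integral>\<^sup>+x. ennreal (1 / c) * ennreal \<bar>V x\<bar> \<partial>euclid d)"
      using W c by (intro nn_integral_mono) (auto simp: indicator_def ennreal_mult[symmetric])
    also have "\<dots> = ennreal (1 / c) * ennreal (L1_norm d V)"
      by (simp only: L1_norm_eq nn_integral_cmult[of "\<lambda>x. ennreal \<bar>V x\<bar>"] measurable_abs_ennreal)
    also have "\<dots> = ennreal (L1_norm d V / c)"
      using c by (simp add: ennreal_mult[symmetric] L1_norm_nonneg)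
    finally show ?thesis .
  qed
  have W_le: "gauss_energy d \<tau> W \<le> ennreal (12 * c * L1_norm d V)"
    if [measurable]: "W \<in> borel_measurable (euclid d)"
      and W: "\<And>x. x \<in> space (euclid d) \<Longrightarrow> W x \<noteq> 0 \<Longrightarrow> c \<le> \<bar>V x\<bar>"
      "\<And>x. x \<in> space (euclid d) \<Longrightarrow> 0 \<le> W x" "\<And>x. x \<in> space (euclid d) \<Longrightarrow> W x \<le> K"
      "\<And>x y. W x - W y \<le> \<bar>V x - V y\<bar>"
    for W
  proof -
    have "gauss_energy d \<tau> W \<le> ennreal (12 * (M * \<tau> powr \<gamma>)\<^sup>2) * emeasure (euclid d) {x \<in> space (euclid d). W x \<noteq> 0}"
    proof (rule gauss_energy_hoelder_support[where K=K])
      fix x y assume "x \<in> space (euclid d)" "y \<in> space (euclid d)"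
      from V_hoelderD[OF this] W(4)[of x y]
      show "W x - W y \<le> M * vnorm d (vdiff d x y) powr \<gamma>" by linarith
    qed (use W \<tau> M_pos \<gamma>_pos \<gamma>_le_1 in auto)
    also have "\<dots> \<le> ennreal (12 * c\<^sup>2) * ennreal (L1_norm d V / c)"
      unfolding c_def[symmetric] using W by (intro mult_left_mono supp) auto
    also have "\<dots> = ennreal (12 * c * L1_norm d V)"
      using c L1_norm_nonneg by (simp add: ennreal_mult[symmetric] power2_eq_square)
    finally show ?thesis .
  qed
  have W1: "gauss_energy d \<tau> W1 \<le> ennreal (12 * c * L1_norm d V)"
  proof (rule W_le)
    fix x assume "x \<in> space (euclid d)"
    from V_bound[OF this] c K_nonneg show "W1 x \<le> K" by (auto simp: W1_def)
  qed (auto simp: W1_def max_def split: if_splits)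
  have W2: "gauss_energy d \<tau> W2 \<le> ennreal (12 * c * L1_norm d V)"
  proof (rule W_le)
    fix x assume "x \<in> space (euclid d)"
    from V_bound[OF this] c K_nonneg show "W2 x \<le> K" by (auto simp: W2_def)
  qed (auto simp: W2_def max_def split: if_splits)
  have T: "gauss_energy d \<tau> T \<le> ennreal (4 * c * L1_norm d V)"
  proof -
    define h where "h x = ennreal (2 * (T x)\<^sup>2)" for x
    have [measurable]: "h \<in> borel_measurable (euclid d)" unfolding h_def[abs_def] by measurable
    have "gauss_energy d \<tau> T \<le> (\<integral>\<^sup>+x. \<integral>\<^sup>+z. \<integral>\<^sup>+z'. h (vadd d x z) + h (vadd d x z')
        \<partial>gauss d \<tau> \<partial>gauss d \<tau> \<partial>euclid d)"
      unfolding gauss_energy_def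
    proof (intro nn_integral_mono)
      fix x z z'
      have "(T (vadd d x z) - T (vadd d x z'))\<^sup>2 \<le> 2 * (T (vadd d x z))\<^sup>2 + 2 * (T (vadd d x z'))\<^sup>2"
        using zero_le_power2[of "T (vadd d x z) + T (vadd d x z')"]
        by (simp add: power2_eq_square algebra_simps)
      then show "ennreal ((T (vadd d x z) - T (vadd d x z'))\<^sup>2) \<le> h (vadd d x z) + h (vadd d x z')"
        unfolding h_def by (simp add: ennreal_leI flip: ennreal_plus)
    qed
    also have "\<dots> = (\<integral>\<^sup>+x. (\<integral>\<^sup>+z. h (vadd d x z) \<partial>gauss d \<tau>) + (\<integral>\<^sup>+z. h (vadd d x z) \<partial>gauss d \<tau>) \<partial>euclid d)"
      using G.emeasure_space_1 by (intro nn_integral_cong) (simp add: nn_integral_add)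
    also have "\<dots> = (\<integral>\<^sup>+x. h x \<partial>euclid d) + (\<integral>\<^sup>+x. h x \<partial>euclid d)"
      by (subst nn_integral_add) (auto simp: nn_integral_gauss_translate[OF \<tau>])
    also have "\<dots> = (\<integral>\<^sup>+x. h x + h x \<partial>euclid d)"
      by (subst nn_integral_add) auto
    also have "\<dots> \<le> (\<integral>\<^sup>+x. ennreal (4 * c) * ennreal \<bar>V x\<bar> \<partial>euclid d)"
    proof (intro nn_integral_mono)
      fix x
      have "\<bar>T x\<bar> \<le> c" "\<bar>T x\<bar> \<le> \<bar>V x\<bar>" using c by (auto simp: T_def max_def min_def abs_if)
      then have "\<bar>T x\<bar> * \<bar>T x\<bar> \<le> c * \<bar>V x\<bar>" using c by (intro mult_mono) auto
      then have "2 * (T x)\<^sup>2 + 2 * (T x)\<^sup>2 \<le> 4 * c * \<bar>V x\<bar>" by (simp add: power2_eq_square)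
      then show "h x + h x \<le> ennreal (4 * c) * ennreal \<bar>V x\<bar>"
        unfolding h_def using c
        by (simp add: ennreal_leI ennreal_mult[symmetric] flip: ennreal_plus)
    qed
    also have "\<dots> = ennreal (4 * c) * ennreal (L1_norm d V)"
      by (simp only: L1_norm_eq nn_integral_cmult[of "\<lambda>x. ennreal \<bar>V x\<bar>"] measurable_abs_ennreal)
    also have "\<dots> = ennreal (4 * c * L1_norm d V)"
      using c by (simp add: ennreal_mult[symmetric] L1_norm_nonneg)
    finally show ?thesis .
  qed
  \<comment> \<open>The factor 3 is Cauchy-Schwarz for the three pieces of
    \<open>V = T + W1 - W2\<close>; positive and negative excess enter separately because each must
    be nonnegative.\<close>
  have "gauss_energy d \<tau> V \<le> (\<integral>\<^sup>+x. \<integral>\<^sup>+z. \<integral>\<^sup>+z'.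
      3 * (ennreal ((T (vadd d x z) - T (vadd d x z'))\<^sup>2) + ennreal ((W1 (vadd d x z) - W1 (vadd d x z'))\<^sup>2)
        + ennreal ((W2 (vadd d x z) - W2 (vadd d x z'))\<^sup>2)) \<partial>gauss d \<tau> \<partial>gauss d \<tau> \<partial>euclid d)"
    unfolding gauss_energy_def
  proof (intro nn_integral_mono)
    fix x z z'
    have dec: "V y = T y + W1 y - W2 y" for y using c by (auto simp: T_def W1_def W2_def max_def min_def)
    have sq: "(p + q - r)\<^sup>2 \<le> 3 * (p\<^sup>2 + q\<^sup>2 + r\<^sup>2)" for p q r :: real
      using zero_le_power2[of "p - q"] zero_le_power2[of "p + r"] zero_le_power2[of "q + r"]
      by (simp add: power2_eq_square algebra_simps)
    let ?p = "T (vadd d x z) - T (vadd d x z')" and ?q = "W1 (vadd d x z) - W1 (vadd d x z')"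
      and ?r = "W2 (vadd d x z) - W2 (vadd d x z')"
    have "V (vadd d x z) - V (vadd d x z') = ?p + ?q - ?r"
      by (simp add: dec)
    then have "ennreal ((V (vadd d x z) - V (vadd d x z'))\<^sup>2) \<le> ennreal (3 * (?p\<^sup>2 + ?q\<^sup>2 + ?r\<^sup>2))"
      using sq[of ?p ?q ?r] by (intro ennreal_leI) simp
    also have "\<dots> = 3 * (ennreal (?p\<^sup>2) + ennreal (?q\<^sup>2) + ennreal (?r\<^sup>2))"
      by (subst ennreal_mult) (simp_all del: distrib_left_numeral)
    finally show "ennreal ((V (vadd d x z) - V (vadd d x z'))\<^sup>2)
        \<le> 3 * (ennreal (?p\<^sup>2) + ennreal (?q\<^sup>2) + ennreal (?r\<^sup>2))" .
  qed
  also have "\<dots> = 3 * (gauss_energy d \<tau> T + gauss_energy d \<tau> W1 + gauss_energy d \<tau> W2)"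
    unfolding gauss_energy_def by (simp add: nn_integral_cmult nn_integral_add)
  also have "\<dots> \<le> 3 * (ennreal (4 * c * L1_norm d V) + ennreal (12 * c * L1_norm d V) + ennreal (12 * c * L1_norm d V))"
    by (intro mult_left_mono add_mono T W1 W2) auto
  also have "\<dots> = ennreal 3 * ennreal (28 * c * L1_norm d V)"
    using c L1_norm_nonneg by (simp add: algebra_simps flip: ennreal_plus)
  also have "\<dots> = ennreal (84 * M * \<tau> powr \<gamma> * L1_norm d V)"
  proof -
    have e: "84 * M * \<tau> powr \<gamma> * L1_norm d V = 3 * (28 * c * L1_norm d V)" by (simp add: c_def)
    show ?thesis unfolding e using c L1_norm_nonneg by (intro ennreal_mult[symmetric]) auto
  qed
  finally show ?thesis .
qed

end

section \<open>Fourier transforms of Gaussian measures\<close>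

lemma vinner_commute: "vinner d x y = vinner d y x"
  by (simp add: vinner_def mult.commute)

lemma vinner_vdiff: "vinner d (vdiff d x y) z = vinner d x z - vinner d y z"
  by (simp add: vinner_def vdiff_def left_diff_distrib sum_subtractf)

lemma
  shows borel_measurable_cos [measurable]: "(cos :: real \<Rightarrow> real) \<in> borel_measurable borel"
    and borel_measurable_sin [measurable]: "(sin :: real \<Rightarrow> real) \<in> borel_measurable borel"
  by (intro borel_measurable_continuous_onI continuous_intros)+

lemma
  shows measurable_vinner_const [measurable]: "(\<lambda>x. vinner d x z) \<in> borel_measurable (euclid d)"
    and measurable_vinner_const' [measurable]: "(\<lambda>x. vinner d z x) \<in> borel_measurable (euclid d)"
  by (auto simp: vinner_def intro!: borel_measurable_sum borel_measurable_times measurable_euclid_component)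

lemma char_normal_measure:
  assumes "0 < \<sigma>"
  shows "(\<integral>x. iexp (t * x) \<partial>normal_measure \<sigma>) = complex_of_real (exp (- (\<sigma> * t)\<^sup>2 / 2))"
proof -
  have dens: "\<sigma> * normal_density 0 \<sigma> (\<sigma> * x) = std_normal_density x" for x
    using assms by (simp add: normal_density_def real_sqrt_mult power_mult_distrib)
  have "(\<integral>x. iexp (t * x) \<partial>normal_measure \<sigma>) = (\<integral>x. normal_density 0 \<sigma> x *\<^sub>R iexp (t * x) \<partial>lborel)"
    unfolding normal_measure_def by (rule integral_density) auto
  also have "\<dots> = \<bar>\<sigma>\<bar> *\<^sub>R (\<integral>x. normal_density 0 \<sigma> (0 + \<sigma> * x) *\<^sub>R iexp (t * (0 + \<sigma> * x)) \<partial>lborel)"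
    using assms by (intro lborel_integral_real_affine) auto
  also have "\<dots> = (\<integral>x. std_normal_density x *\<^sub>R iexp (\<sigma> * t * x) \<partial>lborel)"
    using assms unfolding dens[symmetric]
    by (subst integral_scaleR_right[symmetric]) (simp add: ac_simps)
  also have "\<dots> = char std_normal_distribution (\<sigma> * t)"
    unfolding char_def by (rule integral_density[symmetric]) auto
  finally show ?thesis by (simp add: char_std_normal_distribution)
qed

lemma char_gauss:
  assumes \<sigma>: "0 < \<sigma>"
  shows "(\<integral>\<xi>. iexp (vinner d w \<xi>) \<partial>gauss d \<sigma>) = complex_of_real (exp (- (\<sigma> * vnorm d w)\<^sup>2 / 2))"
proof -
  interpret N: prob_space "normal_measure \<sigma>" by (rule prob_space_normal_measure[OF \<sigma>])
  interpret P: product_sigma_finite "\<lambda>_::nat. normal_measure \<sigma>" ..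
  have "(\<integral>\<xi>. iexp (vinner d w \<xi>) \<partial>gauss d \<sigma>) = (\<integral>\<xi>. (\<Prod>i<d. iexp (w i * \<xi> i)) \<partial>gauss d \<sigma>)"
    by (simp add: vinner_def exp_sum[symmetric] sum_distrib_left)
  also have "\<dots> = (\<Prod>i<d. \<integral>x. iexp (w i * x) \<partial>normal_measure \<sigma>)"
    unfolding gauss_def
  proof (rule P.product_integral_prod)
    fix i
    have "(\<lambda>x. iexp (w i * x)) \<in> borel_measurable (normal_measure \<sigma>)"
      unfolding measurable_cong_sets[OF sets_normal_measure refl]
      by (intro borel_measurable_continuous_onI continuous_intros)
    then show "integrable (normal_measure \<sigma>) (\<lambda>x. iexp (w i * x))"
      by (intro N.integrable_const_bound[of _ 1]) auto
  qed simp
  also have "\<dots> = complex_of_real (\<Prod>i<d. exp (- (\<sigma> * w i)\<^sup>2 / 2))"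
    by (simp only: char_normal_measure[OF \<sigma>] of_real_prod)
  also have "(\<Prod>i<d. exp (- (\<sigma> * w i)\<^sup>2 / 2)) = exp (- (\<sigma> * vnorm d w)\<^sup>2 / 2)"
    by (simp add: exp_sum[symmetric] power_mult_distrib vnorm_power2 sum_distrib_left
        sum_negf sum_divide_distrib)
  finally show ?thesis .
qed

lemma
  assumes \<sigma>: "0 < \<sigma>"
  shows gauss_cos: "(\<integral>\<xi>. cos (vinner d w \<xi>) \<partial>gauss d \<sigma>) = exp (- (\<sigma> * vnorm d w)\<^sup>2 / 2)"
    and gauss_sin: "(\<integral>\<xi>. sin (vinner d w \<xi>) \<partial>gauss d \<sigma>) = 0"
proof -
  interpret G: prob_space "gauss d \<sigma>" by (rule prob_space_gauss[OF \<sigma>])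
  have int: "integrable (gauss d \<sigma>) (\<lambda>\<xi>. iexp (vinner d w \<xi>))"
    by (rule G.integrable_const_bound[of _ 1]) auto
  have "(\<integral>\<xi>. cos (vinner d w \<xi>) \<partial>gauss d \<sigma>) = (\<integral>\<xi>. Re (iexp (vinner d w \<xi>)) \<partial>gauss d \<sigma>)"
    by (simp add: Re_exp)
  also have "\<dots> = Re (complex_of_real (exp (- (\<sigma> * vnorm d w)\<^sup>2 / 2)))"
    using int by (simp only: integral_Re char_gauss[OF \<sigma>])
  finally show "(\<integral>\<xi>. cos (vinner d w \<xi>) \<partial>gauss d \<sigma>) = exp (- (\<sigma> * vnorm d w)\<^sup>2 / 2)" by simp
  have "(\<integral>\<xi>. sin (vinner d w \<xi>) \<partial>gauss d \<sigma>) = (\<integral>\<xi>. Im (iexp (vinner d w \<xi>)) \<partial>gauss d \<sigma>)"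
    by (simp add: Im_exp)
  also have "\<dots> = Im (complex_of_real (exp (- (\<sigma> * vnorm d w)\<^sup>2 / 2)))"
    using int by (simp only: integral_Im char_gauss[OF \<sigma>])
  finally show "(\<integral>\<xi>. sin (vinner d w \<xi>) \<partial>gauss d \<sigma>) = 0" by simp
qed

text \<open>The law of the difference of two independent copies, that is the centred Gaussian of
  variance \<open>2 * \<tau>\<^sup>2\<close> in each coordinate. It is the increment that enters
  \<open>gauss_energy\<close>, and its Fourier transform has no factor 1/2 in the exponent.\<close>

definition diff_gauss :: "nat \<Rightarrow> real \<Rightarrow> (nat \<Rightarrow> real) measure" where
  "diff_gauss d \<tau> = distr (gauss d \<tau> \<Otimes>\<^sub>M gauss d \<tau>) (euclid d) (\<lambda>(z, z'). vdiff d z z')"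

lemma sets_diff_gauss [simp, measurable_cong]: "sets (diff_gauss d \<tau>) = sets (euclid d)"
  by (simp add: diff_gauss_def)

lemma prob_space_diff_gauss: "0 < \<tau> \<Longrightarrow> prob_space (diff_gauss d \<tau>)"
  unfolding diff_gauss_def
  by (intro prob_space.prob_space_distr prob_space_pair prob_space_gauss) (auto simp: split_beta')

lemma integral_diff_gauss:
  fixes h :: "(nat \<Rightarrow> real) \<Rightarrow> real"
  assumes \<tau>: "0 < \<tau>" and [measurable]: "h \<in> borel_measurable (euclid d)"
    and bnd: "\<And>x. x \<in> space (euclid d) \<Longrightarrow> \<bar>h x\<bar> \<le> B"
  shows "(\<integral>x. h x \<partial>diff_gauss d \<tau>) = (\<integral>z. \<integral>z'. h (vdiff d z z') \<partial>gauss d \<tau> \<partial>gauss d \<tau>)"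
proof -
  interpret G: prob_space "gauss d \<tau>" by (rule prob_space_gauss[OF \<tau>])
  interpret PP: pair_prob_space "gauss d \<tau>" "gauss d \<tau>" ..
  have "(\<integral>x. h x \<partial>diff_gauss d \<tau>) = (\<integral>p. h (vdiff d (fst p) (snd p)) \<partial>(gauss d \<tau> \<Otimes>\<^sub>M gauss d \<tau>))"
    unfolding diff_gauss_def by (subst integral_distr) (auto simp: split_beta')
  also have "\<dots> = (\<integral>z. \<integral>z'. h (vdiff d z z') \<partial>gauss d \<tau> \<partial>gauss d \<tau>)"
    by (subst PP.integral_fst'[symmetric])
       (auto intro!: PP.integrable_const_bound[of _ B] AE_I2 simp: bnd)
  finally show ?thesis .
qed

lemma diff_gauss_cos:
  assumes \<tau>: "0 < \<tau>"
  shows "(\<integral>z. cos (vinner d z \<xi>) \<partial>diff_gauss d \<tau>) = exp (- (\<tau> * vnorm d \<xi>)\<^sup>2)"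
proof -
  interpret G: prob_space "gauss d \<tau>" by (rule prob_space_gauss[OF \<tau>])
  have i: "integrable (gauss d \<tau>) (\<lambda>z. cos (vinner d z \<xi>))" "integrable (gauss d \<tau>) (\<lambda>z. sin (vinner d z \<xi>))"
    by (auto intro!: G.integrable_const_bound[of _ 1])
  have c: "(\<integral>z. cos (vinner d z \<xi>) \<partial>gauss d \<tau>) = exp (- (\<tau> * vnorm d \<xi>)\<^sup>2 / 2)"
    "(\<integral>z. sin (vinner d z \<xi>) \<partial>gauss d \<tau>) = 0"
    using gauss_cos[OF \<tau>, of d \<xi>] gauss_sin[OF \<tau>, of d \<xi>] by (simp_all add: vinner_commute)
  have "(\<integral>z. cos (vinner d z \<xi>) \<partial>diff_gauss d \<tau>)
      = (\<integral>z. \<integral>z'. cos (vinner d (vdiff d z z') \<xi>) \<partial>gauss d \<tau> \<partial>gauss d \<tau>)"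
    by (rule integral_diff_gauss[OF \<tau>, where B=1]) auto
  also have "\<dots> = (\<integral>z. cos (vinner d z \<xi>) * exp (- (\<tau> * vnorm d \<xi>)\<^sup>2 / 2) \<partial>gauss d \<tau>)"
    using i by (simp add: vinner_vdiff cos_diff c)
  also have "\<dots> = exp (- (\<tau> * vnorm d \<xi>)\<^sup>2 / 2) * exp (- (\<tau> * vnorm d \<xi>)\<^sup>2 / 2)"
    by (simp add: c)
  also have "\<dots> = exp (- (\<tau> * vnorm d \<xi>)\<^sup>2)"
    unfolding exp_add[symmetric] by (rule arg_cong[where f=exp]) simp
  finally show ?thesis .
qed

section \<open>Density and moments of the Gaussian measure\<close>

lemma gauss_eq_density:
  assumes \<tau>: "0 < \<tau>"
  shows "gauss d \<tau> = density (euclid d) (\<lambda>w. ennreal (\<Prod>i<d. normal_density 0 \<tau> (w i)))"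
proof -
  interpret N: prob_space "normal_measure \<tau>" by (rule prob_space_normal_measure[OF \<tau>])
  interpret P: product_sigma_finite "\<lambda>_::nat. normal_measure \<tau>" ..
  have "density (euclid d) (\<lambda>w. ennreal (\<Prod>i<d. normal_density 0 \<tau> (w i))) = PiM {..<d} (\<lambda>_. normal_measure \<tau>)"
  proof (rule P.PiM_eqI)
    show "sets (density (euclid d) (\<lambda>w. ennreal (\<Prod>i<d. normal_density 0 \<tau> (w i)))) = sets (PiM {..<d} (\<lambda>_. normal_measure \<tau>))"
      using sets_gauss[of d \<tau>] by (simp add: gauss_def)
  next
    fix A :: "nat \<Rightarrow> real set" assume "\<And>i. i \<in> {..<d} \<Longrightarrow> A i \<in> sets (normal_measure \<tau>)"
    then have A [measurable]: "\<And>i. i < d \<Longrightarrow> A i \<in> sets borel" by simp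
    then have S: "Pi\<^sub>E {..<d} A \<in> sets (euclid d)"
      unfolding euclid_def by (intro sets_PiM_I_finite) auto
    have "emeasure (density (euclid d) (\<lambda>w. ennreal (\<Prod>i<d. normal_density 0 \<tau> (w i)))) (Pi\<^sub>E {..<d} A)
        = (\<integral>\<^sup>+w. ennreal (\<Prod>i<d. normal_density 0 \<tau> (w i)) * indicator (Pi\<^sub>E {..<d} A) w \<partial>euclid d)"
      using S by (intro emeasure_density) auto
    also have "\<dots> = (\<integral>\<^sup>+w. (\<Prod>i<d. ennreal (normal_density 0 \<tau> (w i)) * indicator (A i) (w i)) \<partial>euclid d)"
    proof (intro nn_integral_cong)
      fix w assume "w \<in> space (euclid d)"
      then have "indicator (Pi\<^sub>E {..<d} A) w = (\<Prod>i<d. indicator (A i) (w i) :: ennreal)"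
        by (auto simp: indicator_def space_euclid PiE_def Pi_def)
      then show "ennreal (\<Prod>i<d. normal_density 0 \<tau> (w i)) * indicator (Pi\<^sub>E {..<d} A) w
          = (\<Prod>i<d. ennreal (normal_density 0 \<tau> (w i)) * indicator (A i) (w i))"
        by (simp add: prod.distrib prod_ennreal)
    qed
    also have "\<dots> = (\<Prod>i<d. \<integral>\<^sup>+x. ennreal (normal_density 0 \<tau> x) * indicator (A i) x \<partial>lborel)"
      unfolding euclid_def by (rule lborel_product.product_nn_integral_prod) auto
    also have "\<dots> = (\<Prod>i<d. emeasure (normal_measure \<tau>) (A i))"
      unfolding normal_measure_def by (intro prod.cong refl emeasure_density[symmetric]) auto
    finally show "emeasure (density (euclid d) (\<lambda>w. ennreal (\<Prod>i<d. normal_density 0 \<tau> (w i)))) (Pi\<^sub>E {..<d} A)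
        = (\<Prod>i<d. emeasure (normal_measure \<tau>) (A i))" .
  qed simp
  then show ?thesis by (simp add: gauss_def)
qed

text \<open>The exponent is put into the form of \<open>gauss_cos\<close> for the scale
  \<open>1 / \<tau>\<close>: up to a constant, the Gaussian density of scale \<open>\<tau>\<close>
  is the Fourier transform of the Gaussian measure of scale \<open>1 / \<tau>\<close>.\<close>

lemma prod_normal_density:
  assumes \<tau>: "0 < \<tau>"
  shows "(\<Prod>i<d. normal_density 0 \<tau> (w i)) = (1 / sqrt (2 * pi * \<tau>\<^sup>2)) ^ d * exp (- (1 / \<tau> * vnorm d w)\<^sup>2 / 2)"
proof -
  have "(\<Prod>i<d. normal_density 0 \<tau> (w i)) = (\<Prod>i<d. 1 / sqrt (2 * pi * \<tau>\<^sup>2) * exp (- (w i)\<^sup>2 / (2 * \<tau>\<^sup>2)))"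
    by (simp add: normal_density_def)
  also have "\<dots> = (1 / sqrt (2 * pi * \<tau>\<^sup>2)) ^ d * exp (\<Sum>i<d. - (w i)\<^sup>2 / (2 * \<tau>\<^sup>2))"
    by (simp only: prod.distrib prod_constant card_lessThan exp_sum finite_lessThan)
  also have "(\<Sum>i<d. - (w i)\<^sup>2 / (2 * \<tau>\<^sup>2)) = - (\<Sum>i<d. (w i)\<^sup>2) / (2 * \<tau>\<^sup>2)"
    by (simp only: sum_divide_distrib[symmetric] sum_negf)
  also have "\<dots> = - (1 / \<tau> * vnorm d w)\<^sup>2 / 2"
    by (simp add: vnorm_power2[symmetric] power_mult_distrib power_divide)
  finally show ?thesis .
qed

lemma gauss_second_moment:
  assumes \<tau>: "0 < \<tau>"
  shows "integrable (gauss d \<tau>) (\<lambda>w. (vnorm d w)\<^sup>2)" "(\<integral>w. (vnorm d w)\<^sup>2 \<partial>gauss d \<tau>) = d * \<tau>\<^sup>2"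
proof -
  have N: "has_bochner_integral (normal_measure \<tau>) (\<lambda>x. x\<^sup>2) (\<tau>\<^sup>2)"
    unfolding normal_measure_def
    using normal_moment_even[of \<tau> 0 1] \<tau>
    by (intro has_bochner_integral_density) (auto simp: fact_numeral)
  have m: "distr (gauss d \<tau>) (normal_measure \<tau>) (\<lambda>w. w i) = normal_measure \<tau>" if "i < d" for i
    unfolding gauss_def using that prob_space_normal_measure[OF \<tau>]
    by (intro distr_PiM_component) auto
  have "has_bochner_integral (gauss d \<tau>) (\<lambda>w. (w i)\<^sup>2) (\<tau>\<^sup>2)" if "i < d" for i
  proof -
    have f: "(\<lambda>w. w i) \<in> gauss d \<tau> \<rightarrow>\<^sub>M normal_measure \<tau>"
      using that by measurable
    have g: "(\<lambda>x::real. x\<^sup>2) \<in> borel_measurable (normal_measure \<tau>)"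
      unfolding measurable_cong_sets[OF sets_normal_measure refl]
      by (intro borel_measurable_continuous_onI continuous_intros)
    have "integrable (distr (gauss d \<tau>) (normal_measure \<tau>) (\<lambda>w. w i)) (\<lambda>x. x\<^sup>2)"
      unfolding m[OF that] by (rule integrable.intros[OF N])
    then have "integrable (gauss d \<tau>) (\<lambda>w. (w i)\<^sup>2)" by (rule integrable_distr[OF f])
    moreover have "(\<integral>w. (w i)\<^sup>2 \<partial>gauss d \<tau>) = \<tau>\<^sup>2"
      unfolding integral_distr[OF f g, symmetric] m[OF that]
      by (rule has_bochner_integral_integral_eq[OF N])
    ultimately show ?thesis unfolding has_bochner_integral_iff by (rule conjI)
  qed
  then have "has_bochner_integral (gauss d \<tau>) (\<lambda>w. \<Sum>i<d. (w i)\<^sup>2) (\<Sum>i<d. \<tau>\<^sup>2)"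
    by (intro has_bochner_integral_sum) auto
  then show "integrable (gauss d \<tau>) (\<lambda>w. (vnorm d w)\<^sup>2)" "(\<integral>w. (vnorm d w)\<^sup>2 \<partial>gauss d \<tau>) = d * \<tau>\<^sup>2"
    by (simp_all add: vnorm_power2 has_bochner_integral_iff)
qed

text \<open>The factor \<open>1 + d\<close> does no harm: the estimate serves only a limit with
  \<open>\<tau>\<close> tending to 0 in a fixed dimension, and never enters the final
  constant.\<close>

lemma gauss_powr_moment:
  assumes \<tau>: "0 < \<tau>" and \<gamma>: "0 < \<gamma>" "\<gamma> \<le> 1"
  shows "integrable (gauss d \<tau>) (\<lambda>w. vnorm d w powr \<gamma>)"
    "(\<integral>w. vnorm d w powr \<gamma> \<partial>gauss d \<tau>) \<le> \<tau> powr \<gamma> * (1 + d)"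
proof -
  interpret G: prob_space "gauss d \<tau>" by (rule prob_space_gauss[OF \<tau>])
  have le: "vnorm d w powr \<gamma> \<le> \<tau> powr \<gamma> * (1 + (vnorm d w)\<^sup>2 / \<tau>\<^sup>2)" for w
  proof -
    have "(vnorm d w / \<tau>) powr \<gamma> \<le> 1 + (vnorm d w / \<tau>)\<^sup>2 / 4"
      using \<tau> \<gamma> by (intro powr_le_one_plus_square) auto
    also have "(vnorm d w / \<tau>)\<^sup>2 / 4 \<le> (vnorm d w / \<tau>)\<^sup>2" by simp
    also have "(vnorm d w / \<tau>)\<^sup>2 = (vnorm d w)\<^sup>2 / \<tau>\<^sup>2" by (rule power_divide)
    finally have "\<tau> powr \<gamma> * (vnorm d w / \<tau>) powr \<gamma> \<le> \<tau> powr \<gamma> * (1 + (vnorm d w)\<^sup>2 / \<tau>\<^sup>2)"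
      by (intro mult_left_mono) auto
    then show ?thesis using \<tau> by (simp add: powr_divide)
  qed
  have i: "integrable (gauss d \<tau>) (\<lambda>w. \<tau> powr \<gamma> * (1 + (vnorm d w)\<^sup>2 / \<tau>\<^sup>2))"
    using gauss_second_moment(1)[OF \<tau>, of d] by auto
  show int: "integrable (gauss d \<tau>) (\<lambda>w. vnorm d w powr \<gamma>)"
    by (rule Bochner_Integration.integrable_bound[OF i]) (use le in \<open>auto intro: order_trans[OF le abs_ge_self]\<close>)
  have "(\<integral>w. vnorm d w powr \<gamma> \<partial>gauss d \<tau>) \<le> (\<integral>w. \<tau> powr \<gamma> * (1 + (vnorm d w)\<^sup>2 / \<tau>\<^sup>2) \<partial>gauss d \<tau>)"
    by (intro integral_mono int i le)
  also have "\<dots> = \<tau> powr \<gamma> * (1 + d)"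
    using gauss_second_moment[OF \<tau>, of d] \<tau> G.prob_space by simp
  finally show "(\<integral>w. vnorm d w powr \<gamma> \<partial>gauss d \<tau>) \<le> \<tau> powr \<gamma> * (1 + d)" .
qed

section \<open>The autocorrelation function\<close>

definition autocorr :: "nat \<Rightarrow> ((nat \<Rightarrow> real) \<Rightarrow> real) \<Rightarrow> (nat \<Rightarrow> real) \<Rightarrow> real" where
  "autocorr d V z = (\<integral>x. V (vadd d x z) * V x \<partial>euclid d)"

lemma measurable_autocorr [measurable (raw)]:
  assumes [measurable]: "V \<in> borel_measurable (euclid d)" and "f \<in> N \<rightarrow>\<^sub>M euclid d"
  shows "(\<lambda>x. autocorr d V (f x)) \<in> borel_measurable N"
proof -
  have "autocorr d V \<in> borel_measurable (euclid d)"
    unfolding autocorr_def[abs_def] by measurable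
  from measurable_compose[OF assms(2) this] show ?thesis .
qed

context hoelder_potential
begin

lemma abs_V_vadd_le: "\<bar>V (vadd d x z)\<bar> \<le> K"
  by (rule V_bound) simp

lemma integrable_mult_V:
  assumes "g \<in> borel_measurable (euclid d)" "\<And>x. x \<in> space (euclid d) \<Longrightarrow> \<bar>g x\<bar> \<le> C"
  shows "integrable (euclid d) (\<lambda>x. g x * V x)"
proof (rule Bochner_Integration.integrable_bound)
  show "integrable (euclid d) (\<lambda>x. C * V x)" using V_integrable by simp
  show "(\<lambda>x. g x * V x) \<in> borel_measurable (euclid d)" using assms(1) by simp
  show "AE x in euclid d. norm (g x * V x) \<le> norm (C * V x)"
  proof (rule AE_I2)
    fix x assume x: "x \<in> space (euclid d)"
    have "\<bar>g x\<bar> * \<bar>V x\<bar> \<le> \<bar>C\<bar> * \<bar>V x\<bar>"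
      using assms(2)[OF x] by (intro mult_right_mono) auto
    then show "norm (g x * V x) \<le> norm (C * V x)" by (simp add: abs_mult)
  qed
qed

lemma integral_mult_V_le:
  assumes "g \<in> borel_measurable (euclid d)" "\<And>x. x \<in> space (euclid d) \<Longrightarrow> \<bar>g x\<bar> \<le> C"
  shows "\<bar>\<integral>x. g x * V x \<partial>euclid d\<bar> \<le> C * L1_norm d V"
proof -
  have "\<bar>\<integral>x. g x * V x \<partial>euclid d\<bar> \<le> (\<integral>x. C * \<bar>V x\<bar> \<partial>euclid d)"
  proof (rule order_trans[OF integral_abs_bound integral_mono])
    show "integrable (euclid d) (\<lambda>x. \<bar>g x * V x\<bar>)"
      using integrable_mult_V[OF assms] by simp
    show "\<bar>g x * V x\<bar> \<le> C * \<bar>V x\<bar>" if "x \<in> space (euclid d)" for x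
      using assms(2)[OF that] by (simp add: abs_mult mult_right_mono)
  qed (use V_integrable in simp)
  then show ?thesis by (simp add: L1_norm_def)
qed

lemma integrable_V_shift_mult: "integrable (euclid d) (\<lambda>x. V (vadd d x z) * V x)"
  by (rule integrable_mult_V[of _ K]) (auto intro: abs_V_vadd_le)

lemma integrable_V_square: "integrable (euclid d) (\<lambda>x. (V x)\<^sup>2)"
  using integrable_mult_V[OF V_measurable V_bound] by (simp add: power2_eq_square)

lemma autocorr_le: "\<bar>autocorr d V z\<bar> \<le> K * L1_norm d V"
  unfolding autocorr_def by (rule integral_mult_V_le) (auto intro: abs_V_vadd_le)

lemma autocorr_zero: "autocorr d V (\<lambda>i\<in>{..<d}. 0) = (\<integral>x. (V x)\<^sup>2 \<partial>euclid d)"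
proof -
  have "vadd d x (\<lambda>i\<in>{..<d}. 0) = x" if "x \<in> space (euclid d)" for x
    using that by (auto simp: vadd_def space_euclid extensional_def)
  then show ?thesis
    unfolding autocorr_def
    by (intro Bochner_Integration.integral_cong) (simp_all add: power2_eq_square)
qed

text \<open>Using the Hoelder bound of one factor under the integral costs only
  \<open>L1_norm d V\<close> for the other. The resulting uniform continuity controls the Gaussian
  smoothing in \<open>autocorr_positive_definite\<close>.\<close>

lemma autocorr_hoelder: "\<bar>autocorr d V (vadd d z w) - autocorr d V z\<bar> \<le> M * vnorm d w powr \<gamma> * L1_norm d V"
proof -
  have "autocorr d V (vadd d z w) - autocorr d V z
      = (\<integral>x. (V (vadd d x (vadd d z w)) - V (vadd d x z)) * V x \<partial>euclid d)"
    unfolding autocorr_def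
    by (simp add: integrable_V_shift_mult left_diff_distrib)
  also have "\<bar>\<dots>\<bar> \<le> (M * vnorm d w powr \<gamma>) * L1_norm d V"
  proof (rule integral_mult_V_le)
    fix x
    have "vdiff d (vadd d x (vadd d z w)) (vadd d x z) = (\<lambda>i\<in>{..<d}. w i)"
      by (auto simp: vadd_def vdiff_def)
    then have "vnorm d (vdiff d (vadd d x (vadd d z w)) (vadd d x z)) = vnorm d w"
      by (simp add: vnorm_def L2_set_def)
    then show "\<bar>V (vadd d x (vadd d z w)) - V (vadd d x z)\<bar> \<le> M * vnorm d w powr \<gamma>"
      using V_hoelderD[of "vadd d x (vadd d z w)" "vadd d x z"] by simp
  qed measurable
  finally show ?thesis .
qed

lemma nn_integral_square_diff:
  "(\<integral>\<^sup>+x. ennreal ((V (vadd d x z) - V x)\<^sup>2) \<partial>euclid d)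
    = ennreal (2 * ((\<integral>x. (V x)\<^sup>2 \<partial>euclid d) - autocorr d V z))"
proof -
  have i: "integrable (euclid d) (\<lambda>x. (V (vadd d x z))\<^sup>2)"
    using integrable_euclid_vadd[OF integrable_V_square] .
  have sq: "(V (vadd d x z) - V x)\<^sup>2 = (V (vadd d x z))\<^sup>2 + (V x)\<^sup>2 - 2 * (V (vadd d x z) * V x)" for x
    by (simp add: power2_eq_square algebra_simps)
  have "(\<integral>\<^sup>+x. ennreal ((V (vadd d x z) - V x)\<^sup>2) \<partial>euclid d) = ennreal (\<integral>x. (V (vadd d x z) - V x)\<^sup>2 \<partial>euclid d)"
  proof (rule nn_integral_eq_integral)
    show "integrable (euclid d) (\<lambda>x. (V (vadd d x z) - V x)\<^sup>2)"
      unfolding sq using i integrable_V_square integrable_V_shift_mult by auto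
  qed simp
  also have "(\<integral>x. (V (vadd d x z) - V x)\<^sup>2 \<partial>euclid d)
      = (\<integral>x. (V (vadd d x z))\<^sup>2 \<partial>euclid d) + (\<integral>x. (V x)\<^sup>2 \<partial>euclid d) - 2 * autocorr d V z"
    unfolding sq autocorr_def using i integrable_V_square integrable_V_shift_mult by simp
  also have "(\<integral>x. (V (vadd d x z))\<^sup>2 \<partial>euclid d) = (\<integral>x. (V x)\<^sup>2 \<partial>euclid d)"
    using integral_euclid_vadd[of "\<lambda>x. (V x)\<^sup>2"] by simp
  finally show ?thesis by (simp add: algebra_simps)
qed

lemma autocorr_le_zero: "autocorr d V z \<le> (\<integral>x. (V x)\<^sup>2 \<partial>euclid d)"
proof -
  have i: "integrable (euclid d) (\<lambda>x. (V (vadd d x z))\<^sup>2)"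
    using integrable_euclid_vadd[OF integrable_V_square] .
  have "2 * autocorr d V z = (\<integral>x. 2 * (V (vadd d x z) * V x) \<partial>euclid d)"
    by (simp add: autocorr_def)
  also have "\<dots> \<le> (\<integral>x. (V (vadd d x z))\<^sup>2 + (V x)\<^sup>2 \<partial>euclid d)"
  proof (rule integral_mono)
    show "2 * (V (vadd d x z) * V x) \<le> (V (vadd d x z))\<^sup>2 + (V x)\<^sup>2" for x
      using zero_le_power2[of "V (vadd d x z) - V x"] by (simp add: power2_eq_square algebra_simps)
  qed (use i integrable_V_square integrable_V_shift_mult in auto)
  also have "\<dots> = (\<integral>x. (V x)\<^sup>2 \<partial>euclid d) + (\<integral>x. (V x)\<^sup>2 \<partial>euclid d)"
    using i integrable_V_square integral_euclid_vadd[of "\<lambda>x. (V x)\<^sup>2"] by simp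
  finally show ?thesis by simp
qed

text \<open>Shifting the base point by \<open>z'\<close> replaces two displacements by their
  difference. This makes the energy affine in the law of the increment, so that it can be
  transferred between increments by linear combinations.\<close>

lemma gauss_energy_eq:
  assumes \<tau>: "0 < \<tau>"
  shows "gauss_energy d \<tau> V
    = ennreal (2 * ((\<integral>x. (V x)\<^sup>2 \<partial>euclid d) - (\<integral>z. autocorr d V z \<partial>diff_gauss d \<tau>)))"
proof -
  interpret G: prob_space "gauss d \<tau>" by (rule prob_space_gauss[OF \<tau>])
  interpret PP: pair_prob_space "gauss d \<tau>" "gauss d \<tau>" ..
  interpret EP: pair_sigma_finite "euclid d" "gauss d \<tau> \<Otimes>\<^sub>M gauss d \<tau>" ..
  define \<rho>0 where "\<rho>0 = (\<integral>x. (V x)\<^sup>2 \<partial>euclid d)"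
  have shift: "(\<integral>\<^sup>+x. ennreal ((V (vadd d x z) - V (vadd d x z'))\<^sup>2) \<partial>euclid d)
      = ennreal (2 * (\<rho>0 - autocorr d V (vdiff d z z')))" for z z'
  proof -
    have e: "vadd d (vadd d x z') (vdiff d z z') = vadd d x z" for x
      by (auto simp: vadd_def vdiff_def)
    have "(\<integral>\<^sup>+x. ennreal ((V (vadd d x z) - V (vadd d x z'))\<^sup>2) \<partial>euclid d)
        = (\<integral>\<^sup>+x. ennreal ((V (vadd d x (vdiff d z z')) - V x)\<^sup>2) \<partial>euclid d)"
      using nn_integral_euclid_vadd[of "\<lambda>x. ennreal ((V (vadd d x (vdiff d z z')) - V x)\<^sup>2)" d z']
      by (simp add: e)
    then show ?thesis by (simp add: nn_integral_square_diff \<rho>0_def)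
  qed
  have \<rho>_int: "integrable (gauss d \<tau> \<Otimes>\<^sub>M gauss d \<tau>) (\<lambda>p. autocorr d V (vdiff d (fst p) (snd p)))"
    by (rule PP.integrable_const_bound[of _ "K * L1_norm d V"]) (auto simp: autocorr_le)
  have "gauss_energy d \<tau> V
      = (\<integral>\<^sup>+x. \<integral>\<^sup>+p. ennreal ((V (vadd d x (fst p)) - V (vadd d x (snd p)))\<^sup>2) \<partial>(gauss d \<tau> \<Otimes>\<^sub>M gauss d \<tau>) \<partial>euclid d)"
    unfolding gauss_energy_def by (intro nn_integral_cong) (subst G.nn_integral_fst[symmetric], auto)
  also have "\<dots> = (\<integral>\<^sup>+p. \<integral>\<^sup>+x. ennreal ((V (vadd d x (fst p)) - V (vadd d x (snd p)))\<^sup>2) \<partial>euclid d \<partial>(gauss d \<tau> \<Otimes>\<^sub>M gauss d \<tau>))"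
    by (rule EP.Fubini'[symmetric]) measurable
  also have "\<dots> = (\<integral>\<^sup>+p. ennreal (2 * (\<rho>0 - autocorr d V (vdiff d (fst p) (snd p)))) \<partial>(gauss d \<tau> \<Otimes>\<^sub>M gauss d \<tau>))"
    by (simp only: shift)
  also have "\<dots> = ennreal (\<integral>p. 2 * (\<rho>0 - autocorr d V (vdiff d (fst p) (snd p))) \<partial>(gauss d \<tau> \<Otimes>\<^sub>M gauss d \<tau>))"
    using \<rho>_int autocorr_le_zero by (intro nn_integral_eq_integral) (auto simp: \<rho>0_def)
  also have "(\<integral>p. 2 * (\<rho>0 - autocorr d V (vdiff d (fst p) (snd p))) \<partial>(gauss d \<tau> \<Otimes>\<^sub>M gauss d \<tau>))
      = 2 * (\<rho>0 - (\<integral>p. autocorr d V (vdiff d (fst p) (snd p)) \<partial>(gauss d \<tau> \<Otimes>\<^sub>M gauss d \<tau>)))"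
    using \<rho>_int by (simp add: PP.prob_space)
  also have "(\<integral>p. autocorr d V (vdiff d (fst p) (snd p)) \<partial>(gauss d \<tau> \<Otimes>\<^sub>M gauss d \<tau>)) = (\<integral>z. autocorr d V z \<partial>diff_gauss d \<tau>)"
    unfolding diff_gauss_def by (subst integral_distr) (auto simp: split_beta')
  finally show ?thesis by (simp add: \<rho>0_def)
qed

lemma autocorr_diff_gauss_bound:
  assumes \<tau>: "0 < \<tau>"
  shows "(\<integral>x. (V x)\<^sup>2 \<partial>euclid d) - (\<integral>z. autocorr d V z \<partial>diff_gauss d \<tau>) \<le> 42 * M * \<tau> powr \<gamma> * L1_norm d V"
proof -
  have "0 \<le> 84 * M * \<tau> powr \<gamma> * L1_norm d V" using M_pos L1_norm_nonneg by simp
  then show ?thesis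
    using gauss_energy_bound[OF \<tau>] unfolding gauss_energy_eq[OF \<tau>] by simp
qed

text \<open>The squared modulus of the Fourier transform of \<open>V\<close>, written with real
  integrals. It is the Fourier transform of the autocorrelation, so its nonnegativity expresses
  positive definiteness.\<close>

definition fourier_square :: "(nat \<Rightarrow> real) \<Rightarrow> real" where
  "fourier_square \<xi> = (\<integral>x. cos (vinner d x \<xi>) * V x \<partial>euclid d)\<^sup>2 + (\<integral>x. sin (vinner d x \<xi>) * V x \<partial>euclid d)\<^sup>2"

lemma measurable_fourier_square [measurable]: "fourier_square \<in> borel_measurable (euclid d)"
  unfolding fourier_square_def[abs_def] by measurable

lemma fourier_square_nonneg: "0 \<le> fourier_square \<xi>"
  by (simp add: fourier_square_def)

lemma fourier_square_le: "fourier_square \<xi> \<le> 2 * (L1_norm d V)\<^sup>2"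
proof -
  have "\<bar>\<integral>x. cos (vinner d x \<xi>) * V x \<partial>euclid d\<bar> \<le> 1 * L1_norm d V"
    "\<bar>\<integral>x. sin (vinner d x \<xi>) * V x \<partial>euclid d\<bar> \<le> 1 * L1_norm d V"
    by (rule integral_mult_V_le; simp)+
  then have "(\<integral>x. cos (vinner d x \<xi>) * V x \<partial>euclid d)\<^sup>2 \<le> (L1_norm d V)\<^sup>2"
    "(\<integral>x. sin (vinner d x \<xi>) * V x \<partial>euclid d)\<^sup>2 \<le> (L1_norm d V)\<^sup>2"
    by (auto intro: abs_le_square_iff[THEN iffD1] simp: L1_norm_nonneg)
  then show ?thesis by (simp add: fourier_square_def)
qed

text \<open>The real form of the transform of \<open>V\<close> times its conjugate times a phase.
  Addition theorems separate \<open>x\<close>, \<open>y\<close> and \<open>z\<close>, and the mixed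
  terms \<open>C * S * sin c\<close> cancel.\<close>

lemma fourier_square_mult_cos:
  "fourier_square \<xi> * cos (vinner d z \<xi>)
    = (\<integral>y. (\<integral>x. cos (vinner d (vdiff d (vdiff d x y) z) \<xi>) * V x \<partial>euclid d) * V y \<partial>euclid d)"
proof -
  define C where "C = (\<integral>x. cos (vinner d x \<xi>) * V x \<partial>euclid d)"
  define S where "S = (\<integral>x. sin (vinner d x \<xi>) * V x \<partial>euclid d)"
  define c where "c = vinner d z \<xi>"
  have iC: "integrable (euclid d) (\<lambda>x. cos (vinner d x \<xi>) * V x)"
    and iS: "integrable (euclid d) (\<lambda>x. sin (vinner d x \<xi>) * V x)"
    by (rule integrable_mult_V[of _ 1]; simp)+
  have inner: "(\<integral>x. cos (vinner d (vdiff d (vdiff d x y) z) \<xi>) * V x \<partial>euclid d)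
      = C * cos (vinner d y \<xi> + c) + S * sin (vinner d y \<xi> + c)" for y
  proof -
    have "cos (vinner d (vdiff d (vdiff d x y) z) \<xi>) * V x
        = (cos (vinner d x \<xi>) * V x) * cos (vinner d y \<xi> + c) + (sin (vinner d x \<xi>) * V x) * sin (vinner d y \<xi> + c)" for x
    proof -
      have "vinner d (vdiff d (vdiff d x y) z) \<xi> = vinner d x \<xi> - (vinner d y \<xi> + c)"
        by (simp add: vinner_vdiff c_def)
      then show ?thesis by (simp only: cos_diff) (simp add: algebra_simps)
    qed
    then show ?thesis using iC iS by (simp add: C_def S_def)
  qed
  have "(\<integral>y. (C * cos (vinner d y \<xi> + c) + S * sin (vinner d y \<xi> + c)) * V y \<partial>euclid d)
      = (\<integral>y. (C * cos c + S * sin c) * (cos (vinner d y \<xi>) * V y)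
            + (S * cos c - C * sin c) * (sin (vinner d y \<xi>) * V y) \<partial>euclid d)"
    by (intro Bochner_Integration.integral_cong) (auto simp: cos_add sin_add algebra_simps)
  also have "\<dots> = (C * cos c + S * sin c) * C + (S * cos c - C * sin c) * S"
    using iC iS by (simp add: C_def S_def)
  also have "\<dots> = fourier_square \<xi> * cos c"
  proof -
    have "fourier_square \<xi> = C\<^sup>2 + S\<^sup>2" by (simp only: fourier_square_def C_def S_def)
    then show ?thesis by (simp add: power2_eq_square algebra_simps)
  qed
  finally show ?thesis by (simp add: inner c_def)
qed

text \<open>
  Gaussian summability of the Fourier inversion formula for the autocorrelation:
  the weight on the Fourier side becomes flat as \<open>\<tau>\<close> tends to 0.
\<close>

lemma autocorr_fourier:
  assumes \<tau>: "0 < \<tau>" and z: "z \<in> space (euclid d)"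
  shows "(1 / sqrt (2 * pi * \<tau>\<^sup>2)) ^ d * (\<integral>\<xi>. fourier_square \<xi> * cos (vinner d z \<xi>) \<partial>gauss d (1 / \<tau>))
    = (\<integral>w. autocorr d V (vadd d z w) \<partial>gauss d \<tau>)"
proof -
  define c where "c = (1 / sqrt (2 * pi * \<tau>\<^sup>2)) ^ d"
  have s: "0 < 1 / \<tau>" using \<tau> by simp
  interpret G: prob_space "gauss d (1 / \<tau>)" by (rule prob_space_gauss[OF s])
  interpret T: prob_space "gauss d \<tau>" by (rule prob_space_gauss[OF \<tau>])
  interpret EG: pair_sigma_finite "gauss d (1 / \<tau>)" "euclid d \<Otimes>\<^sub>M euclid d" ..
  interpret ET: pair_sigma_finite "gauss d \<tau>" "euclid d" ..
  let ?N = "\<lambda>w. \<Prod>i<d. normal_density 0 \<tau> (w i)"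
  \<comment> \<open>This tensor square dominates the integrands over pairs, since the other factors
    are bounded by 1; it licenses the interchange with the frequency integral.\<close>
  have VV: "integrable (euclid d \<Otimes>\<^sub>M euclid d) (\<lambda>q. V (fst q) * V (snd q))"
  proof (rule euclid2.Fubini_integrable)
    show "integrable (euclid d) (\<lambda>x. \<integral>y. norm (V (fst (x, y)) * V (snd (x, y))) \<partial>euclid d)"
      using V_integrable by (simp add: abs_mult)
  qed (use V_integrable in auto)
  have pair: "(\<integral>y. (\<integral>x. g (x, y) * V x \<partial>euclid d) * V y \<partial>euclid d)
      = (\<integral>q. g q * (V (fst q) * V (snd q)) \<partial>(euclid d \<Otimes>\<^sub>M euclid d))"
    if [measurable]: "g \<in> borel_measurable (euclid d \<Otimes>\<^sub>M euclid d)" and "\<And>q. \<bar>g q\<bar> \<le> 1" for g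
  proof -
    have int: "integrable (euclid d \<Otimes>\<^sub>M euclid d) (\<lambda>q. g q * (V (fst q) * V (snd q)))"
      using that(2) by (intro Bochner_Integration.integrable_bound[OF VV]) (auto simp: abs_mult mult_left_le_one_le)
    have "(\<integral>y. (\<integral>x. g (x, y) * V x \<partial>euclid d) * V y \<partial>euclid d)
        = (\<integral>y. (\<integral>x. g (x, y) * (V x * V y) \<partial>euclid d) \<partial>euclid d)"
      by (subst integral_mult_left_zero[symmetric]) (simp add: ac_simps)
    also have "\<dots> = (\<integral>q. g q * (V (fst q) * V (snd q)) \<partial>(euclid d \<Otimes>\<^sub>M euclid d))"
      using int by (subst euclid2.integral_snd) (auto simp: split_beta')
    finally show "(\<integral>y. (\<integral>x. g (x, y) * V x \<partial>euclid d) * V y \<partial>euclid d)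
      = (\<integral>q. g q * (V (fst q) * V (snd q)) \<partial>(euclid d \<Otimes>\<^sub>M euclid d))" .
  qed
  define D where "D q = vdiff d (vdiff d (fst q) (snd q)) z" for q
  have D [measurable]: "D \<in> euclid d \<Otimes>\<^sub>M euclid d \<rightarrow>\<^sub>M euclid d"
    unfolding D_def[abs_def] using z by measurable
  have "(\<integral>\<xi>. fourier_square \<xi> * cos (vinner d z \<xi>) \<partial>gauss d (1 / \<tau>))
      = (\<integral>\<xi>. \<integral>q. cos (vinner d (D q) \<xi>) * (V (fst q) * V (snd q)) \<partial>(euclid d \<Otimes>\<^sub>M euclid d) \<partial>gauss d (1 / \<tau>))"
  proof (intro Bochner_Integration.integral_cong refl)
    fix \<xi> assume "\<xi> \<in> space (gauss d (1 / \<tau>))"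
    then have [measurable]: "\<xi> \<in> space (euclid d)" by simp
    show "fourier_square \<xi> * cos (vinner d z \<xi>)
        = (\<integral>q. cos (vinner d (D q) \<xi>) * (V (fst q) * V (snd q)) \<partial>(euclid d \<Otimes>\<^sub>M euclid d))"
      unfolding fourier_square_mult_cos by (subst pair[symmetric]) (auto simp: D_def)
  qed
  also have "\<dots> = (\<integral>q. \<integral>\<xi>. cos (vinner d (D q) \<xi>) * (V (fst q) * V (snd q)) \<partial>gauss d (1 / \<tau>) \<partial>(euclid d \<Otimes>\<^sub>M euclid d))"
  proof (rule EG.Fubini_integral[symmetric])
    have "integrable (gauss d (1 / \<tau>) \<Otimes>\<^sub>M (euclid d \<Otimes>\<^sub>M euclid d)) (\<lambda>p. V (fst (snd p)) * V (snd (snd p)))"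
    proof (rule EG.Fubini_integrable)
      show "integrable (gauss d (1 / \<tau>)) (\<lambda>x. \<integral>q. norm (V (fst (snd (x, q))) * V (snd (snd (x, q)))) \<partial>(euclid d \<Otimes>\<^sub>M euclid d))"
        by simp
    qed (use VV in auto)
    then show "integrable (gauss d (1 / \<tau>) \<Otimes>\<^sub>M (euclid d \<Otimes>\<^sub>M euclid d))
        (\<lambda>(\<xi>, q). cos (vinner d (D q) \<xi>) * (V (fst q) * V (snd q)))"
      by (rule Bochner_Integration.integrable_bound) (auto simp: abs_mult mult_left_le_one_le split_beta')
  qed
  also have "\<dots> = (\<integral>q. exp (- (1 / \<tau> * vnorm d (D q))\<^sup>2 / 2) * (V (fst q) * V (snd q)) \<partial>(euclid d \<Otimes>\<^sub>M euclid d))"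
    by (simp only: integral_mult_left_zero gauss_cos[OF s])
  also have "\<dots> = (\<integral>y. (\<integral>x. exp (- (1 / \<tau> * vnorm d (D (x, y)))\<^sup>2 / 2) * V x \<partial>euclid d) * V y \<partial>euclid d)"
    by (rule pair[symmetric]) auto
  finally have 1: "c * (\<integral>\<xi>. fourier_square \<xi> * cos (vinner d z \<xi>) \<partial>gauss d (1 / \<tau>))
      = (\<integral>y. (\<integral>x. ?N (D (x, y)) * V x \<partial>euclid d) * V y \<partial>euclid d)"
    by (simp add: prod_normal_density[OF \<tau>] c_def mult.assoc)
  \<comment> \<open>The substitution \<open>x = w + y + z\<close> makes the Gaussian density depend
    on \<open>w\<close> alone and turns the integral into a smoothing of \<open>V\<close> at
    \<open>y + z\<close>.\<close>
  have "(\<integral>x. ?N (D (x, y)) * V x \<partial>euclid d) = (\<integral>w. V (vadd d y (vadd d z w)) \<partial>gauss d \<tau>)" for y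
  proof -
    have N [measurable]: "?N \<in> borel_measurable (euclid d)" by measurable
    have "(\<integral>x. ?N (D (x, y)) * V x \<partial>euclid d) = (\<integral>w. ?N (D (vadd d w (vadd d y z), y)) * V (vadd d w (vadd d y z)) \<partial>euclid d)"
      by (rule integral_euclid_vadd[symmetric]) (auto simp: D_def)
    also have "\<dots> = (\<integral>w. ?N w * V (vadd d y (vadd d z w)) \<partial>euclid d)"
    proof (intro Bochner_Integration.integral_cong refl)
      fix w assume "w \<in> space (euclid d)"
      then have "D (vadd d w (vadd d y z), y) = w" "vadd d w (vadd d y z) = vadd d y (vadd d z w)"
        by (auto simp: D_def vadd_def vdiff_def space_euclid extensional_def fun_eq_iff)
      then show "?N (D (vadd d w (vadd d y z), y)) * V (vadd d w (vadd d y z)) = ?N w * V (vadd d y (vadd d z w))"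
        by simp
    qed
    also have "\<dots> = (\<integral>w. V (vadd d y (vadd d z w)) \<partial>gauss d \<tau>)"
      unfolding gauss_eq_density[OF \<tau>]
      by (subst integral_density) (auto intro!: prod_nonneg measurable_compose[OF _ V_measurable] measurable_compose[OF measurable_vadd_const' measurable_vadd_const'])
    finally show ?thesis .
  qed
  then have "c * (\<integral>\<xi>. fourier_square \<xi> * cos (vinner d z \<xi>) \<partial>gauss d (1 / \<tau>))
      = (\<integral>y. (\<integral>w. V (vadd d y (vadd d z w)) * V y \<partial>gauss d \<tau>) \<partial>euclid d)"
    by (simp add: 1)
  also have "\<dots> = (\<integral>w. (\<integral>y. V (vadd d y (vadd d z w)) * V y \<partial>euclid d) \<partial>gauss d \<tau>)"
  proof (rule ET.Fubini_integral)
    have [measurable]: "(\<lambda>p. vadd d (snd p) (vadd d z (fst p))) \<in> gauss d \<tau> \<Otimes>\<^sub>M euclid d \<rightarrow>\<^sub>M euclid d"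
      using z by measurable
    have "integrable (gauss d \<tau> \<Otimes>\<^sub>M euclid d) (\<lambda>p. K * V (snd p))"
    proof (rule ET.Fubini_integrable)
      show "integrable (gauss d \<tau>) (\<lambda>x. \<integral>y. norm (K * V (snd (x, y))) \<partial>euclid d)" by simp
    qed (use V_integrable in auto)
    then show "integrable (gauss d \<tau> \<Otimes>\<^sub>M euclid d) (\<lambda>(w, y). V (vadd d y (vadd d z w)) * V y)"
      by (rule Bochner_Integration.integrable_bound)
         (auto simp: abs_mult split_beta' K_nonneg abs_V_vadd_le intro!: mult_right_mono)
  qed
  finally show ?thesis by (simp add: autocorr_def c_def)
qed

text \<open>Weighted with \<open>fourier_square\<close> and a Gaussian of scale
  \<open>1 / \<tau>\<close>, the nonnegative combination of transforms has nonnegative integral, and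
  \<open>autocorr_fourier\<close> identifies this with the same combination for the autocorrelation
  smoothed at scale \<open>\<tau>\<close>. The smoothing error is at most \<open>E \<tau>\<close>
  uniformly in the point, so it disappears as \<open>\<tau>\<close> tends to 0. The single
  coefficients may have any sign.\<close>

lemma autocorr_positive_definite:
  fixes \<nu> :: "'j \<Rightarrow> (nat \<Rightarrow> real) measure" and a :: "'j \<Rightarrow> real"
  assumes fin: "finite J" and prob: "\<And>j. j \<in> J \<Longrightarrow> prob_space (\<nu> j)"
    and sets: "\<And>j. j \<in> J \<Longrightarrow> sets (\<nu> j) = sets (euclid d)"
    and nonneg: "\<And>\<xi>. \<xi> \<in> space (euclid d) \<Longrightarrow> 0 \<le> (\<Sum>j\<in>J. a j * (\<integral>z. cos (vinner d z \<xi>) \<partial>\<nu> j))"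
  shows "0 \<le> (\<Sum>j\<in>J. a j * (\<integral>z. autocorr d V z \<partial>\<nu> j))"
proof -
  define E where "E \<tau> = M * (\<tau> powr \<gamma> * (1 + real d)) * L1_norm d V" for \<tau>
  have key: "0 \<le> (\<Sum>j\<in>J. a j * (\<integral>z. autocorr d V z \<partial>\<nu> j)) + (\<Sum>j\<in>J. \<bar>a j\<bar>) * E \<tau>" if \<tau>: "0 < \<tau>" for \<tau>
  proof -
    define c where "c = (1 / sqrt (2 * pi * \<tau>\<^sup>2)) ^ d"
    have c: "0 \<le> c" by (simp add: c_def)
    have s: "0 < 1 / \<tau>" using \<tau> by simp
    interpret G: prob_space "gauss d (1 / \<tau>)" by (rule prob_space_gauss[OF s])
    interpret T: prob_space "gauss d \<tau>" by (rule prob_space_gauss[OF \<tau>])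
    define R where "R z = (\<integral>w. autocorr d V (vadd d z w) \<partial>gauss d \<tau>)" for z
    have R [measurable]: "R \<in> borel_measurable (euclid d)" unfolding R_def[abs_def] by measurable
    have \<rho>_int: "integrable (gauss d \<tau>) (\<lambda>w. autocorr d V (vadd d z w))" for z
      by (rule T.integrable_const_bound[of _ "K * L1_norm d V"]) (auto simp: autocorr_le)
    have R_close: "\<bar>R z - autocorr d V z\<bar> \<le> E \<tau>" for z
    proof -
      have "R z - autocorr d V z = (\<integral>w. autocorr d V (vadd d z w) - autocorr d V z \<partial>gauss d \<tau>)"
        using \<rho>_int T.prob_space by (simp add: R_def)
      also have "\<bar>\<dots>\<bar> \<le> (\<integral>w. M * L1_norm d V * vnorm d w powr \<gamma> \<partial>gauss d \<tau>)"
      proof (rule order_trans[OF integral_abs_bound integral_mono])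
        show "\<bar>autocorr d V (vadd d z w) - autocorr d V z\<bar> \<le> M * L1_norm d V * vnorm d w powr \<gamma>" for w
          using autocorr_hoelder[of z w] by (simp add: mult_ac)
      qed (use \<rho>_int gauss_powr_moment(1)[OF \<tau> \<gamma>_pos \<gamma>_le_1] in auto)
      also have "\<dots> = M * L1_norm d V * (\<integral>w. vnorm d w powr \<gamma> \<partial>gauss d \<tau>)" by simp
      also have "\<dots> \<le> M * L1_norm d V * (\<tau> powr \<gamma> * (1 + d))"
        using M_pos L1_norm_nonneg by (intro mult_left_mono gauss_powr_moment \<tau> \<gamma>_pos \<gamma>_le_1) auto
      finally show ?thesis by (simp add: E_def mult_ac)
    qed
    have R_le: "\<bar>R z\<bar> \<le> K * L1_norm d V + E \<tau>" for z
      using R_close[of z] autocorr_le[of z] by linarith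
    have single: "c * (\<integral>\<xi>. fourier_square \<xi> * (\<integral>z. cos (vinner d z \<xi>) \<partial>\<nu> j) \<partial>gauss d (1 / \<tau>)) = (\<integral>z. R z \<partial>\<nu> j)"
      and close: "\<bar>(\<integral>z. R z \<partial>\<nu> j) - (\<integral>z. autocorr d V z \<partial>\<nu> j)\<bar> \<le> E \<tau>"
      and int: "integrable (gauss d (1 / \<tau>)) (\<lambda>\<xi>. fourier_square \<xi> * (\<integral>z. cos (vinner d z \<xi>) \<partial>\<nu> j))"
      if j: "j \<in> J" for j
    proof -
      interpret N: prob_space "\<nu> j" by (rule prob[OF j])
      interpret P: pair_prob_space "gauss d (1 / \<tau>)" "\<nu> j" ..
      note [measurable_cong] = sets[OF j]
      have sp: "space (\<nu> j) = space (euclid d)" by (rule sets_eq_imp_space_eq[OF sets[OF j]])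
      have Pint: "integrable (gauss d (1 / \<tau>) \<Otimes>\<^sub>M \<nu> j) (\<lambda>(\<xi>, z). fourier_square \<xi> * cos (vinner d z \<xi>))"
      proof (rule P.integrable_const_bound)
        show "AE p in gauss d (1 / \<tau>) \<Otimes>\<^sub>M \<nu> j. norm (case p of (\<xi>, z) \<Rightarrow> fourier_square \<xi> * cos (vinner d z \<xi>)) \<le> 2 * (L1_norm d V)\<^sup>2 * 1"
          unfolding split_beta' real_norm_def abs_mult
          using fourier_square_le fourier_square_nonneg by (intro AE_I2 mult_mono) auto
      qed measurable
      have "(\<integral>\<xi>. fourier_square \<xi> * (\<integral>z. cos (vinner d z \<xi>) \<partial>\<nu> j) \<partial>gauss d (1 / \<tau>))
          = (\<integral>\<xi>. (\<integral>z. fourier_square \<xi> * cos (vinner d z \<xi>) \<partial>\<nu> j) \<partial>gauss d (1 / \<tau>))"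
        by simp
      also have "\<dots> = (\<integral>z. (\<integral>\<xi>. fourier_square \<xi> * cos (vinner d z \<xi>) \<partial>gauss d (1 / \<tau>)) \<partial>\<nu> j)"
        by (rule P.Fubini_integral[OF Pint, symmetric])
      finally have "c * (\<integral>\<xi>. fourier_square \<xi> * (\<integral>z. cos (vinner d z \<xi>) \<partial>\<nu> j) \<partial>gauss d (1 / \<tau>))
          = (\<integral>z. c * (\<integral>\<xi>. fourier_square \<xi> * cos (vinner d z \<xi>) \<partial>gauss d (1 / \<tau>)) \<partial>\<nu> j)"
        by simp
      also have "\<dots> = (\<integral>z. R z \<partial>\<nu> j)"
        by (intro Bochner_Integration.integral_cong refl) (simp add: sp R_def c_def autocorr_fourier[OF \<tau>])
      finally show "c * (\<integral>\<xi>. fourier_square \<xi> * (\<integral>z. cos (vinner d z \<xi>) \<partial>\<nu> j) \<partial>gauss d (1 / \<tau>)) = (\<integral>z. R z \<partial>\<nu> j)" .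
      show "integrable (gauss d (1 / \<tau>)) (\<lambda>\<xi>. fourier_square \<xi> * (\<integral>z. cos (vinner d z \<xi>) \<partial>\<nu> j))"
        using P.integrable_fst[OF Pint] by simp
      have iR: "integrable (\<nu> j) R"
        by (rule N.integrable_const_bound[of _ "K * L1_norm d V + E \<tau>"]) (auto simp: R_le)
      have i\<rho>: "integrable (\<nu> j) (autocorr d V)"
        by (rule N.integrable_const_bound[of _ "K * L1_norm d V"]) (auto simp: autocorr_le)
      have "\<bar>(\<integral>z. R z \<partial>\<nu> j) - (\<integral>z. autocorr d V z \<partial>\<nu> j)\<bar> = \<bar>\<integral>z. R z - autocorr d V z \<partial>\<nu> j\<bar>"
        using iR i\<rho> by simp
      also have "\<dots> \<le> (\<integral>z. E \<tau> \<partial>\<nu> j)"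
        using iR i\<rho> R_close by (intro order_trans[OF integral_abs_bound integral_mono]) auto
      finally show "\<bar>(\<integral>z. R z \<partial>\<nu> j) - (\<integral>z. autocorr d V z \<partial>\<nu> j)\<bar> \<le> E \<tau>"
        by (simp add: N.prob_space)
    qed
    have "0 \<le> c * (\<integral>\<xi>. fourier_square \<xi> * (\<Sum>j\<in>J. a j * (\<integral>z. cos (vinner d z \<xi>) \<partial>\<nu> j)) \<partial>gauss d (1 / \<tau>))"
      using c nonneg fourier_square_nonneg
      by (intro mult_nonneg_nonneg integral_nonneg_AE AE_I2) auto
    also have "(\<integral>\<xi>. fourier_square \<xi> * (\<Sum>j\<in>J. a j * (\<integral>z. cos (vinner d z \<xi>) \<partial>\<nu> j)) \<partial>gauss d (1 / \<tau>))
        = (\<integral>\<xi>. (\<Sum>j\<in>J. a j * (fourier_square \<xi> * (\<integral>z. cos (vinner d z \<xi>) \<partial>\<nu> j))) \<partial>gauss d (1 / \<tau>))"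
      by (simp add: sum_distrib_left mult_ac)
    also have "\<dots> = (\<Sum>j\<in>J. a j * (\<integral>\<xi>. fourier_square \<xi> * (\<integral>z. cos (vinner d z \<xi>) \<partial>\<nu> j) \<partial>gauss d (1 / \<tau>)))"
      using int by (subst Bochner_Integration.integral_sum) auto
    also have "c * \<dots> = (\<Sum>j\<in>J. a j * (\<integral>z. R z \<partial>\<nu> j))"
      unfolding sum_distrib_left by (intro sum.cong refl) (simp add: single[symmetric])
    also have "\<dots> \<le> (\<Sum>j\<in>J. a j * (\<integral>z. autocorr d V z \<partial>\<nu> j) + \<bar>a j\<bar> * E \<tau>)"
    proof (intro sum_mono)
      fix j assume j: "j \<in> J"
      have "a j * ((\<integral>z. R z \<partial>\<nu> j) - (\<integral>z. autocorr d V z \<partial>\<nu> j)) \<le> \<bar>a j\<bar> * \<bar>(\<integral>z. R z \<partial>\<nu> j) - (\<integral>z. autocorr d V z \<partial>\<nu> j)\<bar>"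
        by (metis abs_ge_self abs_mult)
      also have "\<dots> \<le> \<bar>a j\<bar> * E \<tau>" using close[OF j] by (intro mult_left_mono) auto
      finally show "a j * (\<integral>z. R z \<partial>\<nu> j) \<le> a j * (\<integral>z. autocorr d V z \<partial>\<nu> j) + \<bar>a j\<bar> * E \<tau>"
        by (simp add: right_diff_distrib)
    qed
    finally show ?thesis by (simp add: sum.distrib sum_distrib_right)
  qed
  have "(\<lambda>n. (1 / real (Suc n)) powr \<gamma>) \<longlonglongrightarrow> 0"
  proof -
    have "(\<lambda>n. (1 / real (Suc n)) powr \<gamma>) \<longlonglongrightarrow> 0 powr \<gamma>"
      using \<gamma>_pos LIMSEQ_inverse_real_of_nat
      by (intro tendsto_powr') (auto simp: inverse_eq_divide intro!: tendsto_const always_eventually)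
    then show ?thesis by simp
  qed
  then have "(\<lambda>n. (\<Sum>j\<in>J. a j * (\<integral>z. autocorr d V z \<partial>\<nu> j)) + (\<Sum>j\<in>J. \<bar>a j\<bar>) * E (1 / real (Suc n)))
      \<longlonglongrightarrow> (\<Sum>j\<in>J. a j * (\<integral>z. autocorr d V z \<partial>\<nu> j)) + (\<Sum>j\<in>J. \<bar>a j\<bar>) * (M * (0 * (1 + real d)) * L1_norm d V)"
    unfolding E_def by (intro tendsto_intros)
  from LIMSEQ_le_const[OF this, of 0] key show ?thesis by simp
qed

end

text \<open>Only the dyadic scale at which \<open>2 ^ k * x\<close> is of order 1 matters.\<close>

lemma one_minus_exp_powr_le:
  fixes x \<beta> :: real
  assumes x: "0 \<le> x" and \<beta>: "0 < \<beta>"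
  shows "1 - exp (- (x powr \<beta>)) \<le> 4 * (\<Sum>k<n. (2 powr - \<beta>) ^ k * (1 - exp (- (2 ^ k * x)))) + (2 powr - \<beta>) ^ n"
proof -
  have pw: "(2 powr - \<beta>) ^ k = (1 / 2 ^ k) powr \<beta>" for k
  proof -
    have "1 / 2 ^ k = 2 powr (- real k)" by (simp add: powr_minus powr_realpow divide_inverse)
    then have "(1 / 2 ^ k) powr \<beta> = 2 powr (- real k * \<beta>)" by (simp only: powr_powr)
    moreover have "(2 powr - \<beta>) ^ k = (2 powr - \<beta>) powr real k" by (simp add: powr_realpow)
    then have "(2 powr - \<beta>) ^ k = 2 powr (- \<beta> * real k)" by (simp only: powr_powr)
    ultimately show ?thesis by (simp add: mult.commute)
  qed
  have nn: "0 \<le> (2 powr - \<beta>) ^ k * (1 - exp (- (2 ^ k * x)))" for k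
    using x by (intro mult_nonneg_nonneg) auto
  have sum_nn: "0 \<le> (\<Sum>k<n. (2 powr - \<beta>) ^ k * (1 - exp (- (2 ^ k * x))))"
    by (intro sum_nonneg nn)
  show ?thesis
  \<comment> \<open>For such small \<open>x\<close> no scale \<open>k < n\<close> reaches order 1,
    and the remainder \<open>(2 powr - \<beta>) ^ n\<close> alone dominates
    \<open>x powr \<beta>\<close>.\<close>
  proof (cases "2 ^ n * x < 1")
    case True
    then have "x powr \<beta> \<le> (1 / 2 ^ n) powr \<beta>"
      using x \<beta> by (intro powr_mono2) (auto simp: field_simps)
    moreover have "1 - exp (- (x powr \<beta>)) \<le> x powr \<beta>"
      using exp_ge_add_one_self[of "- (x powr \<beta>)"] by simp
    ultimately show ?thesis using sum_nn pw[of n] by linarith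
  next
    case False
    define m where "m = (LEAST m. 1 \<le> 2 ^ m * x)"
    have m: "1 \<le> 2 ^ m * x" "m \<le> n"
      unfolding m_def using False by (auto intro: LeastI[of "\<lambda>m. 1 \<le> 2 ^ m * x" n] Least_le)
    show ?thesis
    proof (cases n)
      case 0
      then show ?thesis by simp
    next
      case (Suc n')
      \<comment> \<open>The step back by one keeps the index below \<open>n\<close> even when
        \<open>m = n\<close>, and still leaves \<open>2 ^ k * x \<ge> 1 / 2\<close>. For
        \<open>m = 0\<close> truncated subtraction gives \<open>k = 0\<close>; this is the range
        \<open>x \<ge> 1\<close>, where the weight is 1.\<close>
      define k where "k = m - 1"
      have k: "k < n" using m(2) Suc by (auto simp: k_def)
      have half: "1 / 2 \<le> 2 ^ k * x"
        using m(1) by (cases m) (auto simp: k_def)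
      have "exp (- (2 ^ k * x)) \<le> exp (- (1 / 2))" using half by simp
      also have "\<dots> \<le> 2 / 3"
        using exp_ge_add_one_self[of "1 / 2"] by (simp add: exp_minus field_simps)
      \<comment> \<open>The factor 4 in the statement only has to be at least 3, the inverse of this
        lower bound.\<close>
      finally have third: "1 / 3 \<le> 1 - exp (- (2 ^ k * x))" by simp
      have "1 - exp (- (x powr \<beta>)) \<le> (2 powr - \<beta>) ^ k"
      proof (cases m)
        case 0
        then show ?thesis by (simp add: k_def)
      next
        case (Suc m')
        then have "\<not> 1 \<le> 2 ^ k * x" unfolding k_def m_def by (intro not_less_Least) simp
        then have "x powr \<beta> \<le> (1 / 2 ^ k) powr \<beta>"
          using x \<beta> by (intro powr_mono2) (auto simp: field_simps)
        moreover have "1 - exp (- (x powr \<beta>)) \<le> x powr \<beta>"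
          using exp_ge_add_one_self[of "- (x powr \<beta>)"] by simp
        ultimately show ?thesis by (simp add: pw)
      qed
      also have "\<dots> \<le> 4 * ((2 powr - \<beta>) ^ k * (1 - exp (- (2 ^ k * x))))"
        using mult_left_mono[OF third, of "(2 powr - \<beta>) ^ k"] zero_le_power[of "2 powr - \<beta>" k]
        by simp
      also have "\<dots> \<le> 4 * (\<Sum>k<n. (2 powr - \<beta>) ^ k * (1 - exp (- (2 ^ k * x))))"
        using k nn by (intro mult_left_mono member_le_sum) auto
      finally show ?thesis by (simp add: add_increasing2)
    qed
  qed
qed

context hoelder_potential
begin

text \<open>Let \<delta> be the unit mass at 0 and \<open>G k\<close> the measure
  \<open>diff_gauss d (T k)\<close>. The signed measure \<open>4 * (\<Sum>k<n. b ^ k * (\<delta> - G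
  k)) + b ^ n * \<delta> - (\<delta> - \<nu>)\<close> has nonnegative Fourier transform by
  \<open>one_minus_exp_powr_le\<close> with exponent \<open>\<alpha> / 2\<close>, and positive
  definiteness carries this over to the autocorrelation. The constant is \<open>168 = 4 * 42\<close>
  times the sum of a geometric series of ratio \<open>q\<close>.\<close>

lemma autocorr_stable_bound:
  assumes \<alpha>: "0 < \<alpha>" "\<gamma> < \<alpha>" and s: "0 < s"
    and \<nu>: "prob_space \<nu>" "sets \<nu> = sets (euclid d)"
    and cos: "\<And>\<xi>. \<xi> \<in> space (euclid d) \<Longrightarrow> (\<integral>z. cos (vinner d z \<xi>) \<partial>\<nu>) = exp (- s * vnorm d \<xi> powr \<alpha>)"
  shows "(\<integral>x. (V x)\<^sup>2 \<partial>euclid d) - (\<integral>z. autocorr d V z \<partial>\<nu>)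
    \<le> 168 / (1 - 2 powr ((\<gamma> - \<alpha>) / 2)) * M * s powr (\<gamma> / \<alpha>) * L1_norm d V"
proof -
  define \<rho>0 where "\<rho>0 = (\<integral>x. (V x)\<^sup>2 \<partial>euclid d)"
  define b where "b = 2 powr - (\<alpha> / 2)"
  define q where "q = 2 powr ((\<gamma> - \<alpha>) / 2)"
  \<comment> \<open>Chosen so that \<open>(T k * vnorm d \<xi>)\<^sup>2 = 2 ^ k * x\<close> for the
    \<open>x\<close> below, which matches the dyadic scales; the weighted errors
    \<open>b ^ k * T k powr \<gamma>\<close> then decay like \<open>q ^ k\<close>.\<close>
  define T where "T k = 2 powr (real k / 2) * s powr (1 / \<alpha>)" for k :: nat
  have b: "0 < b" "b < 1" using \<alpha> by (auto simp: b_def powr_less_one)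
  have q: "0 < q" "q < 1" using \<alpha> by (auto simp: q_def powr_less_one)
  have T: "0 < T k" for k using s by (simp add: T_def)
  have T2: "(T k)\<^sup>2 = 2 ^ k * s powr (2 / \<alpha>)" for k
    using s by (simp add: T_def power_mult_distrib powr_power powr_realpow)
  have Tg: "T k powr \<gamma> * b ^ k = q ^ k * s powr (\<gamma> / \<alpha>)" for k
    using s by (simp add: T_def b_def q_def powr_mult powr_powr powr_power powr_add[symmetric]
        diff_divide_distrib algebra_simps)
  define B where "B = 42 * M * s powr (\<gamma> / \<alpha>) * L1_norm d V"
  have B: "0 \<le> B" using M_pos L1_norm_nonneg by (simp add: B_def)
  define \<zeta> where "\<zeta> = (\<lambda>i\<in>{..<d}. 0::real)"
  have \<zeta>: "\<zeta> \<in> space (euclid d)" by (simp add: \<zeta>_def space_euclid)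
  have bound: "\<rho>0 - (\<integral>z. autocorr d V z \<partial>\<nu>) \<le> 4 * B / (1 - q) + b ^ n * \<rho>0" for n
  proof -
    \<comment> \<open>All unit masses at 0 are collected in one coefficient:
      \<open>4 * b ^ k\<close> from each Gaussian difference, \<open>b ^ n\<close> from the
      remainder, and -1 from the stable difference.\<close>
    define A where "A = 4 * (\<Sum>k<n. b ^ k) + b ^ n - 1"
    define N where "N k = (if k < n then diff_gauss d (T k) else if k = n then return (euclid d) \<zeta> else \<nu>)" for k
    define a where "a k = (if k < n then - 4 * b ^ k else if k = n then A else 1)" for k
    have sum_eq: "(\<Sum>k<Suc (Suc n). a k * (\<integral>z. h z \<partial>N k))
        = (\<Sum>k<n. - 4 * b ^ k * (\<integral>z. h z \<partial>diff_gauss d (T k))) + A * h \<zeta> + (\<integral>z. h z \<partial>\<nu>)"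
      if "h \<in> borel_measurable (euclid d)" for h :: "(nat \<Rightarrow> real) \<Rightarrow> real"
      using that \<zeta> by (simp add: a_def N_def integral_return)
    have "0 \<le> (\<Sum>k<Suc (Suc n). a k * (\<integral>z. autocorr d V z \<partial>N k))"
    proof (rule autocorr_positive_definite)
      show "prob_space (N k)" for k
        using \<nu>(1) prob_space_diff_gauss[OF T] prob_space_return[OF \<zeta>] by (simp add: N_def)
      show "sets (N k) = sets (euclid d)" for k using \<nu>(2) by (simp add: N_def)
      fix \<xi> assume \<xi>: "\<xi> \<in> space (euclid d)"
      define x where "x = s powr (2 / \<alpha>) * (vnorm d \<xi>)\<^sup>2"
      have x: "0 \<le> x" by (simp add: x_def)
      have x_powr: "x powr (\<alpha> / 2) = s * vnorm d \<xi> powr \<alpha>"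
      proof (cases "vnorm d \<xi> = 0")
        case False
        then have "0 < vnorm d \<xi>" using vnorm_nonneg[of d \<xi>] by linarith
        then show ?thesis using s \<alpha>
          by (simp add: x_def powr_mult powr_powr powr_numeral[symmetric] del: powr_numeral)
      qed (use \<alpha> in \<open>simp add: x_def\<close>)
      have Tx: "(T k * vnorm d \<xi>)\<^sup>2 = 2 ^ k * x" for k by (simp add: power_mult_distrib T2 x_def)
      have z1: "cos (vinner d \<zeta> \<xi>) = 1" by (simp add: \<zeta>_def vinner_def)
      have "(\<Sum>k<Suc (Suc n). a k * (\<integral>z. cos (vinner d z \<xi>) \<partial>N k))
          = (\<Sum>k<n. - 4 * b ^ k * exp (- (2 ^ k * x))) + A + exp (- (x powr (\<alpha> / 2)))"
        by (subst sum_eq)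
           (simp_all add: diff_gauss_cos[OF T] Tx cos[OF \<xi>] z1 x_powr)
      also have "\<dots> = 4 * (\<Sum>k<n. b ^ k * (1 - exp (- (2 ^ k * x)))) + b ^ n - (1 - exp (- (x powr (\<alpha> / 2))))"
        by (simp add: A_def right_diff_distrib sum_subtractf sum_distrib_left sum_negf mult.assoc)
      also have "0 \<le> \<dots>"
        using one_minus_exp_powr_le[OF x, of "\<alpha> / 2" n] \<alpha> by (simp add: b_def)
      finally show "0 \<le> (\<Sum>k<Suc (Suc n). a k * (\<integral>z. cos (vinner d z \<xi>) \<partial>N k))" .
    qed simp
    also have "\<dots> = (\<Sum>k<n. - 4 * b ^ k * (\<integral>z. autocorr d V z \<partial>diff_gauss d (T k))) + A * \<rho>0 + (\<integral>z. autocorr d V z \<partial>\<nu>)"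
      by (subst sum_eq) (auto simp: \<zeta>_def autocorr_zero \<rho>0_def)
    also have "\<dots> = 4 * (\<Sum>k<n. b ^ k * (\<rho>0 - (\<integral>z. autocorr d V z \<partial>diff_gauss d (T k)))) + b ^ n * \<rho>0
        - (\<rho>0 - (\<integral>z. autocorr d V z \<partial>\<nu>))"
      by (simp add: A_def right_diff_distrib sum_subtractf sum_distrib_left sum_distrib_right sum_negf algebra_simps)
    finally have "\<rho>0 - (\<integral>z. autocorr d V z \<partial>\<nu>)
        \<le> 4 * (\<Sum>k<n. b ^ k * (\<rho>0 - (\<integral>z. autocorr d V z \<partial>diff_gauss d (T k)))) + b ^ n * \<rho>0" by simp
    also have "(\<Sum>k<n. b ^ k * (\<rho>0 - (\<integral>z. autocorr d V z \<partial>diff_gauss d (T k)))) \<le> (\<Sum>k<n. q ^ k * B)"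
    proof (intro sum_mono)
      fix k
      have "b ^ k * (\<rho>0 - (\<integral>z. autocorr d V z \<partial>diff_gauss d (T k))) \<le> b ^ k * (42 * M * T k powr \<gamma> * L1_norm d V)"
        unfolding \<rho>0_def using b by (intro mult_left_mono autocorr_diff_gauss_bound T) auto
      also have "\<dots> = 42 * M * (T k powr \<gamma> * b ^ k) * L1_norm d V" by (simp add: mult_ac)
      also have "\<dots> = q ^ k * B" unfolding Tg by (simp add: B_def mult_ac)
      finally show "b ^ k * (\<rho>0 - (\<integral>z. autocorr d V z \<partial>diff_gauss d (T k))) \<le> q ^ k * B" .
    qed
    also have "\<dots> = (\<Sum>k<n. q ^ k) * B" by (simp add: sum_distrib_right)
    also have "(\<Sum>k<n. q ^ k) \<le> 1 / (1 - q)"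
      using q by (simp add: sum_gp_strict divide_right_mono)
    finally show ?thesis using B by (simp add: mult_right_mono)
  qed
  \<comment> \<open>The truncation level \<open>n\<close> was free; since \<open>b < 1\<close>, the
    remainder vanishes in the limit.\<close>
  have "(\<lambda>n. 4 * B / (1 - q) + b ^ n * \<rho>0) \<longlonglongrightarrow> 4 * B / (1 - q) + 0 * \<rho>0"
    using b by (intro tendsto_intros LIMSEQ_realpow_zero) auto
  from LIMSEQ_le_const[OF this, of "\<rho>0 - (\<integral>z. autocorr d V z \<partial>\<nu>)"] bound
  have "\<rho>0 - (\<integral>z. autocorr d V z \<partial>\<nu>) \<le> 4 * B / (1 - q)" by simp
  then show ?thesis by (simp add: B_def \<rho>0_def q_def)
qed

end

section \<open>Stable densities and bridges\<close>

locale stable_bridge_family =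
  fixes d :: nat and \<alpha> :: real
    and p :: "real \<Rightarrow> (nat \<Rightarrow> real) \<Rightarrow> real"
    and P :: "real \<Rightarrow> (nat \<Rightarrow> real) \<Rightarrow> (nat \<Rightarrow> real) \<Rightarrow> (real \<Rightarrow> nat \<Rightarrow> real) measure"
  assumes densities: "stable_densities d \<alpha> p" and bridges: "stable_bridges d p P"
    and \<alpha>_pos: "0 < \<alpha>"
begin

lemma p_integrable: "0 < t \<Longrightarrow> integrable (euclid d) (p t)"
  and p_nonneg: "0 < t \<Longrightarrow> x \<in> space (euclid d) \<Longrightarrow> 0 \<le> p t x"
  using densities by (auto simp: stable_densities_def)

lemma p_measurable [measurable]: "0 < t \<Longrightarrow> p t \<in> borel_measurable (euclid d)"
  using p_integrable by (rule borel_measurable_integrable)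

lemma p_measurable' [measurable (raw)]:
  "0 < t \<Longrightarrow> f \<in> M \<rightarrow>\<^sub>M euclid d \<Longrightarrow> (\<lambda>x. p t (f x)) \<in> borel_measurable M"
  using measurable_compose[OF _ p_measurable] .

lemma p_cos:
  assumes t: "0 < t" and \<xi>: "\<xi> \<in> space (euclid d)"
  shows "(\<integral>y. cos (vinner d y \<xi>) * p t y \<partial>euclid d) = exp (- t * vnorm d \<xi> powr \<alpha>)"
proof -
  let ?f = "\<lambda>y. exp (- \<i> * complex_of_real (vinner d y \<xi>)) * complex_of_real (p t y)"
  have f: "?f y = complex_of_real (cos (vinner d y \<xi>) * p t y) - \<i> * complex_of_real (sin (vinner d y \<xi>) * p t y)" for y
  proof -
    have "exp (- \<i> * complex_of_real (vinner d y \<xi>)) = cis (- vinner d y \<xi>)"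
      by (simp add: cis_conv_exp)
    then show ?thesis by (simp add: complex_eq_iff)
  qed
  have ic: "integrable (euclid d) (\<lambda>y. cos (vinner d y \<xi>) * p t y)"
    and isn: "integrable (euclid d) (\<lambda>y. sin (vinner d y \<xi>) * p t y)"
    using t by (auto intro!: Bochner_Integration.integrable_bound[OF p_integrable[OF t]] simp: abs_mult mult_left_le_one_le)
  have int: "integrable (euclid d) ?f"
    unfolding f using ic isn
    by (intro Bochner_Integration.integrable_diff integrable_mult_right integrable_of_real)
  have "(\<integral>y. cos (vinner d y \<xi>) * p t y \<partial>euclid d) = (\<integral>y. Re (?f y) \<partial>euclid d)"
    by (intro Bochner_Integration.integral_cong refl) (simp only: f, simp)
  also have "\<dots> = Re (\<integral>y. ?f y \<partial>euclid d)" by (rule integral_Re[OF int])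
  also have "(\<integral>y. ?f y \<partial>euclid d) = complex_of_real (exp (- t * vnorm d \<xi> powr \<alpha>))"
    using densities t \<xi> unfolding stable_densities_def by blast
  finally show ?thesis by (simp only: Re_complex_of_real)
qed

text \<open>The Fourier transform at frequency 0.\<close>

lemma p_integral: 
  assumes t: "0 < t" shows "(\<integral>y. p t y \<partial>euclid d) = 1"
proof -
  have "(\<lambda>i\<in>{..<d}. 0::real) \<in> space (euclid d)" by (simp add: space_euclid)
  from p_cos[OF t this] show ?thesis
    using \<alpha>_pos by (simp add: vinner_def vnorm_def L2_set_def)
qed

definition stable_law :: "real \<Rightarrow> (nat \<Rightarrow> real) measure" where
  "stable_law t = density (euclid d) (\<lambda>x. ennreal (p t x))"

lemma sets_stable_law [simp, measurable_cong]: "sets (stable_law t) = sets (euclid d)"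
  by (simp add: stable_law_def)

lemma integral_stable_law:
  fixes h :: "(nat \<Rightarrow> real) \<Rightarrow> real"
  assumes "0 < t" "h \<in> borel_measurable (euclid d)"
  shows "(\<integral>x. h x \<partial>stable_law t) = (\<integral>x. h x * p t x \<partial>euclid d)"
  unfolding stable_law_def using assms p_nonneg
  by (subst integral_density) (auto intro!: Bochner_Integration.integral_cong simp: mult.commute)

lemma prob_space_stable_law:
  assumes t: "0 < t" shows "prob_space (stable_law t)"
proof
  have "emeasure (stable_law t) (space (stable_law t)) = (\<integral>\<^sup>+x. ennreal (p t x) \<partial>euclid d)"
    using t unfolding stable_law_def by (simp add: emeasure_density cong: nn_integral_cong)
  also have "\<dots> = ennreal (\<integral>x. p t x \<partial>euclid d)"
    using t p_nonneg by (intro nn_integral_eq_integral p_integrable) auto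
  finally show "emeasure (stable_law t) (space (stable_law t)) = 1" using p_integral[OF t] by simp
qed

lemma stable_law_cos:
  assumes "0 < t" "\<xi> \<in> space (euclid d)"
  shows "(\<integral>z. cos (vinner d z \<xi>) \<partial>stable_law t) = exp (- t * vnorm d \<xi> powr \<alpha>)"
  using assms p_cos by (subst integral_stable_law) auto

section \<open>Finite-dimensional distributions of the bridge\<close>

definition time_grid :: "real \<Rightarrow> nat \<Rightarrow> (nat \<Rightarrow> real) \<Rightarrow> bool" where
  "time_grid t k s \<longleftrightarrow> 1 \<le> k \<and> s 0 = 0 \<and> s (k + 1) = t \<and> (\<forall>j\<le>k. s j < s (j + 1))"

text \<open>Only the factors between interior times. The two factors that involve the end points of
  the bridge are split off, because integrating over the end points reduces each of them to
  1.\<close>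

definition path_weight :: "nat \<Rightarrow> (nat \<Rightarrow> real) \<Rightarrow> (nat \<Rightarrow> nat \<Rightarrow> real) \<Rightarrow> real" where
  "path_weight k s w = (\<Prod>j\<in>{1..<k}. p (s (j + 1) - s j) (vdiff d (w j) (w (j + 1))))"

lemma bridgeD:
  assumes "0 < t" "x \<in> space (euclid d)" "y \<in> space (euclid d)"
  shows "stable_bridge d p t x y (P t x y)"
  using assms bridges by (auto simp: stable_bridges_def)

lemma prob_space_bridge:
  "0 < t \<Longrightarrow> x \<in> space (euclid d) \<Longrightarrow> y \<in> space (euclid d) \<Longrightarrow> prob_space (P t x y)"
  using bridgeD by (auto simp: stable_bridge_def)

lemma bridge_coordinate_measurable:
  "0 < t \<Longrightarrow> x \<in> space (euclid d) \<Longrightarrow> y \<in> space (euclid d) \<Longrightarrow> 0 \<le> s \<Longrightarrow> s \<le> t \<Longrightarrow>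
    (\<lambda>\<omega>. \<omega> s) \<in> P t x y \<rightarrow>\<^sub>M euclid d"
  using bridgeD[of t x y] by (auto simp: stable_bridge_def)

lemma bridge_in_space:
  "0 < t \<Longrightarrow> x \<in> space (euclid d) \<Longrightarrow> y \<in> space (euclid d) \<Longrightarrow> 0 \<le> s \<Longrightarrow> s \<le> t \<Longrightarrow>
    \<omega> \<in> space (P t x y) \<Longrightarrow> \<omega> s \<in> space (euclid d)"
  using measurable_space[OF bridge_coordinate_measurable] by blast

lemma bridge_cadlag:
  "0 < t \<Longrightarrow> x \<in> space (euclid d) \<Longrightarrow> y \<in> space (euclid d) \<Longrightarrow> \<omega> \<in> space (P t x y) \<Longrightarrow> cadlag_on t \<omega>"
  using bridgeD[of t x y] by (auto simp: stable_bridge_def)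

lemma prod_split_ends:
  assumes "1 \<le> k"
  shows "(\<Prod>j\<le>k. p (s (j + 1) - s j) (vdiff d ((w(0 := x, k + 1 := y)) j) ((w(0 := x, k + 1 := y)) (j + 1))))
    = p (s 1 - s 0) (vdiff d x (w 1)) * path_weight k s w * p (s (k + 1) - s k) (vdiff d (w k) y)"
proof -
  have "{..k} = insert 0 (insert k {1..<k})" using assms by auto
  then show ?thesis
    using assms by (simp add: path_weight_def mult_ac)
qed

lemma bridge_distributed:
  assumes "0 < t" "x \<in> space (euclid d)" "y \<in> space (euclid d)" "time_grid t k s"
  shows "distributed (P t x y) (\<Pi>\<^sub>M j\<in>{1..k}. euclid d) (\<lambda>\<omega>. \<lambda>j\<in>{1..k}. \<omega> (s j))
    (\<lambda>w. ennreal (1 / p t (vdiff d x y) *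
      (p (s 1 - s 0) (vdiff d x (w 1)) * path_weight k s w * p (s (k + 1) - s k) (vdiff d (w k) y))))"
proof -
  have k: "1 \<le> k" using assms(4) by (simp add: time_grid_def)
  have "distributed (P t x y) (\<Pi>\<^sub>M j\<in>{1..k}. euclid d) (\<lambda>\<omega>. \<lambda>j\<in>{1..k}. \<omega> (s j))
          (\<lambda>w. let z = w(0 := x, k + 1 := y) in
             ennreal (1 / p t (vdiff d x y) *
               (\<Prod>j\<le>k. p (s (j + 1) - s j) (vdiff d (z j) (z (j + 1))))))"
    using bridgeD[OF assms(1-3)] assms(4) unfolding stable_bridge_def time_grid_def by blast
  then show ?thesis unfolding Let_def prod_split_ends[OF k] .
qed

text \<open>If the density vanished, then \<open>1 / p t (vdiff d x y)\<close> would be 0 by the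
  convention for division by zero, and the position of the bridge at time \<open>t / 2\<close> would
  have density zero, which is impossible for a probability measure.\<close>

lemma p_pos:
  assumes t: "0 < t" and x: "x \<in> space (euclid d)" and y: "y \<in> space (euclid d)"
  shows "0 < p t (vdiff d x y)"
proof (rule ccontr)
  assume "\<not> 0 < p t (vdiff d x y)"
  then have z: "p t (vdiff d x y) = 0" using p_nonneg[OF t, of "vdiff d x y"] by simp
  interpret B: prob_space "P t x y" by (rule prob_space_bridge[OF assms])
  have "time_grid t 1 (\<lambda>j. t * real j / 2)" using t by (auto simp: time_grid_def field_simps)
  from bridge_distributed[OF assms this]
  have D: "distributed (P t x y) (\<Pi>\<^sub>M j\<in>{1..1}. euclid d) (\<lambda>\<omega>. \<lambda>j\<in>{1..1}. \<omega> (t * real j / 2)) (\<lambda>w. 0)"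
    by (simp add: z)
  have "(\<integral>\<^sup>+w. 0 * 1 \<partial>(\<Pi>\<^sub>M j\<in>{1..1::nat}. euclid d)) = (\<integral>\<^sup>+\<omega>. 1 \<partial>P t x y)"
    by (rule distributed_nn_integral[OF D]) simp
  then show False using B.emeasure_space_1 by simp
qed

lemma time_grid_increment_pos: "time_grid t k s \<Longrightarrow> j \<le> k \<Longrightarrow> 0 < s (j + 1) - s j"
  by (simp add: time_grid_def)

lemma measurable_path_component [measurable]:
  "j \<in> {1..k} \<Longrightarrow> (\<lambda>w. w j) \<in> (\<Pi>\<^sub>M j\<in>{1..k}. euclid d) \<rightarrow>\<^sub>M euclid d"
  by (rule measurable_component_singleton)

lemma path_component_in_space:
  "j \<in> {1..k} \<Longrightarrow> w \<in> space (\<Pi>\<^sub>M j\<in>{1..k}. euclid d) \<Longrightarrow> w j \<in> space (euclid d)"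
  by (auto simp: space_PiM)

lemma path_weight_measurable [measurable]:
  assumes "time_grid t k s"
  shows "path_weight k s \<in> borel_measurable (\<Pi>\<^sub>M j\<in>{1..k}. euclid d)"
  unfolding path_weight_def[abs_def]
  using time_grid_increment_pos[OF assms]
  by (intro borel_measurable_prod p_measurable' measurable_vdiff measurable_path_component) auto

lemma path_weight_nonneg:
  assumes "time_grid t k s" shows "0 \<le> path_weight k s w"
  unfolding path_weight_def using time_grid_increment_pos[OF assms] p_nonneg
  by (intro prod_nonneg) auto

text \<open>Multiplying by \<open>p t\<close> cancels the normalization of the bridge density. What
  remains depends jointly measurably on end points and interior positions, ready for Fubini.\<close>

lemma bridge_integral:
  fixes \<phi> :: "(nat \<Rightarrow> nat \<Rightarrow> real) \<Rightarrow> real"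
  assumes t: "0 < t" and xy: "x \<in> space (euclid d)" "y \<in> space (euclid d)" and grid: "time_grid t k s"
    and \<phi>: "\<phi> \<in> borel_measurable (\<Pi>\<^sub>M j\<in>{1..k}. euclid d)"
  shows "p t (vdiff d x y) * (\<integral>\<omega>. \<phi> (\<lambda>j\<in>{1..k}. \<omega> (s j)) \<partial>P t x y)
    = (\<integral>w. p (s 1 - s 0) (vdiff d x (w 1)) * p (s (k + 1) - s k) (vdiff d (w k) y) * (path_weight k s w * \<phi> w)
        \<partial>(\<Pi>\<^sub>M j\<in>{1..k}. euclid d))"
proof -
  have k: "1 \<le> k" using grid by (simp add: time_grid_def)
  have pos: "0 < s 1 - s 0" "0 < s (k + 1) - s k"
    using time_grid_increment_pos[OF grid, of 0] time_grid_increment_pos[OF grid, of k] by simp_all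
  have "(\<integral>\<omega>. \<phi> (\<lambda>j\<in>{1..k}. \<omega> (s j)) \<partial>P t x y)
      = (\<integral>w. 1 / p t (vdiff d x y) *
      (p (s 1 - s 0) (vdiff d x (w 1)) * path_weight k s w * p (s (k + 1) - s k) (vdiff d (w k) y)) * \<phi> w
        \<partial>(\<Pi>\<^sub>M j\<in>{1..k}. euclid d))"
    using p_nonneg[OF pos(1)] p_nonneg[OF pos(2)] p_pos[OF t xy] path_weight_nonneg[OF grid]
    by (intro distributed_integral[OF bridge_distributed[OF t xy grid] \<phi>, symmetric]) auto
  also have "\<dots> = (\<integral>w. 1 / p t (vdiff d x y) *
      (p (s 1 - s 0) (vdiff d x (w 1)) * p (s (k + 1) - s k) (vdiff d (w k) y) * (path_weight k s w * \<phi> w))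
        \<partial>(\<Pi>\<^sub>M j\<in>{1..k}. euclid d))"
    by (simp add: mult_ac)
  finally show ?thesis using p_pos[OF t xy] by simp
qed

lemma sigma_finite_path_space: "sigma_finite_measure (\<Pi>\<^sub>M j\<in>{1..k::nat}. euclid d)"
proof -
  interpret product_sigma_finite "\<lambda>_::nat. euclid d"
    by (simp add: product_sigma_finite_def euclid.sigma_finite_measure_axioms)
  show ?thesis by (rule sigma_finite) simp
qed

text \<open>The definition of a bridge says nothing about measurability of \<open>P t x y\<close> in
  the end points; it is recovered from the explicit density, for functionals of finitely many
  interior positions.\<close>

lemma bridge_integral_measurable:
  fixes \<phi> :: "(nat \<Rightarrow> nat \<Rightarrow> real) \<Rightarrow> real"
  assumes t: "0 < t" and grid: "time_grid t k s"
    and \<phi> [measurable]: "\<phi> \<in> borel_measurable (\<Pi>\<^sub>M j\<in>{1..k}. euclid d)"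
  shows "(\<lambda>q. \<integral>\<omega>. \<phi> (\<lambda>j\<in>{1..k}. \<omega> (s j)) \<partial>P t (fst q) (snd q)) \<in> borel_measurable (euclid d \<Otimes>\<^sub>M euclid d)"
proof -
  interpret W: sigma_finite_measure "\<Pi>\<^sub>M j\<in>{1..k::nat}. euclid d" by (rule sigma_finite_path_space)
  have k: "1 \<in> {1..k}" "k \<in> {1..k}" using grid by (auto simp: time_grid_def)
  have [measurable]: "(\<lambda>w. w 1) \<in> (\<Pi>\<^sub>M j\<in>{1..k}. euclid d) \<rightarrow>\<^sub>M euclid d"
    "(\<lambda>w. w k) \<in> (\<Pi>\<^sub>M j\<in>{1..k}. euclid d) \<rightarrow>\<^sub>M euclid d"
    using k by (simp_all only: measurable_path_component)
  have pos [measurable]: "0 < s 1 - s 0" "0 < s (k + 1) - s k"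
    using time_grid_increment_pos[OF grid, of 0] time_grid_increment_pos[OF grid, of k] by simp_all
  note [measurable] = t path_weight_measurable[OF grid]
  have "(\<lambda>q. 1 / p t (vdiff d (fst q) (snd q)) *
      (\<integral>w. p (s 1 - s 0) (vdiff d (fst q) (w 1)) * p (s (k + 1) - s k) (vdiff d (w k) (snd q)) * (path_weight k s w * \<phi> w)
        \<partial>(\<Pi>\<^sub>M j\<in>{1..k}. euclid d))) \<in> borel_measurable (euclid d \<Otimes>\<^sub>M euclid d)"
    by measurable
  then show ?thesis
  proof (rule measurable_cong[THEN iffD1, rotated])
    fix q assume "q \<in> space (euclid d \<Otimes>\<^sub>M euclid d)"
    then have q: "fst q \<in> space (euclid d)" "snd q \<in> space (euclid d)" by (auto simp: space_pair_measure)
    show "1 / p t (vdiff d (fst q) (snd q)) *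
      (\<integral>w. p (s 1 - s 0) (vdiff d (fst q) (w 1)) * p (s (k + 1) - s k) (vdiff d (w k) (snd q)) * (path_weight k s w * \<phi> w)
        \<partial>(\<Pi>\<^sub>M j\<in>{1..k}. euclid d)) = (\<integral>\<omega>. \<phi> (\<lambda>j\<in>{1..k}. \<omega> (s j)) \<partial>P t (fst q) (snd q))"
      unfolding bridge_integral[OF t q grid \<phi>, symmetric] using p_pos[OF t q] by simp
  qed
qed

text \<open>
  Integrating out both end points of the bridge leaves Lebesgue measure for the position at the
  first interior time.
\<close>

lemma bridge_integral_total:
  fixes \<phi> :: "(nat \<Rightarrow> nat \<Rightarrow> real) \<Rightarrow> real"
  assumes t: "0 < t" and grid: "time_grid t k s"
    and \<phi> [measurable]: "\<phi> \<in> borel_measurable (\<Pi>\<^sub>M j\<in>{1..k}. euclid d)"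
    and int: "integrable (\<Pi>\<^sub>M j\<in>{1..k}. euclid d) (\<lambda>w. path_weight k s w * \<phi> w)"
  shows "integrable (euclid d \<Otimes>\<^sub>M euclid d)
      (\<lambda>q. p t (vdiff d (fst q) (snd q)) * (\<integral>\<omega>. \<phi> (\<lambda>j\<in>{1..k}. \<omega> (s j)) \<partial>P t (fst q) (snd q)))" (is ?int)
    and "(\<integral>q. p t (vdiff d (fst q) (snd q)) * (\<integral>\<omega>. \<phi> (\<lambda>j\<in>{1..k}. \<omega> (s j)) \<partial>P t (fst q) (snd q)) \<partial>(euclid d \<Otimes>\<^sub>M euclid d))
      = (\<integral>w. path_weight k s w * \<phi> w \<partial>(\<Pi>\<^sub>M j\<in>{1..k}. euclid d))" (is ?eq)
proof -
  define W where "W = (\<Pi>\<^sub>M j\<in>{1..k}. euclid d)"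
  interpret W: sigma_finite_measure W unfolding W_def by (rule sigma_finite_path_space)
  interpret WE: pair_sigma_finite W "euclid d \<Otimes>\<^sub>M euclid d" ..
  have k: "1 \<in> {1..k}" "k \<in> {1..k}" using grid by (auto simp: time_grid_def)
  have [measurable]: "(\<lambda>w. w 1) \<in> W \<rightarrow>\<^sub>M euclid d" "(\<lambda>w. w k) \<in> W \<rightarrow>\<^sub>M euclid d"
    unfolding W_def using k by (simp_all only: measurable_path_component)
  have pos [measurable]: "0 < s 1 - s 0" "0 < s (k + 1) - s k"
    using time_grid_increment_pos[OF grid, of 0] time_grid_increment_pos[OF grid, of k] by simp_all
  have [measurable]: "path_weight k s \<in> borel_measurable W" "\<phi> \<in> borel_measurable W"
    unfolding W_def using path_weight_measurable[OF grid] \<phi> by simp_all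
  \<comment> \<open>For fixed interior positions \<open>w\<close> this is a probability density in
    the pair of end points: a product of one density for the first step and one for the
    last.\<close>
  define g where "g w q = p (s 1 - s 0) (vdiff d (fst q) (w 1)) * p (s (k + 1) - s k) (vdiff d (w k) (snd q))"
    for w and q :: "(nat \<Rightarrow> real) \<times> (nat \<Rightarrow> real)"
  have g0: "0 \<le> g w q" for w q
    using p_nonneg[OF pos(1)] p_nonneg[OF pos(2)] by (simp add: g_def)
  have g_int: "integrable (euclid d \<Otimes>\<^sub>M euclid d) (g w)" and g_one: "(\<integral>q. g w q \<partial>(euclid d \<Otimes>\<^sub>M euclid d)) = 1"
    if w: "w \<in> space W" for w
  proof -
    have w1 [measurable]: "w 1 \<in> space (euclid d)" and wk [measurable]: "w k \<in> space (euclid d)"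
      using w k path_component_in_space unfolding W_def by blast+
    have i1: "integrable (euclid d) (\<lambda>x. p (s 1 - s 0) (vdiff d x (w 1)))"
      and i2: "integrable (euclid d) (\<lambda>y. p (s (k + 1) - s k) (vdiff d (w k) y))"
      using pos by (auto intro!: integrable_euclid_vdiff1 integrable_euclid_vdiff2 p_integrable)
    have e1: "(\<integral>x. p (s 1 - s 0) (vdiff d x (w 1)) \<partial>euclid d) = 1"
      using integral_euclid_vdiff1[OF p_measurable[OF pos(1)]] p_integral[OF pos(1)] by simp
    have e2: "(\<integral>y. p (s (k + 1) - s k) (vdiff d (w k) y) \<partial>euclid d) = 1"
      using integral_euclid_vdiff2[OF p_measurable[OF pos(2)]] p_integral[OF pos(2)] by simp
    show gi: "integrable (euclid d \<Otimes>\<^sub>M euclid d) (g w)"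
    proof (rule euclid2.Fubini_integrable)
      show "integrable (euclid d) (\<lambda>x. \<integral>y. norm (g w (x, y)) \<partial>euclid d)"
        using i1 e2 p_nonneg[OF pos(1)] p_nonneg[OF pos(2)] by (simp add: g_def)
      show "AE x in euclid d. integrable (euclid d) (\<lambda>y. g w (x, y))"
        using i2 by (simp add: g_def)
      show "g w \<in> borel_measurable (euclid d \<Otimes>\<^sub>M euclid d)"
        unfolding g_def[abs_def] by measurable
    qed
    show "(\<integral>q. g w q \<partial>(euclid d \<Otimes>\<^sub>M euclid d)) = 1"
      using e1 e2 by (subst euclid2.integral_fst'[OF gi, symmetric]) (simp add: g_def)
  qed
  have g_meas [measurable]: "(\<lambda>(w, q). g w q) \<in> borel_measurable (W \<Otimes>\<^sub>M (euclid d \<Otimes>\<^sub>M euclid d))"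
    unfolding g_def[abs_def] split_beta' by measurable
  define F where "F w q = g w q * (path_weight k s w * \<phi> w)" for w q
  have F: "integrable (W \<Otimes>\<^sub>M (euclid d \<Otimes>\<^sub>M euclid d)) (case_prod F)"
  proof (rule WE.Fubini_integrable)
    show "case_prod F \<in> borel_measurable (W \<Otimes>\<^sub>M (euclid d \<Otimes>\<^sub>M euclid d))"
      unfolding F_def using g_meas by (simp add: split_beta') 
    have "integrable W (\<lambda>w. norm (path_weight k s w * \<phi> w))" using int unfolding W_def by (rule integrable_norm)
    then show "integrable W (\<lambda>w. \<integral>q. norm (case (w, q) of (w, q) \<Rightarrow> F w q) \<partial>(euclid d \<Otimes>\<^sub>M euclid d))"
      by (rule Bochner_Integration.integrable_cong[THEN iffD1, rotated -1])
         (use g0 g_one in \<open>simp_all add: F_def abs_mult\<close>)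
    show "AE w in W. integrable (euclid d \<Otimes>\<^sub>M euclid d) (\<lambda>q. case (w, q) of (w, q) \<Rightarrow> F w q)"
      using g_int by (intro AE_I2) (simp add: F_def)
  qed
  have eq: "p t (vdiff d (fst q) (snd q)) * (\<integral>\<omega>. \<phi> (\<lambda>j\<in>{1..k}. \<omega> (s j)) \<partial>P t (fst q) (snd q)) = (\<integral>w. F w q \<partial>W)"
    if "q \<in> space (euclid d \<Otimes>\<^sub>M euclid d)" for q
    unfolding F_def g_def W_def
    by (rule bridge_integral[OF t _ _ grid \<phi>]) (use that in \<open>auto simp: space_pair_measure\<close>)
  show ?int
    using WE.integrable_snd[OF F] by (rule Bochner_Integration.integrable_cong[THEN iffD2, rotated -1]) (rule refl, erule eq)
  have "(\<integral>q. p t (vdiff d (fst q) (snd q)) * (\<integral>\<omega>. \<phi> (\<lambda>j\<in>{1..k}. \<omega> (s j)) \<partial>P t (fst q) (snd q)) \<partial>(euclid d \<Otimes>\<^sub>M euclid d))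
      = (\<integral>q. \<integral>w. F w q \<partial>W \<partial>(euclid d \<Otimes>\<^sub>M euclid d))"
    by (intro Bochner_Integration.integral_cong refl eq)
  also have "\<dots> = (\<integral>w. \<integral>q. F w q \<partial>(euclid d \<Otimes>\<^sub>M euclid d) \<partial>W)"
    by (rule WE.Fubini_integral[OF F])
  also have "\<dots> = (\<integral>w. path_weight k s w * \<phi> w \<partial>W)"
    by (intro Bochner_Integration.integral_cong refl) (simp add: F_def g_one)
  finally show ?eq by (simp add: W_def)
qed

end

section \<open>The action along a bridge\<close>

locale bridge_potential = hoelder_potential d V M \<gamma> K + stable_bridge_family d \<alpha> p P
  for d V M \<gamma> K \<alpha> p P +
  fixes t :: real
  assumes t_pos [measurable]: "0 < t"
begin

text \<open>The interval is open since the densities of the bridge describe interior times only and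
  right limits are available strictly before \<open>t\<close>; the two end points do not affect the
  action.\<close>

definition time_measure :: "real measure" where
  "time_measure = restrict_space lborel {0<..<t}"

lemma space_time_measure [simp]: "space time_measure = {0<..<t}"
  by (simp add: time_measure_def space_restrict_space)

lemma measurable_time_measure: "f \<in> borel_measurable borel \<Longrightarrow> f \<in> borel_measurable time_measure"
  unfolding time_measure_def by (rule measurable_restrict_space1) simp

lemma emeasure_time_measure: "emeasure time_measure (space time_measure) = ennreal t"
  using t_pos unfolding time_measure_def
  by (simp add: emeasure_restrict_space space_restrict_space)

sublocale T: finite_measure time_measure
  by standard (simp add: emeasure_time_measure del: space_time_measure)

lemma measure_time_measure [simp]: "measure time_measure {0<..<t} = t"
  using t_pos emeasure_time_measure by (simp add: measure_def)

text \<open>Measurability on the open interval says nothing about the values at 0 and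
  \<open>t\<close>; these are split off as singletons, which are null and measurable on their
  own.\<close>

lemma set_integral_eq_time_measure:
  fixes f :: "real \<Rightarrow> real"
  assumes f: "f \<in> borel_measurable time_measure"
  shows "(LINT s:{0..t}|lborel. f s) = (\<integral>s. f s \<partial>time_measure)"
proof -
  have m: "(\<lambda>s. indicator {0<..<t} s *\<^sub>R f s) \<in> borel_measurable lborel"
    using f unfolding time_measure_def by (subst (asm) borel_measurable_restrict_space_iff) auto
  have "indicator {0..t} s *\<^sub>R f s = indicator {0<..<t} s *\<^sub>R f s + indicator {0} s *\<^sub>R f 0 + indicator {t} s *\<^sub>R f t" for s
    using t_pos by (auto simp: indicator_def)
  then have m': "(\<lambda>s. indicator {0..t} s *\<^sub>R f s) \<in> borel_measurable lborel"
    using m by simp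
  have "AE s in lborel. s \<noteq> 0 \<and> s \<noteq> t"
    using AE_lborel_singleton[of 0] AE_lborel_singleton[of t] by eventually_elim simp
  then have "AE s in lborel. indicator {0..t} s *\<^sub>R f s = indicator {0<..<t} s *\<^sub>R f s"
    by eventually_elim (auto simp: indicator_def)
  then have "(LINT s:{0..t}|lborel. f s) = (LINT s:{0<..<t}|lborel. f s)"
    unfolding set_lebesgue_integral_def by (intro integral_cong_AE m m')
  then show ?thesis
    unfolding time_measure_def set_lebesgue_integral_def by (simp add: integral_restrict_space)
qed

section \<open>Step approximation of the potential along a path\<close>

definition grid :: "nat \<Rightarrow> nat \<Rightarrow> real" where
  "grid k j = t * real j / real (k + 1)"

definition cell :: "nat \<Rightarrow> nat \<Rightarrow> real set" where
  "cell k j = {grid k (j - 1)..<grid k j}"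

text \<open>Each cell carries the value at its right end point, since the paths are right
  continuous; so the approximation depends on finitely many interior times. The last cell before
  \<open>t\<close> is left out, because its right end point would be \<open>t\<close> itself, and
  the value there is 0.\<close>

definition step_path :: "nat \<Rightarrow> real \<Rightarrow> (real \<Rightarrow> nat \<Rightarrow> real) \<Rightarrow> real" where
  "step_path k s \<omega> = (\<Sum>j\<in>{1..k}. indicator (cell k j) s * V (\<omega> (grid k j)))"

lemma time_grid_grid: "1 \<le> k \<Longrightarrow> time_grid t k (grid k)"
  using t_pos by (auto simp: time_grid_def grid_def divide_strict_right_mono)

lemma grid_bounds: "j \<le> k \<Longrightarrow> 0 \<le> grid k j \<and> grid k j \<le> t"
proof -
  assume "j \<le> k"
  then have "t * (real j / real (k + 1)) \<le> t * 1" using t_pos by (intro mult_left_mono) auto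
  then show ?thesis using t_pos by (simp add: grid_def)
qed

lemma indicator_cell_measurable [measurable]: "(\<lambda>s. indicator (cell k j) s :: real) \<in> borel_measurable time_measure"
  unfolding cell_def by (rule measurable_time_measure) measurable

text \<open>The floor numbers the left end point of the cell containing \<open>s\<close>, and adding
  1 gives the right one. Values of \<open>n k\<close> above \<open>k\<close> belong to times outside
  the covered cells.\<close>

lemma step_path_eq:
  assumes s: "0 < s"
  defines "n \<equiv> \<lambda>k. nat \<lfloor>s * real (k + 1) / t\<rfloor> + 1"
  shows "step_path k s \<omega> = (if n k \<le> k then V (\<omega> (grid k (n k))) else 0)"
    and "s < grid k (n k)" "grid k (n k) \<le> s + t / real (k + 1)"
proof -
  define f where "f = \<lfloor>s * real (k + 1) / t\<rfloor>"
  have f0: "0 \<le> f" using s t_pos by (simp add: f_def)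
  have f_eq: "f = i \<longleftrightarrow> real_of_int i * t / real (k + 1) \<le> s \<and> s < (real_of_int i + 1) * t / real (k + 1)" for i
    unfolding f_def floor_eq_iff using t_pos by (simp add: field_simps)
  have nk: "real (n k) = real_of_int f + 1" using f0 by (simp add: n_def f_def)
  have cell_iff: "s \<in> cell k j \<longleftrightarrow> n k = j" if j: "1 \<le> j" for j
  proof -
    have "s \<in> cell k j \<longleftrightarrow> f = int (j - 1)"
      using j by (simp add: cell_def grid_def f_eq of_nat_diff mult.commute)
    also have "\<dots> \<longleftrightarrow> n k = j" using j f0 by (auto simp: n_def f_def)
    finally show ?thesis .
  qed
  have "step_path k s \<omega> = (\<Sum>j\<in>{1..k}. if n k = j then V (\<omega> (grid k j)) else 0)"
    unfolding step_path_def by (intro sum.cong refl) (simp add: indicator_def cell_iff)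
  also have "\<dots> = (if n k \<le> k then V (\<omega> (grid k (n k))) else 0)"
    by (simp add: sum.delta n_def)
  finally show "step_path k s \<omega> = (if n k \<le> k then V (\<omega> (grid k (n k))) else 0)" .
  have "s \<in> cell k (n k)" by (subst cell_iff) (auto simp: n_def)
  then show "s < grid k (n k)" by (simp add: cell_def)
  have "real_of_int f * t / real (k + 1) \<le> s" using f_eq[of f] by blast
  then show "grid k (n k) \<le> s + t / real (k + 1)"
    unfolding grid_def nk by (simp add: distrib_left add_divide_distrib mult.commute)
qed

lemma step_path_le: "0 < s \<Longrightarrow> s < t \<Longrightarrow> (\<And>r. 0 \<le> r \<Longrightarrow> r \<le> t \<Longrightarrow> \<omega> r \<in> space (euclid d)) \<Longrightarrow> \<bar>step_path k s \<omega>\<bar> \<le> K"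
  using K_nonneg grid_bounds by (auto simp: step_path_eq(1) intro!: V_bound)

text \<open>Convergence in the function type is coordinatewise, and only finitely many coordinates
  enter \<open>vnorm\<close>; so the path converges in the Euclidean norm and the Hoelder bound
  passes this on to \<open>V\<close>.\<close>

lemma V_path_right_continuous:
  assumes cad: "cadlag_on t \<omega>" and sp: "\<And>r. 0 \<le> r \<Longrightarrow> r \<le> t \<Longrightarrow> \<omega> r \<in> space (euclid d)"
    and s: "0 < s" "s < t"
  shows "((\<lambda>r. V (\<omega> r)) \<longlongrightarrow> V (\<omega> s)) (at_right s)"
proof -
  have lim: "(\<omega> \<longlongrightarrow> \<omega> s) (at_right s)" using cad s by (auto simp: cadlag_on_def)
  have "((\<lambda>r. \<omega> r i) \<longlongrightarrow> \<omega> s i) (at_right s)" for i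
  proof (rule isCont_tendsto_compose[OF _ lim])
    show "isCont (\<lambda>x::nat \<Rightarrow> real. x i) (\<omega> s)"
      by (rule iffD1[OF continuous_on_eq_continuous_at[OF open_UNIV] continuous_on_product_coordinates,
            THEN bspec, OF UNIV_I])
  qed
  then have "((\<lambda>r. sqrt (\<Sum>i<d. (\<omega> r i - \<omega> s i)\<^sup>2)) \<longlongrightarrow> sqrt (\<Sum>i<d. (\<omega> s i - \<omega> s i)\<^sup>2)) (at_right s)"
    by (intro tendsto_intros)
  then have "((\<lambda>r. vnorm d (vdiff d (\<omega> r) (\<omega> s))) \<longlongrightarrow> 0) (at_right s)"
    by (simp add: vnorm_def L2_set_def vdiff_def)
  then have "((\<lambda>r. vnorm d (vdiff d (\<omega> r) (\<omega> s)) powr \<gamma>) \<longlongrightarrow> 0 powr \<gamma>) (at_right s)"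
    using \<gamma>_pos by (intro tendsto_powr') (auto intro!: tendsto_const)
  then have "((\<lambda>r. M * vnorm d (vdiff d (\<omega> r) (\<omega> s)) powr \<gamma>) \<longlongrightarrow> M * 0) (at_right s)"
    by (intro tendsto_mult_left) simp
  then have lim0: "((\<lambda>r. M * vnorm d (vdiff d (\<omega> r) (\<omega> s)) powr \<gamma>) \<longlongrightarrow> 0) (at_right s)" by simp
  have "((\<lambda>r. V (\<omega> r) - V (\<omega> s)) \<longlongrightarrow> 0) (at_right s)"
  proof (rule Lim_null_comparison[OF _ lim0])
    have "\<forall>\<^sub>F r in at_right s. r \<in> {s<..<t}" using s by (intro eventually_at_right_real)
    then show "\<forall>\<^sub>F r in at_right s. norm (V (\<omega> r) - V (\<omega> s)) \<le> M * vnorm d (vdiff d (\<omega> r) (\<omega> s)) powr \<gamma>"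
      by (rule eventually_mono) (use s in \<open>auto intro!: V_hoelderD sp\<close>)
  qed
  then show ?thesis by (simp add: LIM_zero_iff)
qed

text \<open>The grid point used lies strictly to the right of \<open>s\<close>, so it converges
  along \<open>at_right s\<close>, where right continuity applies. Eventually the omitted last cell
  no longer contains \<open>s\<close>.\<close>

lemma step_path_tendsto:
  assumes cad: "cadlag_on t \<omega>" and sp: "\<And>r. 0 \<le> r \<Longrightarrow> r \<le> t \<Longrightarrow> \<omega> r \<in> space (euclid d)"
    and s: "0 < s" "s < t"
  shows "(\<lambda>k. step_path k s \<omega>) \<longlonglongrightarrow> V (\<omega> s)"
proof -
  define n where "n k = nat \<lfloor>s * real (k + 1) / t\<rfloor> + 1" for k
  note eq = step_path_eq[OF s(1), folded n_def]
  have "(\<lambda>k. grid k (n k)) \<longlonglongrightarrow> s"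
  proof (rule tendsto_sandwich)
    show "\<forall>\<^sub>F k in sequentially. s \<le> grid k (n k)" using eq(2) by (auto intro!: always_eventually less_imp_le)
    show "\<forall>\<^sub>F k in sequentially. grid k (n k) \<le> s + t / real (k + 1)" using eq(3) by (auto intro!: always_eventually)
    have "(\<lambda>k. s + t * (1 / real (Suc k))) \<longlonglongrightarrow> s + t * 0"
      using LIMSEQ_inverse_real_of_nat by (intro tendsto_intros) (simp add: inverse_eq_divide)
    then show "(\<lambda>k. s + t / real (k + 1)) \<longlonglongrightarrow> s" by simp
  qed simp
  then have "filterlim (\<lambda>k. grid k (n k)) (at_right s) sequentially"
    using eq(2) by (auto simp: filterlim_at intro!: always_eventually)
  moreover have "((\<lambda>r. V (\<omega> r)) \<longlongrightarrow> V (\<omega> s)) (at_right s)"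
    by (rule V_path_right_continuous[OF cad _ s]) (rule sp)
  ultimately have lim: "(\<lambda>k. V (\<omega> (grid k (n k)))) \<longlonglongrightarrow> V (\<omega> s)"
    by (rule filterlim_compose[rotated])
  show ?thesis
  proof (rule Lim_transform_eventually[OF lim])
    obtain k0 :: nat where k0: "t / (t - s) < real k0" using reals_Archimedean2 by blast
    show "\<forall>\<^sub>F k in sequentially. V (\<omega> (grid k (n k))) = step_path k s \<omega>"
    proof (rule eventually_sequentiallyI[of k0])
      fix k assume "k0 \<le> k"
      then have "t / (t - s) < real (k + 1)" using k0 by simp
      then have "t < real (k + 1) * (t - s)" using s by (simp add: field_simps)
      then have "s + t / real (k + 1) < t" by (simp add: field_simps)
      then have "grid k (n k) < t" using eq(3)[of k] by linarith
      then have "t * real (n k) < t * real (k + 1)" by (simp add: grid_def divide_less_eq)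
      then have "real (n k) < real (k + 1)" using t_pos by (simp only: mult_less_cancel_left_pos)
      then have "n k \<le> k" by simp
      then show "V (\<omega> (grid k (n k))) = step_path k s \<omega>" by (simp add: eq(1))
    qed
  qed
qed

section \<open>Measurability of bridge expectations in time and end points\<close>

definition bridge :: "(nat \<Rightarrow> real) \<times> (nat \<Rightarrow> real) \<Rightarrow> (real \<Rightarrow> nat \<Rightarrow> real) measure" where
  "bridge q = P t (fst q) (snd q)"

definition p_diff :: "(nat \<Rightarrow> real) \<times> (nat \<Rightarrow> real) \<Rightarrow> real" where
  "p_diff q = p t (vdiff d (fst q) (snd q))"

abbreviation ends :: "((nat \<Rightarrow> real) \<times> (nat \<Rightarrow> real)) measure" where
  "ends \<equiv> euclid d \<Otimes>\<^sub>M euclid d"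

lemma p_diff_measurable [measurable]: "p_diff \<in> borel_measurable ends"
  unfolding p_diff_def[abs_def] using t_pos by measurable

lemma p_diff_nonneg: "0 \<le> p_diff q"
  using p_nonneg[OF t_pos] by (simp add: p_diff_def)

context
  fixes q assumes q: "q \<in> space ends"
begin

lemma endpoints: "fst q \<in> space (euclid d)" "snd q \<in> space (euclid d)"
  using q by (auto simp: space_pair_measure)

lemma prob_space_bridge_q: "prob_space (bridge q)"
  unfolding bridge_def by (rule prob_space_bridge[OF t_pos endpoints])

interpretation B: prob_space "bridge q" by (rule prob_space_bridge_q)

lemma path_in_space: "\<omega> \<in> space (bridge q) \<Longrightarrow> 0 \<le> s \<Longrightarrow> s \<le> t \<Longrightarrow> \<omega> s \<in> space (euclid d)"
  unfolding bridge_def using bridge_in_space[OF t_pos endpoints] by blast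

lemma path_cadlag: "\<omega> \<in> space (bridge q) \<Longrightarrow> cadlag_on t \<omega>"
  unfolding bridge_def using bridge_cadlag[OF t_pos endpoints] by blast

lemma V_path_measurable: "0 \<le> s \<Longrightarrow> s \<le> t \<Longrightarrow> (\<lambda>\<omega>. V (\<omega> s)) \<in> borel_measurable (bridge q)"
  unfolding bridge_def
  by (rule measurable_compose[OF bridge_coordinate_measurable[OF t_pos endpoints] V_measurable])

lemma V_path_le: "\<omega> \<in> space (bridge q) \<Longrightarrow> 0 \<le> s \<Longrightarrow> s \<le> t \<Longrightarrow> \<bar>V (\<omega> s)\<bar> \<le> K"
  by (intro V_bound path_in_space)

lemma step_path_pair_measurable: "(\<lambda>x. step_path k (fst x) (snd x)) \<in> borel_measurable (time_measure \<Otimes>\<^sub>M bridge q)"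
  unfolding step_path_def
proof (intro borel_measurable_sum borel_measurable_times)
  fix j assume j: "j \<in> {1..k}"
  show "(\<lambda>x. indicator (cell k j) (fst x) :: real) \<in> borel_measurable (time_measure \<Otimes>\<^sub>M bridge q)"
    by (rule measurable_compose[OF measurable_fst indicator_cell_measurable])
  show "(\<lambda>x. V (snd x (grid k j))) \<in> borel_measurable (time_measure \<Otimes>\<^sub>M bridge q)"
    using j grid_bounds[of j k] by (intro measurable_compose[OF measurable_snd V_path_measurable]) auto
qed

text \<open>A bridge measure supplies measurability at each fixed time only. Joint measurability in
  time and path, needed for Fubini, comes from the step approximations.\<close>

lemma V_path_pair_measurable: "(\<lambda>x. V (snd x (fst x))) \<in> borel_measurable (time_measure \<Otimes>\<^sub>M bridge q)"
proof (rule borel_measurable_LIMSEQ_real[OF _ step_path_pair_measurable])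
  fix x assume "x \<in> space (time_measure \<Otimes>\<^sub>M bridge q)"
  then show "(\<lambda>k. step_path k (fst x) (snd x)) \<longlonglongrightarrow> V (snd x (fst x))"
    by (intro step_path_tendsto path_cadlag path_in_space) (auto simp: space_pair_measure)
qed

lemma V_path_time_measurable: "\<omega> \<in> space (bridge q) \<Longrightarrow> (\<lambda>s. V (\<omega> s)) \<in> borel_measurable time_measure"
  using measurable_compose[OF measurable_Pair2'[of \<omega> "bridge q" time_measure] V_path_pair_measurable] by simp

lemma V_path_time_integrable: "\<omega> \<in> space (bridge q) \<Longrightarrow> integrable time_measure (\<lambda>s. V (\<omega> s))"
  by (rule T.integrable_const_bound[of _ K]) (auto intro!: V_path_le V_path_time_measurable)

lemma integrable_bridge:
  fixes f :: "(real \<Rightarrow> nat \<Rightarrow> real) \<Rightarrow> real"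
  assumes "f \<in> borel_measurable (bridge q)" "\<And>\<omega>. \<omega> \<in> space (bridge q) \<Longrightarrow> \<bar>f \<omega>\<bar> \<le> C"
  shows "integrable (bridge q) f"
  using assms by (intro B.integrable_const_bound[of _ C]) auto

end

definition action :: "(real \<Rightarrow> nat \<Rightarrow> real) \<Rightarrow> real" where
  "action \<omega> = (\<integral>s. V (\<omega> s) \<partial>time_measure)"

definition mean1 :: "real \<Rightarrow> (nat \<Rightarrow> real) \<times> (nat \<Rightarrow> real) \<Rightarrow> real" where
  "mean1 s q = (\<integral>\<omega>. V (\<omega> s) \<partial>bridge q)"

definition mean2 :: "real \<Rightarrow> real \<Rightarrow> (nat \<Rightarrow> real) \<times> (nat \<Rightarrow> real) \<Rightarrow> real" where
  "mean2 s r q = (\<integral>\<omega>. V (\<omega> s) * V (\<omega> r) \<partial>bridge q)"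

lemma action_measurable:
  assumes q: "q \<in> space ends"
  shows "action \<in> borel_measurable (bridge q)"
proof -
  have "(\<lambda>(\<omega>, s). V (\<omega> s)) \<in> borel_measurable (bridge q \<Otimes>\<^sub>M time_measure)"
    using measurable_compose[OF measurable_pair_swap' V_path_pair_measurable[OF q]] by (simp add: split_beta')
  then show ?thesis
    unfolding action_def[abs_def] by (rule T.borel_measurable_lebesgue_integral)
qed

lemma action_le:
  assumes q: "q \<in> space ends" and \<omega>: "\<omega> \<in> space (bridge q)"
  shows "\<bar>action \<omega>\<bar> \<le> (\<integral>s. \<bar>V (\<omega> s)\<bar> \<partial>time_measure)" "\<bar>action \<omega>\<bar> \<le> t * K"
proof -
  show 1: "\<bar>action \<omega>\<bar> \<le> (\<integral>s. \<bar>V (\<omega> s)\<bar> \<partial>time_measure)"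
    unfolding action_def by (rule integral_abs_bound)
  have "(\<integral>s. \<bar>V (\<omega> s)\<bar> \<partial>time_measure) \<le> (\<integral>s. K \<partial>time_measure)"
    using V_path_time_integrable[OF q \<omega>] by (intro integral_mono) (auto intro!: V_path_le[OF q \<omega>])
  with 1 show "\<bar>action \<omega>\<bar> \<le> t * K" by simp
qed

lemma grid_mean_measurable:
  fixes \<phi> :: "(nat \<Rightarrow> nat \<Rightarrow> real) \<Rightarrow> real"
  assumes "\<phi> \<in> borel_measurable (\<Pi>\<^sub>M j\<in>{1..k}. euclid d)" "1 \<le> k"
  shows "(\<lambda>q. \<integral>\<omega>. \<phi> (\<lambda>j\<in>{1..k}. \<omega> (grid k j)) \<partial>bridge q) \<in> borel_measurable ends"
  unfolding bridge_def using bridge_integral_measurable[OF t_pos time_grid_grid[OF assms(2)] assms(1)] .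

text \<open>At grid times the bridge expectation is measurable in the end points by its explicit
  density, so the expectation of the step path is jointly measurable. Dominated convergence with the
  constant \<open>K\<close> passes to arbitrary times.\<close>

lemma mean1_measurable: "(\<lambda>x. mean1 (fst x) (snd x)) \<in> borel_measurable (time_measure \<Otimes>\<^sub>M ends)"
proof (rule borel_measurable_LIMSEQ_real)
  fix k
  have "(\<lambda>x. \<Sum>j\<in>{1..k}. indicator (cell k j) (fst x) * (\<integral>\<omega>. V (\<omega> (grid k j)) \<partial>bridge (snd x)))
      \<in> borel_measurable (time_measure \<Otimes>\<^sub>M ends)"
  proof (intro borel_measurable_sum borel_measurable_times)
    fix j assume j: "j \<in> {1..k}"
    show "(\<lambda>x. indicator (cell k j) (fst x) :: real) \<in> borel_measurable (time_measure \<Otimes>\<^sub>M ends)"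
      by (rule measurable_compose[OF measurable_fst indicator_cell_measurable])
    have "(\<lambda>w. V (w j)) \<in> borel_measurable (\<Pi>\<^sub>M j\<in>{1..k}. euclid d)"
      by (rule measurable_compose[OF measurable_path_component[OF j] V_measurable])
    from grid_mean_measurable[OF this] j
    have "(\<lambda>q. \<integral>\<omega>. V (\<omega> (grid k j)) \<partial>bridge q) \<in> borel_measurable ends" by simp
    then show "(\<lambda>x. \<integral>\<omega>. V (\<omega> (grid k j)) \<partial>bridge (snd x)) \<in> borel_measurable (time_measure \<Otimes>\<^sub>M ends)"
      by (rule measurable_compose[OF measurable_snd])
  qed
  then show "(\<lambda>x. \<integral>\<omega>. step_path k (fst x) \<omega> \<partial>bridge (snd x)) \<in> borel_measurable (time_measure \<Otimes>\<^sub>M ends)"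
  proof (rule measurable_cong[THEN iffD1, rotated])
    fix x assume "x \<in> space (time_measure \<Otimes>\<^sub>M ends)"
    then have q: "snd x \<in> space ends" by (simp add: space_pair_measure mem_Times_iff)
    show "(\<Sum>j\<in>{1..k}. indicator (cell k j) (fst x) * (\<integral>\<omega>. V (\<omega> (grid k j)) \<partial>bridge (snd x)))
        = (\<integral>\<omega>. step_path k (fst x) \<omega> \<partial>bridge (snd x))"
      unfolding step_path_def
      using grid_bounds[of _ k]
      by (subst Bochner_Integration.integral_sum)
         (auto intro!: integrable_mult_right integrable_bridge[OF q, of _ K] V_path_measurable[OF q] V_path_le[OF q])
  qed
next
  fix x assume x: "x \<in> space (time_measure \<Otimes>\<^sub>M ends)"
  then have q: "snd x \<in> space ends" and s: "0 < fst x" "fst x < t"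
    by (auto simp: space_pair_measure)
  interpret B: prob_space "bridge (snd x)" by (rule prob_space_bridge_q[OF q])
  show "(\<lambda>k. \<integral>\<omega>. step_path k (fst x) \<omega> \<partial>bridge (snd x)) \<longlonglongrightarrow> mean1 (fst x) (snd x)"
    unfolding mean1_def
  proof (rule integral_dominated_convergence[where w="\<lambda>_. K"])
    show "(\<lambda>\<omega>. V (\<omega> (fst x))) \<in> borel_measurable (bridge (snd x))"
      using s by (intro V_path_measurable[OF q]) auto
    show "step_path k (fst x) \<in> borel_measurable (bridge (snd x))" for k
      using measurable_compose[OF measurable_Pair1'[of "fst x" time_measure "bridge (snd x)"] step_path_pair_measurable[OF q]] s
      by simp
    show "AE \<omega> in bridge (snd x). (\<lambda>k. step_path k (fst x) \<omega>) \<longlonglongrightarrow> V (\<omega> (fst x))"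
      using s by (intro AE_I2 step_path_tendsto path_cadlag[OF q] path_in_space[OF q])
    show "AE \<omega> in bridge (snd x). norm (step_path k (fst x) \<omega>) \<le> K" for k
      using s unfolding real_norm_def by (intro AE_I2 step_path_le path_in_space[OF q])
  qed simp
qed

text \<open>The limit argument for one time, with a double sum over grid times. Products of values
  at two grid times, equal or not, are functionals of the same vector of grid positions.\<close>

lemma mean2_measurable:
  "(\<lambda>x. mean2 (fst (fst x)) (snd (fst x)) (snd x)) \<in> borel_measurable ((time_measure \<Otimes>\<^sub>M time_measure) \<Otimes>\<^sub>M ends)"
proof (rule borel_measurable_LIMSEQ_real)
  fix k
  have "(\<lambda>x. \<Sum>i\<in>{1..k}. \<Sum>j\<in>{1..k}. indicator (cell k i) (fst (fst x)) * indicator (cell k j) (snd (fst x)) *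
        (\<integral>\<omega>. V (\<omega> (grid k i)) * V (\<omega> (grid k j)) \<partial>bridge (snd x)))
      \<in> borel_measurable ((time_measure \<Otimes>\<^sub>M time_measure) \<Otimes>\<^sub>M ends)"
  proof (intro borel_measurable_sum borel_measurable_times)
    fix i j assume i: "i \<in> {1..k}" and j: "j \<in> {1..k}"
    show "(\<lambda>x. indicator (cell k i) (fst (fst x)) :: real) \<in> borel_measurable ((time_measure \<Otimes>\<^sub>M time_measure) \<Otimes>\<^sub>M ends)"
      by (intro measurable_compose[OF _ indicator_cell_measurable] measurable_compose[OF measurable_fst measurable_fst])
    show "(\<lambda>x. indicator (cell k j) (snd (fst x)) :: real) \<in> borel_measurable ((time_measure \<Otimes>\<^sub>M time_measure) \<Otimes>\<^sub>M ends)"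
      by (intro measurable_compose[OF _ indicator_cell_measurable] measurable_compose[OF measurable_fst measurable_snd])
    have "(\<lambda>w. V (w i) * V (w j)) \<in> borel_measurable (\<Pi>\<^sub>M j\<in>{1..k}. euclid d)"
      by (intro borel_measurable_times measurable_compose[OF measurable_path_component[OF i] V_measurable]
          measurable_compose[OF measurable_path_component[OF j] V_measurable])
    from grid_mean_measurable[OF this] i j
    have "(\<lambda>q. \<integral>\<omega>. V (\<omega> (grid k i)) * V (\<omega> (grid k j)) \<partial>bridge q) \<in> borel_measurable ends" by simp
    then show "(\<lambda>x. \<integral>\<omega>. V (\<omega> (grid k i)) * V (\<omega> (grid k j)) \<partial>bridge (snd x))
        \<in> borel_measurable ((time_measure \<Otimes>\<^sub>M time_measure) \<Otimes>\<^sub>M ends)"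
      by (rule measurable_compose[OF measurable_snd])
  qed
  then show "(\<lambda>x. \<integral>\<omega>. step_path k (fst (fst x)) \<omega> * step_path k (snd (fst x)) \<omega> \<partial>bridge (snd x))
      \<in> borel_measurable ((time_measure \<Otimes>\<^sub>M time_measure) \<Otimes>\<^sub>M ends)"
  proof (rule measurable_cong[THEN iffD1, rotated])
    fix x assume "x \<in> space ((time_measure \<Otimes>\<^sub>M time_measure) \<Otimes>\<^sub>M ends)"
    then have q: "snd x \<in> space ends" by (simp add: space_pair_measure mem_Times_iff)
    have int: "integrable (bridge (snd x)) (\<lambda>\<omega>. V (\<omega> (grid k i)) * V (\<omega> (grid k j)))"
      if "i \<in> {1..k}" "j \<in> {1..k}" for i j
      using that grid_bounds[of _ k]
      by (intro integrable_bridge[OF q, of _ "K * K"] borel_measurable_times V_path_measurable[OF q])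
         (auto simp: abs_mult intro!: mult_mono V_path_le[OF q] K_nonneg)
    have "(\<integral>\<omega>. step_path k (fst (fst x)) \<omega> * step_path k (snd (fst x)) \<omega> \<partial>bridge (snd x))
        = (\<integral>\<omega>. (\<Sum>i\<in>{1..k}. \<Sum>j\<in>{1..k}. indicator (cell k i) (fst (fst x)) * indicator (cell k j) (snd (fst x)) *
           (V (\<omega> (grid k i)) * V (\<omega> (grid k j)))) \<partial>bridge (snd x))"
      unfolding step_path_def sum_product by (simp add: mult_ac)
    also have "\<dots> = (\<Sum>i\<in>{1..k}. \<integral>\<omega>. (\<Sum>j\<in>{1..k}. indicator (cell k i) (fst (fst x)) * indicator (cell k j) (snd (fst x)) *
        (V (\<omega> (grid k i)) * V (\<omega> (grid k j)))) \<partial>bridge (snd x))"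
      by (rule Bochner_Integration.integral_sum) (rule Bochner_Integration.integrable_sum, intro integrable_mult_right int)
    also have "\<dots> = (\<Sum>i\<in>{1..k}. \<Sum>j\<in>{1..k}. \<integral>\<omega>. indicator (cell k i) (fst (fst x)) * indicator (cell k j) (snd (fst x)) *
        (V (\<omega> (grid k i)) * V (\<omega> (grid k j))) \<partial>bridge (snd x))"
      by (intro sum.cong refl Bochner_Integration.integral_sum integrable_mult_right int)
    also have "\<dots> = (\<Sum>i\<in>{1..k}. \<Sum>j\<in>{1..k}. indicator (cell k i) (fst (fst x)) * indicator (cell k j) (snd (fst x)) *
        (\<integral>\<omega>. V (\<omega> (grid k i)) * V (\<omega> (grid k j)) \<partial>bridge (snd x)))"
      by (simp only: integral_mult_right_zero)
    finally show "(\<Sum>i\<in>{1..k}. \<Sum>j\<in>{1..k}. indicator (cell k i) (fst (fst x)) * indicator (cell k j) (snd (fst x)) *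
        (\<integral>\<omega>. V (\<omega> (grid k i)) * V (\<omega> (grid k j)) \<partial>bridge (snd x)))
      = (\<integral>\<omega>. step_path k (fst (fst x)) \<omega> * step_path k (snd (fst x)) \<omega> \<partial>bridge (snd x))" ..
  qed
next
  fix x assume x: "x \<in> space ((time_measure \<Otimes>\<^sub>M time_measure) \<Otimes>\<^sub>M ends)"
  then have q: "snd x \<in> space ends" and s: "0 < fst (fst x)" "fst (fst x) < t" and r: "0 < snd (fst x)" "snd (fst x) < t"
    by (auto simp: space_pair_measure)
  interpret B: prob_space "bridge (snd x)" by (rule prob_space_bridge_q[OF q])
  have step_meas: "step_path k u \<in> borel_measurable (bridge (snd x))" if "0 < u" "u < t" for k u
    using measurable_compose[OF measurable_Pair1'[of u time_measure "bridge (snd x)"] step_path_pair_measurable[OF q]] that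
    by simp
  show "(\<lambda>k. \<integral>\<omega>. step_path k (fst (fst x)) \<omega> * step_path k (snd (fst x)) \<omega> \<partial>bridge (snd x)) \<longlonglongrightarrow> mean2 (fst (fst x)) (snd (fst x)) (snd x)"
    unfolding mean2_def
  proof (rule integral_dominated_convergence[where w="\<lambda>_. K * K"])
    show "(\<lambda>\<omega>. V (\<omega> (fst (fst x))) * V (\<omega> (snd (fst x)))) \<in> borel_measurable (bridge (snd x))"
      using s r by (intro borel_measurable_times V_path_measurable[OF q]) auto
    show "(\<lambda>\<omega>. step_path k (fst (fst x)) \<omega> * step_path k (snd (fst x)) \<omega>) \<in> borel_measurable (bridge (snd x))" for k
      using s r by (intro borel_measurable_times step_meas)
    show "AE \<omega> in bridge (snd x). (\<lambda>k. step_path k (fst (fst x)) \<omega> * step_path k (snd (fst x)) \<omega>) \<longlonglongrightarrow> V (\<omega> (fst (fst x))) * V (\<omega> (snd (fst x)))"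
      using s r by (intro AE_I2 tendsto_mult step_path_tendsto path_cadlag[OF q] path_in_space[OF q])
    show "AE \<omega> in bridge (snd x). norm (step_path k (fst (fst x)) \<omega> * step_path k (snd (fst x)) \<omega>) \<le> K * K" for k
      using s r unfolding real_norm_def abs_mult by (intro AE_I2 mult_mono step_path_le path_in_space[OF q] K_nonneg abs_ge_zero)
  qed simp
qed

text \<open>The action involves all times at once, but its Riemann sums involve only the grid
  positions, converge on every path and are bounded by \<open>t * K\<close>. So the expectation of
  the exponential is again a limit of measurable functions.\<close>

lemma exp_action_measurable: "(\<lambda>q. \<integral>\<omega>. exp (- action \<omega>) \<partial>bridge q) \<in> borel_measurable ends"
proof (rule borel_measurable_LIMSEQ_real)
  define c :: "nat \<Rightarrow> nat \<Rightarrow> real" where "c k j = (\<integral>s. indicator (cell k j) s \<partial>time_measure)" for k j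
  define A where "A k \<omega> = (\<Sum>j\<in>{1..k}. c k j * V (\<omega> (grid k j)))" for k \<omega>
  have A_eq: "A k \<omega> = (\<integral>s. step_path k s \<omega> \<partial>time_measure)" for k \<omega>
  proof -
    have "integrable time_measure (\<lambda>s. indicator (cell k j) s * V (\<omega> (grid k j)))" for j
      by (intro integrable_mult_left T.integrable_const_bound[of _ 1] indicator_cell_measurable AE_I2)
         (simp add: indicator_def)
    then have "(\<integral>s. step_path k s \<omega> \<partial>time_measure)
        = (\<Sum>j\<in>{1..k}. \<integral>s. indicator (cell k j) s * V (\<omega> (grid k j)) \<partial>time_measure)"
      unfolding step_path_def by (rule Bochner_Integration.integral_sum)
    then show ?thesis by (simp only: A_def c_def integral_mult_left_zero)
  qed
  \<comment> \<open>The index is shifted because the bridge densities require at least one interior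
    time.\<close>
  show "(\<lambda>q. \<integral>\<omega>. exp (- A (Suc k) \<omega>) \<partial>bridge q) \<in> borel_measurable ends" for k
  proof -
    have "(\<lambda>w. exp (- (\<Sum>j\<in>{1..Suc k}. c (Suc k) j * V (w j)))) \<in> borel_measurable (\<Pi>\<^sub>M j\<in>{1..Suc k}. euclid d)"
      by (intro measurable_compose[OF _ borel_measurable_exp] borel_measurable_uminus borel_measurable_sum
          borel_measurable_times borel_measurable_const measurable_compose[OF measurable_path_component V_measurable])
    from grid_mean_measurable[OF this]
    have "(\<lambda>q. \<integral>\<omega>. exp (- (\<Sum>j\<in>{1..Suc k}. c (Suc k) j * V ((\<lambda>j\<in>{1..Suc k}. \<omega> (grid (Suc k) j)) j))) \<partial>bridge q)
        \<in> borel_measurable ends" by simp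
    moreover have "(\<Sum>j\<in>{1..Suc k}. c (Suc k) j * V ((\<lambda>j\<in>{1..Suc k}. \<omega> (grid (Suc k) j)) j)) = A (Suc k) \<omega>" for \<omega>
      unfolding A_def by (rule sum.cong) simp_all
    ultimately show ?thesis by (simp only:)
  qed
  fix q assume q: "q \<in> space ends"
  interpret B: prob_space "bridge q" by (rule prob_space_bridge_q[OF q])
  have A_le: "\<bar>A k \<omega>\<bar> \<le> t * K" if \<omega>: "\<omega> \<in> space (bridge q)" for k \<omega>
  proof -
    have le: "\<bar>step_path k s \<omega>\<bar> \<le> K" if "s \<in> space time_measure" for s
      using that by (intro step_path_le path_in_space[OF q \<omega>]) auto
    have m: "(\<lambda>s. step_path k s \<omega>) \<in> borel_measurable time_measure"
      using measurable_compose[OF measurable_Pair2'[OF \<omega>, of time_measure] step_path_pair_measurable[OF q]] by simp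
    have "\<bar>A k \<omega>\<bar> \<le> (\<integral>s. \<bar>step_path k s \<omega>\<bar> \<partial>time_measure)" unfolding A_eq by (rule integral_abs_bound)
    also have "\<dots> \<le> (\<integral>s. K \<partial>time_measure)"
      using le m K_nonneg by (intro integral_mono T.integrable_const_bound[of _ K]) auto
    finally show ?thesis by simp
  qed
  have A_lim: "(\<lambda>k. A k \<omega>) \<longlonglongrightarrow> action \<omega>" if \<omega>: "\<omega> \<in> space (bridge q)" for \<omega>
    unfolding A_eq action_def
  proof (rule integral_dominated_convergence[where w="\<lambda>_. K"])
    show "(\<lambda>s. step_path k s \<omega>) \<in> borel_measurable time_measure" for k
      using measurable_compose[OF measurable_Pair2'[OF \<omega>, of time_measure] step_path_pair_measurable[OF q]] by simp
    show "AE s in time_measure. (\<lambda>k. step_path k s \<omega>) \<longlonglongrightarrow> V (\<omega> s)"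
      by (intro AE_I2 step_path_tendsto path_cadlag[OF q \<omega>] path_in_space[OF q \<omega>]) auto
    show "AE s in time_measure. norm (step_path k s \<omega>) \<le> K" for k
      unfolding real_norm_def by (intro AE_I2 step_path_le path_in_space[OF q \<omega>]) auto
  qed (use V_path_time_measurable[OF q \<omega>] in auto)
  show "(\<lambda>k. \<integral>\<omega>. exp (- A (Suc k) \<omega>) \<partial>bridge q) \<longlonglongrightarrow> (\<integral>\<omega>. exp (- action \<omega>) \<partial>bridge q)"
  proof (rule integral_dominated_convergence[where w="\<lambda>_. exp (t * K)"])
    show "(\<lambda>\<omega>. exp (- action \<omega>)) \<in> borel_measurable (bridge q)"
      using action_measurable[OF q] by measurable
    have "A k \<in> borel_measurable (bridge q)" for k
      unfolding A_def[abs_def] using grid_bounds[of _ k]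
      by (intro borel_measurable_sum borel_measurable_times borel_measurable_const V_path_measurable[OF q]) auto
    then show "(\<lambda>\<omega>. exp (- A (Suc k) \<omega>)) \<in> borel_measurable (bridge q)" for k
      by measurable
    show "AE \<omega> in bridge q. (\<lambda>k. exp (- A (Suc k) \<omega>)) \<longlonglongrightarrow> exp (- action \<omega>)"
      by (intro AE_I2 tendsto_exp tendsto_minus LIMSEQ_Suc A_lim)
    show "AE \<omega> in bridge q. norm (exp (- A (Suc k) \<omega>)) \<le> exp (t * K)" for k
      using A_le by (intro AE_I2) (auto simp: abs_le_iff)
  qed simp
qed

end

section \<open>Second order expansion of the heat content\<close>

context stable_bridge_family
begin

lemma product_sigma_finite_euclid: "product_sigma_finite (\<lambda>_::nat. euclid d)"
  by (simp add: product_sigma_finite_def euclid.sigma_finite_measure_axioms)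

end

context bridge_potential
begin

text \<open>With a single interior time \<open>path_weight\<close> is an empty product, so Lebesgue
  measure without any weight is left for the position at time \<open>s\<close>.\<close>

lemma bridge_mean_one_time:
  fixes g :: "(nat \<Rightarrow> real) \<Rightarrow> real"
  assumes s: "0 < s" "s < t" and g: "integrable (euclid d) g"
  shows "integrable ends (\<lambda>q. p_diff q * (\<integral>\<omega>. g (\<omega> s) \<partial>bridge q))"
    and "(\<integral>q. p_diff q * (\<integral>\<omega>. g (\<omega> s) \<partial>bridge q) \<partial>ends) = (\<integral>x. g x \<partial>euclid d)"
proof -
  interpret W: product_sigma_finite "\<lambda>_::nat. euclid d" by (rule product_sigma_finite_euclid)
  define \<sigma> where "\<sigma> j = (if j = 0 then 0 else if j = 1 then s else t)" for j :: nat
  have grid: "time_grid t 1 \<sigma>" using s by (auto simp: time_grid_def \<sigma>_def le_Suc_eq)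
  have gm [measurable]: "g \<in> borel_measurable (euclid d)" using g by (rule borel_measurable_integrable)
  have set: "{1..1} = {1::nat}" by auto
  have m: "(\<lambda>w. g (w 1)) \<in> borel_measurable (\<Pi>\<^sub>M j\<in>{1..1::nat}. euclid d)"
    by (rule measurable_compose[OF measurable_path_component gm]) simp
  have w: "path_weight 1 \<sigma> w * g (w 1) = g (w 1)" for w by (simp add: path_weight_def)
  have i: "integrable (\<Pi>\<^sub>M j\<in>{1..1::nat}. euclid d) (\<lambda>w. path_weight 1 \<sigma> w * g (w 1))"
    unfolding w set
  proof -
    have c: "(\<lambda>w. w 1) \<in> (\<Pi>\<^sub>M j\<in>{1::nat}. euclid d) \<rightarrow>\<^sub>M euclid d"
      by (rule measurable_component_singleton) simp
    have "integrable (distr (\<Pi>\<^sub>M j\<in>{1::nat}. euclid d) (euclid d) (\<lambda>w. w 1)) g"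
      unfolding W.distr_singleton by (rule g)
    from integrable_distr[OF c this] show "integrable (\<Pi>\<^sub>M j\<in>{1::nat}. euclid d) (\<lambda>w. g (w 1))" .
  qed
  have e: "(\<lambda>j\<in>{1..1}. \<omega> (\<sigma> j)) 1 = \<omega> s" for \<omega> :: "real \<Rightarrow> nat \<Rightarrow> real" by (simp add: \<sigma>_def)
  note tot = bridge_integral_total[OF t_pos grid m i, unfolded e, folded bridge_def p_diff_def]
  show "integrable ends (\<lambda>q. p_diff q * (\<integral>\<omega>. g (\<omega> s) \<partial>bridge q))" by (rule tot(1))
  have "(\<integral>w. path_weight 1 \<sigma> w * g (w 1) \<partial>(\<Pi>\<^sub>M j\<in>{1..1::nat}. euclid d)) = (\<integral>x. g x \<partial>euclid d)"
    unfolding w set by (rule W.product_integral_singleton[OF gm])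
  with tot(2) show "(\<integral>q. p_diff q * (\<integral>\<omega>. g (\<omega> s) \<partial>bridge q) \<partial>ends) = (\<integral>x. g x \<partial>euclid d)" by simp
qed

text \<open>The substitution \<open>y = x - z\<close> separates the increment \<open>z\<close> from
  the base point; translating \<open>x\<close> by \<open>z\<close> then produces the autocorrelation
  at \<open>z\<close>.\<close>

lemma p_convolution_autocorr:
  assumes u: "0 < u"
  shows "(\<integral>x. \<integral>y. p u (vdiff d x y) * (V x * V y) \<partial>euclid d \<partial>euclid d) = (\<integral>z. autocorr d V z \<partial>stable_law u)"
proof -
  note [measurable] = u
  have "(\<integral>y. p u (vdiff d x y) * (V x * V y) \<partial>euclid d) = (\<integral>z. p u z * (V x * V (vdiff d x z)) \<partial>euclid d)"
    if [measurable]: "x \<in> space (euclid d)" for x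
  proof -
    have "(\<integral>y. p u (vdiff d x y) * (V x * V y) \<partial>euclid d)
        = (\<integral>z. p u (vdiff d x (vdiff d x z)) * (V x * V (vdiff d x z)) \<partial>euclid d)"
      by (rule integral_euclid_vdiff2[symmetric]) measurable
    also have "\<dots> = (\<integral>z. p u z * (V x * V (vdiff d x z)) \<partial>euclid d)"
    proof (intro Bochner_Integration.integral_cong refl)
      fix z assume "z \<in> space (euclid d)"
      then have "vdiff d x (vdiff d x z) = z"
        by (auto simp: vdiff_def space_euclid extensional_def fun_eq_iff)
      then show "p u (vdiff d x (vdiff d x z)) * (V x * V (vdiff d x z)) = p u z * (V x * V (vdiff d x z))" by simp
    qed
    finally show ?thesis .
  qed
  then have "(\<integral>x. \<integral>y. p u (vdiff d x y) * (V x * V y) \<partial>euclid d \<partial>euclid d)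
      = (\<integral>x. \<integral>z. p u z * (V x * V (vdiff d x z)) \<partial>euclid d \<partial>euclid d)"
    by (rule Bochner_Integration.integral_cong[OF refl])
  also have "\<dots> = (\<integral>z. \<integral>x. p u z * (V x * V (vdiff d x z)) \<partial>euclid d \<partial>euclid d)"
  proof (rule euclid2.Fubini_integral)
    have "integrable ends (\<lambda>q. p u (fst q) * (V (snd q) * K))"
    proof (rule euclid2.Fubini_integrable)
      show "integrable (euclid d) (\<lambda>x. \<integral>y. norm (p u (fst (x, y)) * (V (snd (x, y)) * K)) \<partial>euclid d)"
        using p_integrable[OF u] by (simp add: abs_mult)
    qed (use V_integrable in auto)
    then show "integrable ends (\<lambda>(z, x). p u z * (V x * V (vdiff d x z)))"
      by (rule Bochner_Integration.integrable_bound)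
         (auto simp: abs_mult K_nonneg split_beta' intro!: AE_I2 mult_left_mono V_bound)
  qed
  also have "\<dots> = (\<integral>z. autocorr d V z * p u z \<partial>euclid d)"
  proof (intro Bochner_Integration.integral_cong refl)
    fix z assume [measurable]: "z \<in> space (euclid d)"
    have "(\<integral>x. V x * V (vdiff d x z) \<partial>euclid d) = (\<integral>x. V (vadd d x z) * V (vdiff d (vadd d x z) z) \<partial>euclid d)"
      by (rule integral_euclid_vadd[symmetric]) measurable
    also have "\<dots> = autocorr d V z"
      unfolding autocorr_def by (intro Bochner_Integration.integral_cong refl) (simp add: vadd_vdiff_cancel)
    finally show "(\<integral>x. p u z * (V x * V (vdiff d x z)) \<partial>euclid d) = autocorr d V z * p u z" by simp
  qed
  also have "\<dots> = (\<integral>z. autocorr d V z \<partial>stable_law u)"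
    by (rule integral_stable_law[OF u, symmetric]) measurable
  finally show ?thesis .
qed

text \<open>With two interior times a single transition density survives the integration over the
  end points, that of the increment over \<open>r - s\<close>.\<close>

lemma bridge_mean_two_times:
  assumes s: "0 < s" "s < r" "r < t"
  shows "(\<integral>q. p_diff q * mean2 s r q \<partial>ends) = (\<integral>z. autocorr d V z \<partial>stable_law (r - s))"
proof -
  interpret W: product_sigma_finite "\<lambda>_::nat. euclid d" by (rule product_sigma_finite_euclid)
  have u [measurable]: "0 < r - s" using s by simp
  define \<sigma> where "\<sigma> j = (if j = 0 then 0 else if j = 1 then s else if j = 2 then r else t)" for j :: nat
  have grid: "time_grid t 2 \<sigma>" using s by (auto simp: time_grid_def \<sigma>_def le_Suc_eq numeral_2_eq_2)
  have set: "{1..2} = insert 2 {1::nat}" by auto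
  define G where "G x y = p (r - s) (vdiff d x y) * (V x * V y)" for x y
  have G [measurable]: "(\<lambda>(x, y). G x y) \<in> borel_measurable ends" unfolding G_def by measurable
  have m: "(\<lambda>w. V (w 1) * V (w 2)) \<in> borel_measurable (\<Pi>\<^sub>M j\<in>{1..2::nat}. euclid d)"
    by (intro borel_measurable_times measurable_compose[OF measurable_path_component V_measurable]) auto
  have w: "path_weight 2 \<sigma> w * (V (w 1) * V (w 2)) = G (w 1) (w 2)" for w
  proof -
    have "{1..<2} = {1::nat}" by auto
    then show ?thesis by (simp add: path_weight_def G_def \<sigma>_def numeral_2_eq_2)
  qed
  have comp: "(\<lambda>w. w j) \<in> (\<Pi>\<^sub>M j\<in>insert 2 {1::nat}. euclid d) \<rightarrow>\<^sub>M euclid d" if "j = 1 \<or> j = 2" for j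
    using that by (intro measurable_component_singleton) auto
  have mG: "(\<lambda>w. G (w 1) (w 2)) \<in> borel_measurable (\<Pi>\<^sub>M j\<in>insert 2 {1::nat}. euclid d)"
    using measurable_compose[OF measurable_Pair[OF comp[of 1] comp[of 2]] G] by simp
  \<comment> \<open>One factor of \<open>V\<close> is bounded by \<open>K\<close> and the other is
    kept for integrability in \<open>x\<close>; the density integrates to 1 in
    \<open>y\<close>.\<close>
  have i: "integrable (\<Pi>\<^sub>M j\<in>insert 2 {1::nat}. euclid d) (\<lambda>w. G (w 1) (w 2))"
  proof (rule integrableI_bounded[OF mG])
    have "(\<integral>\<^sup>+w. ennreal (norm (G (w 1) (w 2))) \<partial>(\<Pi>\<^sub>M j\<in>insert 2 {1::nat}. euclid d))
        = (\<integral>\<^sup>+w. \<integral>\<^sup>+y. ennreal (norm (G (w 1) y)) \<partial>euclid d \<partial>(\<Pi>\<^sub>M j\<in>{1::nat}. euclid d))"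
      using mG by (subst W.product_nn_integral_insert) auto
    also have "\<dots> = (\<integral>\<^sup>+x. \<integral>\<^sup>+y. ennreal (norm (G x y)) \<partial>euclid d \<partial>euclid d)"
      by (rule W.product_nn_integral_singleton) measurable
    also have "\<dots> \<le> (\<integral>\<^sup>+x. \<integral>\<^sup>+y. ennreal (K * \<bar>V x\<bar>) * ennreal (p (r - s) (vdiff d x y)) \<partial>euclid d \<partial>euclid d)"
    proof (intro nn_integral_mono)
      fix x y assume "x \<in> space (euclid d)" "y \<in> space (euclid d)"
      then have "p (r - s) (vdiff d x y) * (\<bar>V x\<bar> * \<bar>V y\<bar>) \<le> p (r - s) (vdiff d x y) * (\<bar>V x\<bar> * K)"
        using p_nonneg[OF u] by (intro mult_left_mono V_bound) auto
      then show "ennreal (norm (G x y)) \<le> ennreal (K * \<bar>V x\<bar>) * ennreal (p (r - s) (vdiff d x y))"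
        using p_nonneg[OF u, of "vdiff d x y"] K_nonneg
        by (simp add: G_def abs_mult ennreal_mult[symmetric] mult_ac ennreal_leI)
    qed
    also have "\<dots> = (\<integral>\<^sup>+x. ennreal (K * \<bar>V x\<bar>) * 1 \<partial>euclid d)"
    proof (intro nn_integral_cong)
      fix x assume [measurable]: "x \<in> space (euclid d)"
      have "(\<integral>\<^sup>+y. ennreal (p (r - s) (vdiff d x y)) \<partial>euclid d) = (\<integral>\<^sup>+y. ennreal (p (r - s) y) \<partial>euclid d)"
        by (rule nn_integral_euclid_vdiff2) measurable
      also have "\<dots> = 1"
        using p_nonneg[OF u] p_integral[OF u] by (subst nn_integral_eq_integral[OF p_integrable[OF u]]) auto
      finally show "(\<integral>\<^sup>+y. ennreal (K * \<bar>V x\<bar>) * ennreal (p (r - s) (vdiff d x y)) \<partial>euclid d) = ennreal (K * \<bar>V x\<bar>) * 1"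
        by (subst nn_integral_cmult) auto
    qed
    also have "\<dots> = ennreal (\<integral>x. K * \<bar>V x\<bar> \<partial>euclid d)"
      unfolding mult_1_right using V_integrable K_nonneg by (intro nn_integral_eq_integral) auto
    also have "\<dots> < \<infinity>" by simp
    finally show "(\<integral>\<^sup>+w. ennreal (norm (G (w 1) (w 2))) \<partial>(\<Pi>\<^sub>M j\<in>insert 2 {1::nat}. euclid d)) < \<infinity>" .
  qed
  have e: "(\<lambda>j\<in>{1..2}. \<omega> (\<sigma> j)) 1 = \<omega> s" "(\<lambda>j\<in>{1..2}. \<omega> (\<sigma> j)) 2 = \<omega> r" for \<omega> :: "real \<Rightarrow> nat \<Rightarrow> real"
    by (simp_all add: \<sigma>_def)
  have i': "integrable (\<Pi>\<^sub>M j\<in>{1..2::nat}. euclid d) (\<lambda>w. path_weight 2 \<sigma> w * (V (w 1) * V (w 2)))"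
    unfolding w set by (rule i)
  have "(\<integral>q. p_diff q * mean2 s r q \<partial>ends) = (\<integral>w. path_weight 2 \<sigma> w * (V (w 1) * V (w 2)) \<partial>(\<Pi>\<^sub>M j\<in>{1..2::nat}. euclid d))"
    using bridge_integral_total(2)[OF t_pos grid m i', unfolded e, folded bridge_def p_diff_def]
    by (simp add: mean2_def)
  also have "\<dots> = (\<integral>w. \<integral>y. G (w 1) y \<partial>euclid d \<partial>(\<Pi>\<^sub>M j\<in>{1::nat}. euclid d))"
    unfolding w set using i by (subst W.product_integral_insert) auto
  also have "\<dots> = (\<integral>x. \<integral>y. G x y \<partial>euclid d \<partial>euclid d)"
    by (rule W.product_integral_singleton) measurable
  also have "\<dots> = (\<integral>z. autocorr d V z \<partial>stable_law (r - s))"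
    unfolding G_def by (rule p_convolution_autocorr[OF u])
  finally show ?thesis .
qed

text \<open>The bound at the largest possible time gap \<open>t\<close>; it dominates all smaller
  gaps since the exponent \<open>\<gamma> / \<alpha>\<close> is positive.\<close>

definition holder_error :: real where
  "holder_error = 168 / (1 - 2 powr ((\<gamma> - \<alpha>) / 2)) * M * t powr (\<gamma> / \<alpha>) * L1_norm d V"

text \<open>One side is free: the autocorrelation never exceeds its value at 0. The other is
  \<open>autocorr_stable_bound\<close>, whose right side increases with the time gap.\<close>

lemma stable_law_autocorr_close:
  assumes \<alpha>: "\<gamma> < \<alpha>" and u: "0 < u" "u \<le> t"
  shows "\<bar>(\<integral>z. autocorr d V z \<partial>stable_law u) - (\<integral>x. (V x)\<^sup>2 \<partial>euclid d)\<bar> \<le> holder_error"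
proof -
  interpret S: prob_space "stable_law u" by (rule prob_space_stable_law[OF u(1)])
  have "autocorr d V \<in> borel_measurable (stable_law u)"
    using measurable_autocorr[OF V_measurable measurable_ident_sets[OF sets_stable_law]] by simp
  then have "(\<integral>z. autocorr d V z \<partial>stable_law u) \<le> (\<integral>z. (\<integral>x. (V x)\<^sup>2 \<partial>euclid d) \<partial>stable_law u)"
    using autocorr_le autocorr_le_zero
    by (intro integral_mono S.integrable_const_bound[of "autocorr d V" "K * L1_norm d V"]) auto
  then have 1: "(\<integral>z. autocorr d V z \<partial>stable_law u) \<le> (\<integral>x. (V x)\<^sup>2 \<partial>euclid d)"
    by (simp add: S.prob_space)
  have q: "2 powr ((\<gamma> - \<alpha>) / 2) < 1" using \<alpha> by (simp add: powr_less_one)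
  have "(\<integral>x. (V x)\<^sup>2 \<partial>euclid d) - (\<integral>z. autocorr d V z \<partial>stable_law u)
      \<le> 168 / (1 - 2 powr ((\<gamma> - \<alpha>) / 2)) * M * u powr (\<gamma> / \<alpha>) * L1_norm d V"
    by (rule autocorr_stable_bound[OF \<alpha>_pos \<alpha> u(1) prob_space_stable_law[OF u(1)] sets_stable_law stable_law_cos[OF u(1)]])
  also have "\<dots> \<le> holder_error"
    unfolding holder_error_def using u q M_pos L1_norm_nonneg \<gamma>_pos \<alpha>_pos
    by (intro mult_right_mono mult_left_mono powr_mono2) auto
  finally show ?thesis using 1 by simp
qed

lemma mean2_total_close:
  assumes \<alpha>: "\<gamma> < \<alpha>" and s: "0 < s" "s < t" and r: "0 < r" "r < t"
  shows "\<bar>(\<integral>q. p_diff q * mean2 s r q \<partial>ends) - (\<integral>x. (V x)\<^sup>2 \<partial>euclid d)\<bar> \<le> holder_error"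
proof -
  consider "s < r" | "r < s" | "s = r" by linarith
  then show ?thesis
  proof cases
    case 1
    then show ?thesis
      using stable_law_autocorr_close[OF \<alpha>, of "r - s"] s r by (simp add: bridge_mean_two_times)
  next
    case 2
    have "mean2 s r = mean2 r s" by (simp add: fun_eq_iff mean2_def mult.commute)
    with 2 show ?thesis
      using stable_law_autocorr_close[OF \<alpha>, of "s - r"] s r by (simp add: bridge_mean_two_times)
  next
    \<comment> \<open>Coinciding times admit no grid with two interior points, but the difference is
      then exactly 0. The estimate at gap \<open>t\<close> is cited because it shows that
      \<open>holder_error\<close> is nonnegative.\<close>
    case 3
    have "(\<integral>q. p_diff q * mean2 s r q \<partial>ends) = (\<integral>x. (V x)\<^sup>2 \<partial>euclid d)"
      using bridge_mean_one_time(2)[OF s integrable_V_square] 3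
      by (simp add: mean2_def power2_eq_square)
    then show ?thesis using stable_law_autocorr_close[OF \<alpha> t_pos order_refl] by simp
  qed
qed

section \<open>Moments of the action\<close>

lemma mean_abs_one_time:
  assumes s: "0 < s" "s < t"
  shows "integrable ends (\<lambda>q. p_diff q * (\<integral>\<omega>. \<bar>V (\<omega> s)\<bar> \<partial>bridge q))"
    and "(\<integral>q. p_diff q * (\<integral>\<omega>. \<bar>V (\<omega> s)\<bar> \<partial>bridge q) \<partial>ends) = L1_norm d V"
  using bridge_mean_one_time[OF s, of "\<lambda>x. \<bar>V x\<bar>"] V_integrable by (auto simp: L1_norm_def)

text \<open>Integrability over the end points has to come from \<open>V\<close>, as
  \<open>p_diff\<close> itself has infinite integral over \<open>ends\<close> when \<open>d\<close>
  is positive. So one factor \<open>\<bar>V (\<omega> s)\<bar>\<close> is kept, and only the other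
  is bounded by \<open>K\<close>.\<close>

lemma mean_abs_le:
  assumes q: "q \<in> space ends" and s: "0 < s" "s < t" and r: "0 < r" "r < t"
  shows "\<bar>p_diff q * mean1 s q\<bar> \<le> p_diff q * (\<integral>\<omega>. \<bar>V (\<omega> s)\<bar> \<partial>bridge q)"
    and "\<bar>p_diff q * mean2 s r q\<bar> \<le> K * (p_diff q * (\<integral>\<omega>. \<bar>V (\<omega> s)\<bar> \<partial>bridge q))"
proof -
  have i: "integrable (bridge q) (\<lambda>\<omega>. V (\<omega> u))" if "0 < u" "u < t" for u
    using that by (intro integrable_bridge[OF q, of _ K] V_path_measurable[OF q] V_path_le[OF q]) auto
  have i2: "integrable (bridge q) (\<lambda>\<omega>. \<bar>V (\<omega> s) * V (\<omega> r)\<bar>)"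
    using s r by (intro integrable_bridge[OF q, of _ "K * K"] borel_measurable_abs borel_measurable_times V_path_measurable[OF q])
      (auto simp: abs_mult intro!: mult_mono V_path_le[OF q] K_nonneg)
  have "\<bar>mean1 s q\<bar> \<le> (\<integral>\<omega>. \<bar>V (\<omega> s)\<bar> \<partial>bridge q)"
    unfolding mean1_def by (rule integral_abs_bound)
  then show "\<bar>p_diff q * mean1 s q\<bar> \<le> p_diff q * (\<integral>\<omega>. \<bar>V (\<omega> s)\<bar> \<partial>bridge q)"
    using p_diff_nonneg[of q] by (simp add: abs_mult mult_left_mono)
  have "\<bar>mean2 s r q\<bar> \<le> (\<integral>\<omega>. K * \<bar>V (\<omega> s)\<bar> \<partial>bridge q)"
    unfolding mean2_def
  proof (rule order_trans[OF integral_abs_bound integral_mono])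
    show "\<bar>V (\<omega> s) * V (\<omega> r)\<bar> \<le> K * \<bar>V (\<omega> s)\<bar>" if "\<omega> \<in> space (bridge q)" for \<omega>
    proof -
      have "\<bar>V (\<omega> s)\<bar> * \<bar>V (\<omega> r)\<bar> \<le> \<bar>V (\<omega> s)\<bar> * K"
        using V_path_le[OF q that, of r] r by (intro mult_left_mono) auto
      then show ?thesis by (simp add: abs_mult mult.commute)
    qed
  qed (use i2 i[OF s] in auto)
  then have le: "\<bar>mean2 s r q\<bar> \<le> K * (\<integral>\<omega>. \<bar>V (\<omega> s)\<bar> \<partial>bridge q)" by simp
  show "\<bar>p_diff q * mean2 s r q\<bar> \<le> K * (p_diff q * (\<integral>\<omega>. \<bar>V (\<omega> s)\<bar> \<partial>bridge q))"
    using mult_left_mono[OF le p_diff_nonneg[of q]] p_diff_nonneg[of q]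
    by (simp add: abs_mult mult.left_commute)
qed

text \<open>Fubini is used once for time and path and once for time and end points. Every interior
  time contributes the same integral of \<open>V\<close>, hence the factor \<open>t\<close>.\<close>

lemma action_mean:
  "integrable ends (\<lambda>q. p_diff q * (\<integral>\<omega>. action \<omega> \<partial>bridge q))"
  "(\<integral>q. p_diff q * (\<integral>\<omega>. action \<omega> \<partial>bridge q) \<partial>ends) = t * (\<integral>x. V x \<partial>euclid d)"
proof -
  interpret TE: pair_sigma_finite time_measure ends ..
  define F where "F s q = p_diff q * mean1 s q" for s q
  have Fm [measurable]: "(\<lambda>(s, q). F s q) \<in> borel_measurable (time_measure \<Otimes>\<^sub>M ends)"
    unfolding F_def using mean1_measurable by (simp add: split_beta')
  have F_int: "integrable ends (F s)" and F_le: "(\<integral>q. \<bar>F s q\<bar> \<partial>ends) \<le> L1_norm d V"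
    if s: "0 < s" "s < t" for s
  proof -
    have m: "F s \<in> borel_measurable ends"
      using measurable_compose[OF measurable_Pair1'[of s time_measure ends] Fm] s by simp
    show i: "integrable ends (F s)"
      by (rule Bochner_Integration.integrable_bound[OF mean_abs_one_time(1)[OF s] m])
         (auto simp: F_def intro!: order_trans[OF mean_abs_le(1)[OF _ s s] abs_ge_self] simp del: space_pair_measure)
    have "(\<integral>q. \<bar>F s q\<bar> \<partial>ends) \<le> (\<integral>q. p_diff q * (\<integral>\<omega>. \<bar>V (\<omega> s)\<bar> \<partial>bridge q) \<partial>ends)"
    proof (rule integral_mono[OF integrable_abs[OF i] mean_abs_one_time(1)[OF s]])
      show "\<bar>F s q\<bar> \<le> p_diff q * (\<integral>\<omega>. \<bar>V (\<omega> s)\<bar> \<partial>bridge q)" if "q \<in> space ends" for q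
        unfolding F_def by (rule mean_abs_le(1)[OF that s s])
    qed
    then show "(\<integral>q. \<bar>F s q\<bar> \<partial>ends) \<le> L1_norm d V" by (simp add: mean_abs_one_time(2)[OF s])
  qed
  have F: "integrable (time_measure \<Otimes>\<^sub>M ends) (\<lambda>(s, q). F s q)"
  proof (rule TE.Fubini_integrable[OF Fm])
    show "integrable time_measure (\<lambda>s. \<integral>q. norm (case (s, q) of (s, q) \<Rightarrow> F s q) \<partial>ends)"
    proof (rule T.integrable_const_bound[of _ "L1_norm d V"])
      show "AE s in time_measure. norm (\<integral>q. norm (case (s, q) of (s, q) \<Rightarrow> F s q) \<partial>ends) \<le> L1_norm d V"
        using F_le by (intro AE_I2) auto
    qed measurable
    show "AE s in time_measure. integrable ends (\<lambda>q. case (s, q) of (s, q) \<Rightarrow> F s q)"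
      using F_int by (intro AE_I2) auto
  qed
  have eq: "p_diff q * (\<integral>\<omega>. action \<omega> \<partial>bridge q) = (\<integral>s. F s q \<partial>time_measure)" if q: "q \<in> space ends" for q
  proof -
    interpret B: prob_space "bridge q" by (rule prob_space_bridge_q[OF q])
    interpret TB: pair_sigma_finite time_measure "bridge q" ..
    have "integrable (time_measure \<Otimes>\<^sub>M bridge q) (\<lambda>x. V (snd x (fst x)))"
    proof (rule TB.Fubini_integrable[OF V_path_pair_measurable[OF q]])
      have [measurable]: "(\<lambda>(s, \<omega>). norm (V (\<omega> s))) \<in> borel_measurable (time_measure \<Otimes>\<^sub>M bridge q)"
        using V_path_pair_measurable[OF q] by (simp add: split_beta')
      have le: "\<bar>\<integral>\<omega>. \<bar>V (\<omega> s)\<bar> \<partial>bridge q\<bar> \<le> K" if "0 < s" "s < t" for s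
      proof -
        have "(\<integral>\<omega>. \<bar>V (\<omega> s)\<bar> \<partial>bridge q) \<le> (\<integral>\<omega>. K \<partial>bridge q)"
          using that K_nonneg
          by (intro integral_mono integrable_abs integrable_bridge[OF q, of _ K] V_path_measurable[OF q] V_path_le[OF q]) auto
        then show ?thesis by (simp add: B.prob_space)
      qed
      show "integrable time_measure (\<lambda>s. \<integral>\<omega>. norm (V (snd (s, \<omega>) (fst (s, \<omega>)))) \<partial>bridge q)"
        unfolding fst_conv snd_conv
      proof (rule T.integrable_const_bound[of _ K])
        show "AE s in time_measure. norm (\<integral>\<omega>. norm (V (\<omega> s)) \<partial>bridge q) \<le> K"
          using le by (intro AE_I2) auto
      qed measurable
      show "AE s in time_measure. integrable (bridge q) (\<lambda>\<omega>. V (snd (s, \<omega>) (fst (s, \<omega>))))"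
        by (intro AE_I2 integrable_bridge[OF q, of _ K]) (auto intro!: V_path_measurable[OF q] V_path_le[OF q])
    qed
    then have "integrable (time_measure \<Otimes>\<^sub>M bridge q) (\<lambda>(s, \<omega>). V (\<omega> s))"
      by (simp add: split_beta')
    from TB.Fubini_integral[OF this] show ?thesis
      by (simp add: action_def F_def mean1_def)
  qed
  show "integrable ends (\<lambda>q. p_diff q * (\<integral>\<omega>. action \<omega> \<partial>bridge q))"
    using TE.integrable_snd[OF F] by (rule Bochner_Integration.integrable_cong[THEN iffD2, rotated -1]) (rule refl, erule eq)
  have "(\<integral>q. p_diff q * (\<integral>\<omega>. action \<omega> \<partial>bridge q) \<partial>ends) = (\<integral>q. \<integral>s. F s q \<partial>time_measure \<partial>ends)"
    by (intro Bochner_Integration.integral_cong refl eq)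
  also have "\<dots> = (\<integral>s. \<integral>q. F s q \<partial>ends \<partial>time_measure)"
    by (rule TE.Fubini_integral[OF F])
  also have "\<dots> = (\<integral>s. (\<integral>x. V x \<partial>euclid d) \<partial>time_measure)"
    using bridge_mean_one_time(2)[OF _ _ V_integrable]
    by (intro Bochner_Integration.integral_cong refl) (simp add: F_def mean1_def)
  finally show "(\<integral>q. p_diff q * (\<integral>\<omega>. action \<omega> \<partial>bridge q) \<partial>ends) = t * (\<integral>x. V x \<partial>euclid d)" by simp
qed

text \<open>The square of the action is an integral over pairs of times, and
  \<open>mean2_total_close\<close> holds uniformly on the square of side \<open>t\<close>, whose
  area is the factor \<open>t\<^sup>2\<close>.\<close>

lemma action_square_mean:
  assumes \<alpha>: "\<gamma> < \<alpha>"
  shows "integrable ends (\<lambda>q. p_diff q * (\<integral>\<omega>. (action \<omega>)\<^sup>2 \<partial>bridge q))"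
    and "\<bar>(\<integral>q. p_diff q * (\<integral>\<omega>. (action \<omega>)\<^sup>2 \<partial>bridge q) \<partial>ends) - t\<^sup>2 * (\<integral>x. (V x)\<^sup>2 \<partial>euclid d)\<bar> \<le> t\<^sup>2 * holder_error"
proof -
  define T2 where "T2 = time_measure \<Otimes>\<^sub>M time_measure"
  interpret TT: pair_sigma_finite time_measure time_measure ..
  interpret T2: finite_measure T2
    unfolding T2_def by (rule finite_measure_pair_measure) (rule T.finite_measure_axioms)+
  interpret TE: pair_sigma_finite T2 ends ..
  have space_T2: "space T2 = {0<..<t} \<times> {0<..<t}" by (simp add: T2_def space_pair_measure)
  have measure_T2: "measure T2 (space T2) = t\<^sup>2"
  proof -
    have "{0<..<t} \<in> sets time_measure" using sets.top[of time_measure] by simp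
    then have "emeasure T2 (space T2) = emeasure time_measure {0<..<t} * emeasure time_measure {0<..<t}"
      unfolding space_T2 unfolding T2_def by (intro T.emeasure_pair_measure_Times)
    also have "\<dots> = ennreal (t\<^sup>2)"
      using emeasure_time_measure t_pos by (simp add: ennreal_mult[symmetric] power2_eq_square)
    finally show ?thesis by (simp add: measure_def)
  qed
  define F where "F x q = p_diff q * mean2 (fst x) (snd x) q" for x q
  have Fm [measurable]: "(\<lambda>(x, q). F x q) \<in> borel_measurable (T2 \<Otimes>\<^sub>M ends)"
    unfolding F_def T2_def using mean2_measurable by (simp add: split_beta')
  have F_int: "integrable ends (F x)" and F_le: "(\<integral>q. \<bar>F x q\<bar> \<partial>ends) \<le> K * L1_norm d V"
    if x: "x \<in> space T2" for x
  proof -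
    have s: "0 < fst x" "fst x < t" and r: "0 < snd x" "snd x < t" using x by (auto simp: space_T2)
    have m: "F x \<in> borel_measurable ends"
      using measurable_compose[OF measurable_Pair1'[OF x, of ends] Fm] by simp
    have Ki: "integrable ends (\<lambda>q. K * (p_diff q * (\<integral>\<omega>. \<bar>V (\<omega> (fst x))\<bar> \<partial>bridge q)))"
      by (intro integrable_mult_right mean_abs_one_time(1)[OF s])
    have le: "\<bar>F x q\<bar> \<le> K * (p_diff q * (\<integral>\<omega>. \<bar>V (\<omega> (fst x))\<bar> \<partial>bridge q))" if "q \<in> space ends" for q
      unfolding F_def by (rule mean_abs_le(2)[OF that s r])
    show i: "integrable ends (F x)"
    proof (rule Bochner_Integration.integrable_bound[OF Ki m], rule AE_I2)
      fix q assume "q \<in> space ends"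
      from le[OF this] show "norm (F x q) \<le> norm (K * (p_diff q * (\<integral>\<omega>. \<bar>V (\<omega> (fst x))\<bar> \<partial>bridge q)))"
        unfolding real_norm_def by (rule order_trans[OF _ abs_ge_self])
    qed
    have "(\<integral>q. \<bar>F x q\<bar> \<partial>ends) \<le> (\<integral>q. K * (p_diff q * (\<integral>\<omega>. \<bar>V (\<omega> (fst x))\<bar> \<partial>bridge q)) \<partial>ends)"
      by (rule integral_mono[OF integrable_abs[OF i] Ki le])
    then show "(\<integral>q. \<bar>F x q\<bar> \<partial>ends) \<le> K * L1_norm d V" by (simp add: mean_abs_one_time(2)[OF s])
  qed
  have F: "integrable (T2 \<Otimes>\<^sub>M ends) (\<lambda>(x, q). F x q)"
  proof (rule TE.Fubini_integrable[OF Fm])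
    show "integrable T2 (\<lambda>x. \<integral>q. norm (case (x, q) of (x, q) \<Rightarrow> F x q) \<partial>ends)"
    proof (rule T2.integrable_const_bound[of _ "K * L1_norm d V"])
      show "AE x in T2. norm (\<integral>q. norm (case (x, q) of (x, q) \<Rightarrow> F x q) \<partial>ends) \<le> K * L1_norm d V"
        using F_le by (intro AE_I2) auto
    qed measurable
    show "AE x in T2. integrable ends (\<lambda>q. case (x, q) of (x, q) \<Rightarrow> F x q)"
      using F_int by (intro AE_I2) auto
  qed
  have eq: "p_diff q * (\<integral>\<omega>. (action \<omega>)\<^sup>2 \<partial>bridge q) = (\<integral>x. F x q \<partial>T2)" if q: "q \<in> space ends" for q
  proof -
    interpret B: prob_space "bridge q" by (rule prob_space_bridge_q[OF q])
    interpret TB: pair_sigma_finite T2 "bridge q" ..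
    interpret TB: finite_measure "T2 \<Otimes>\<^sub>M bridge q"
      by (rule finite_measure_pair_measure) (rule B.finite_measure_axioms, rule T2.finite_measure_axioms)
    define f where "f y = V (snd y (fst (fst y))) * V (snd y (snd (fst y)))"
      for y :: "(real \<times> real) \<times> (real \<Rightarrow> nat \<Rightarrow> real)"
    have f [measurable]: "f \<in> borel_measurable (T2 \<Otimes>\<^sub>M bridge q)"
    proof -
      have "(\<lambda>y. (fst (fst y), snd y)) \<in> T2 \<Otimes>\<^sub>M bridge q \<rightarrow>\<^sub>M time_measure \<Otimes>\<^sub>M bridge q"
        "(\<lambda>y. (snd (fst y), snd y)) \<in> T2 \<Otimes>\<^sub>M bridge q \<rightarrow>\<^sub>M time_measure \<Otimes>\<^sub>M bridge q"
        unfolding T2_def by measurable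
      from this[THEN measurable_compose[OF _ V_path_pair_measurable[OF q]]]
      show ?thesis unfolding f_def[abs_def] by simp
    qed
    have f_le: "\<bar>f y\<bar> \<le> K * K" if "y \<in> space (T2 \<Otimes>\<^sub>M bridge q)" for y
      using that unfolding f_def abs_mult
      by (intro mult_mono V_path_le[OF q] K_nonneg abs_ge_zero) (auto simp: space_pair_measure space_T2)
    have fi: "integrable (T2 \<Otimes>\<^sub>M bridge q) f"
      using f_le by (intro TB.integrable_const_bound[of _ "K * K"]) auto
    then have fi': "integrable (T2 \<Otimes>\<^sub>M bridge q) (\<lambda>(x, \<omega>). f (x, \<omega>))" by simp
    have "(action \<omega>)\<^sup>2 = (\<integral>x. f (x, \<omega>) \<partial>T2)" if \<omega>: "\<omega> \<in> space (bridge q)" for \<omega>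
    proof -
      have m: "(\<lambda>x. f (x, \<omega>)) \<in> borel_measurable T2"
        using measurable_compose[OF measurable_Pair2'[OF \<omega>, of T2] f] by simp
      have i: "integrable T2 (\<lambda>x. f (x, \<omega>))"
        using f_le \<omega> by (intro T2.integrable_const_bound[of _ "K * K"] m) (auto simp: space_pair_measure)
      have "(\<integral>x. f (x, \<omega>) \<partial>T2) = (\<integral>s. \<integral>r. V (\<omega> s) * V (\<omega> r) \<partial>time_measure \<partial>time_measure)"
        using i unfolding T2_def by (subst TT.integral_fst'[symmetric]) (auto simp: f_def)
      then show ?thesis by (simp add: action_def power2_eq_square)
    qed
    then have "(\<integral>\<omega>. (action \<omega>)\<^sup>2 \<partial>bridge q) = (\<integral>\<omega>. \<integral>x. f (x, \<omega>) \<partial>T2 \<partial>bridge q)"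
      by (rule Bochner_Integration.integral_cong[OF refl])
    also have "\<dots> = (\<integral>x. \<integral>\<omega>. f (x, \<omega>) \<partial>bridge q \<partial>T2)"
      by (rule TB.Fubini_integral[OF fi'])
    also have "\<dots> = (\<integral>x. mean2 (fst x) (snd x) q \<partial>T2)"
      by (simp add: f_def mean2_def)
    finally show ?thesis by (simp add: F_def)
  qed
  show "integrable ends (\<lambda>q. p_diff q * (\<integral>\<omega>. (action \<omega>)\<^sup>2 \<partial>bridge q))"
    using TE.integrable_snd[OF F] by (rule Bochner_Integration.integrable_cong[THEN iffD2, rotated -1]) (rule refl, erule eq)
  define \<rho>0 where "\<rho>0 = (\<integral>x. (V x)\<^sup>2 \<partial>euclid d)"
  have "(\<integral>q. p_diff q * (\<integral>\<omega>. (action \<omega>)\<^sup>2 \<partial>bridge q) \<partial>ends) = (\<integral>q. \<integral>x. F x q \<partial>T2 \<partial>ends)"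
    by (intro Bochner_Integration.integral_cong[OF refl] eq)
  also have "\<dots> = (\<integral>x. \<integral>q. F x q \<partial>ends \<partial>T2)"
    by (rule TE.Fubini_integral[OF F])
  finally have e: "(\<integral>q. p_diff q * (\<integral>\<omega>. (action \<omega>)\<^sup>2 \<partial>bridge q) \<partial>ends) - t\<^sup>2 * \<rho>0
      = (\<integral>x. (\<integral>q. F x q \<partial>ends) - \<rho>0 \<partial>T2)"
    using TE.integrable_fst[OF F] by (simp add: measure_T2)
  have "\<bar>\<integral>x. (\<integral>q. F x q \<partial>ends) - \<rho>0 \<partial>T2\<bar> \<le> (\<integral>x. holder_error \<partial>T2)"
  proof (rule order_trans[OF integral_abs_bound integral_mono])
    show "integrable T2 (\<lambda>x. \<bar>(\<integral>q. F x q \<partial>ends) - \<rho>0\<bar>)"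
      using TE.integrable_fst[OF F] by auto
    show "\<bar>(\<integral>q. F x q \<partial>ends) - \<rho>0\<bar> \<le> holder_error" if "x \<in> space T2" for x
      using that unfolding F_def \<rho>0_def by (intro mean2_total_close[OF \<alpha>]) (auto simp: space_T2)
  qed simp
  then show "\<bar>(\<integral>q. p_diff q * (\<integral>\<omega>. (action \<omega>)\<^sup>2 \<partial>bridge q) \<partial>ends) - t\<^sup>2 * (\<integral>x. (V x)\<^sup>2 \<partial>euclid d)\<bar> \<le> t\<^sup>2 * holder_error"
    unfolding e \<rho>0_def[symmetric] by (simp add: measure_T2)
qed

text \<open>By the reverse triangle inequality \<open>\<bar>V\<bar>\<close> satisfies the same
  Hoelder bound, so \<open>action_mean\<close> applies to it. This mean serves as the integrable
  majorant for the Taylor remainder.\<close>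

lemma abs_action_mean:
  "integrable ends (\<lambda>q. p_diff q * (\<integral>\<omega>. (\<integral>s. \<bar>V (\<omega> s)\<bar> \<partial>time_measure) \<partial>bridge q))"
  "(\<integral>q. p_diff q * (\<integral>\<omega>. (\<integral>s. \<bar>V (\<omega> s)\<bar> \<partial>time_measure) \<partial>bridge q) \<partial>ends) = t * L1_norm d V"
proof -
  have "hoelder_potential d (\<lambda>x. \<bar>V x\<bar>) M \<gamma> K"
  proof
    show "uniformly_Hoelder d M \<gamma> (\<lambda>x. \<bar>V x\<bar>)"
      using V_hoelder unfolding uniformly_Hoelder_def by (meson abs_triangle_ineq3 order_trans)
  qed (use V_integrable V_bound M_pos \<gamma>_pos \<gamma>_le_1 in auto)
  then interpret A: bridge_potential d "\<lambda>x. \<bar>V x\<bar>" M \<gamma> K \<alpha> p P t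
    by (intro bridge_potential.intro bridge_potential_axioms.intro stable_bridge_family_axioms t_pos)
  show "integrable ends (\<lambda>q. p_diff q * (\<integral>\<omega>. (\<integral>s. \<bar>V (\<omega> s)\<bar> \<partial>time_measure) \<partial>bridge q))"
    "(\<integral>q. p_diff q * (\<integral>\<omega>. (\<integral>s. \<bar>V (\<omega> s)\<bar> \<partial>time_measure) \<partial>bridge q) \<partial>ends) = t * L1_norm d V"
    using A.action_mean unfolding A.action_def by (auto simp: L1_norm_def)
qed

text \<open>In the cubic Taylor remainder two factors of the action are bounded by
  \<open>t * K\<close> and the third is kept as the time integral of \<open>\<bar>V\<bar>\<close>.
  This makes it integrable over the end points and produces the single factor
  \<open>L1_norm d V\<close>.\<close>

lemma p_diff_exp_integral_bound:
  assumes \<alpha>: "\<gamma> < \<alpha>"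
  defines "\<Phi> \<equiv> \<lambda>q. p_diff q * (\<integral>\<omega>. exp (- action \<omega>) \<partial>bridge q) - p_diff q"
  shows "integrable ends \<Phi>"
    and "\<bar>(\<integral>q. \<Phi> q \<partial>ends) + t * (\<integral>x. V x \<partial>euclid d) - t\<^sup>2 / 2 * (\<integral>x. (V x)\<^sup>2 \<partial>euclid d)\<bar>
      \<le> exp (t * K) * (t * K)\<^sup>2 / 2 * (t * L1_norm d V) + t\<^sup>2 / 2 * holder_error"
proof -
  define c where "c = exp (t * K) * (t * K)\<^sup>2 / 2"
  have c: "0 \<le> c" by (simp add: c_def)
  define rem where "rem \<omega> = exp (- action \<omega>) - 1 + action \<omega> - (action \<omega>)\<^sup>2 / 2" for \<omega>
  define A0 where "A0 q = (\<integral>\<omega>. exp (- action \<omega>) \<partial>bridge q)" for q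
  define A1 where "A1 q = (\<integral>\<omega>. action \<omega> \<partial>bridge q)" for q
  define A2 where "A2 q = (\<integral>\<omega>. (action \<omega>)\<^sup>2 \<partial>bridge q)" for q
  define A3 where "A3 q = (\<integral>\<omega>. (\<integral>s. \<bar>V (\<omega> s)\<bar> \<partial>time_measure) \<partial>bridge q)" for q
  \<comment> \<open>The terms must be combined before integrating: for positive \<open>d\<close>
    neither \<open>p_diff\<close> nor its product with \<open>A0\<close> is integrable over
    \<open>ends\<close>.\<close>
  define R where "R q = p_diff q * (A0 q - 1 + A1 q - A2 q / 2)" for q
  note i1 = action_mean(1)[folded A1_def] and i2 = action_square_mean(1)[OF \<alpha>, folded A2_def]
    and i3 = abs_action_mean(1)[folded A3_def]
  have rem_le: "\<bar>rem \<omega>\<bar> \<le> c * (\<integral>s. \<bar>V (\<omega> s)\<bar> \<partial>time_measure)"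
    if q: "q \<in> space ends" and \<omega>: "\<omega> \<in> space (bridge q)" for q \<omega>
  proof -
    have "\<bar>rem \<omega>\<bar> = norm (exp (- action \<omega>) - (\<Sum>i\<le>2. (- action \<omega>) ^ i / fact i))"
      by (simp add: rem_def numeral_2_eq_2)
    also have "\<dots> \<le> exp (norm (- action \<omega>)) * (norm (- action \<omega>) ^ Suc 2) / fact 2"
      by (rule Taylor_exp_field)
    also have "\<dots> = (exp \<bar>action \<omega>\<bar> * \<bar>action \<omega>\<bar>\<^sup>2 / 2) * \<bar>action \<omega>\<bar>"
      by (simp add: numeral_2_eq_2)
    also have "\<dots> \<le> c * (\<integral>s. \<bar>V (\<omega> s)\<bar> \<partial>time_measure)"
      unfolding c_def using action_le[OF q \<omega>]
      by (intro mult_mono divide_right_mono power_mono) auto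
    finally show ?thesis .
  qed
  have R_eq: "A0 q - 1 + A1 q - A2 q / 2 = (\<integral>\<omega>. rem \<omega> \<partial>bridge q)"
    and rem_int_le: "\<bar>A0 q - 1 + A1 q - A2 q / 2\<bar> \<le> c * A3 q" if q: "q \<in> space ends" for q
  proof -
    interpret B: prob_space "bridge q" by (rule prob_space_bridge_q[OF q])
    note [measurable] = action_measurable[OF q]
    have ia: "integrable (bridge q) action"
      using action_le(2)[OF q] by (intro integrable_bridge[OF q, of _ "t * K"]) auto
    have ia2: "integrable (bridge q) (\<lambda>\<omega>. (action \<omega>)\<^sup>2)"
    proof (rule integrable_bridge[OF q, of _ "(t * K)\<^sup>2"])
      fix \<omega> assume "\<omega> \<in> space (bridge q)"
      from power_mono[OF action_le(2)[OF q this], of 2] show "\<bar>(action \<omega>)\<^sup>2\<bar> \<le> (t * K)\<^sup>2" by simp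
    qed measurable
    have ie: "integrable (bridge q) (\<lambda>\<omega>. exp (- action \<omega>))"
      using action_le(2)[OF q] by (intro integrable_bridge[OF q, of _ "exp (t * K)"]) (auto simp: abs_le_iff)
    show e: "A0 q - 1 + A1 q - A2 q / 2 = (\<integral>\<omega>. rem \<omega> \<partial>bridge q)"
      unfolding rem_def A0_def A1_def A2_def using ia ia2 ie by (simp add: B.prob_space)
    have irem: "integrable (bridge q) rem" unfolding rem_def[abs_def] using ia ia2 ie by simp
    have V_pair: "(\<lambda>(\<omega>, s). \<bar>V (\<omega> s)\<bar>) \<in> borel_measurable (bridge q \<Otimes>\<^sub>M time_measure)"
      using measurable_compose[OF measurable_pair_swap' V_path_pair_measurable[OF q]] by (simp add: split_beta')
    have iV: "integrable (bridge q) (\<lambda>\<omega>. (\<integral>s. \<bar>V (\<omega> s)\<bar> \<partial>time_measure))"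
    proof (rule integrable_bridge[OF q, of _ "t * K"])
      show "(\<lambda>\<omega>. (\<integral>s. \<bar>V (\<omega> s)\<bar> \<partial>time_measure)) \<in> borel_measurable (bridge q)"
        using V_pair by (rule T.borel_measurable_lebesgue_integral)
      fix \<omega> assume \<omega>: "\<omega> \<in> space (bridge q)"
      have "(\<integral>s. \<bar>V (\<omega> s)\<bar> \<partial>time_measure) \<le> (\<integral>s. K \<partial>time_measure)"
        using V_path_time_integrable[OF q \<omega>] by (intro integral_mono) (auto intro!: V_path_le[OF q \<omega>])
      then show "\<bar>\<integral>s. \<bar>V (\<omega> s)\<bar> \<partial>time_measure\<bar> \<le> t * K" by simp
    qed
    have "\<bar>\<integral>\<omega>. rem \<omega> \<partial>bridge q\<bar> \<le> (\<integral>\<omega>. c * (\<integral>s. \<bar>V (\<omega> s)\<bar> \<partial>time_measure) \<partial>bridge q)"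
      by (rule order_trans[OF integral_abs_bound integral_mono[OF integrable_abs[OF irem] integrable_mult_right[OF iV] rem_le[OF q]]])
    then show "\<bar>A0 q - 1 + A1 q - A2 q / 2\<bar> \<le> c * A3 q" unfolding e by (simp add: A3_def)
  qed
  have R_le: "\<bar>R q\<bar> \<le> c * (p_diff q * A3 q)" if "q \<in> space ends" for q
    using mult_left_mono[OF rem_int_le[OF that] p_diff_nonneg[of q]] p_diff_nonneg[of q]
    by (simp add: R_def abs_mult mult.left_commute)
  have R_meas: "R \<in> borel_measurable ends"
  proof -
    have "(\<lambda>q. p_diff q * A0 q - p_diff q + p_diff q * A1 q - (p_diff q * A2 q) / 2) \<in> borel_measurable ends"
      using exp_action_measurable[folded A0_def] i1[THEN borel_measurable_integrable] i2[THEN borel_measurable_integrable]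
      by measurable
    moreover have "R = (\<lambda>q. p_diff q * A0 q - p_diff q + p_diff q * A1 q - (p_diff q * A2 q) / 2)"
      by (simp add: fun_eq_iff R_def algebra_simps)
    ultimately show ?thesis by simp
  qed
  have iR: "integrable ends R"
  proof (rule Bochner_Integration.integrable_bound[OF integrable_mult_right[OF i3, of c] R_meas], rule AE_I2)
    fix q assume "q \<in> space ends"
    from R_le[OF this] show "norm (R q) \<le> norm (c * (p_diff q * A3 q))"
      unfolding real_norm_def by (rule order_trans[OF _ abs_ge_self])
  qed
  have "\<bar>\<integral>q. R q \<partial>ends\<bar> \<le> (\<integral>q. c * (p_diff q * A3 q) \<partial>ends)"
    by (rule order_trans[OF integral_abs_bound integral_mono[OF integrable_abs[OF iR] integrable_mult_right[OF i3] R_le]])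
  then have R_total: "\<bar>\<integral>q. R q \<partial>ends\<bar> \<le> c * (t * L1_norm d V)"
    using abs_action_mean(2)[folded A3_def] by simp
  have \<Phi>: "\<Phi> = (\<lambda>q. R q - p_diff q * A1 q + (p_diff q * A2 q) / 2)"
    by (simp add: fun_eq_iff \<Phi>_def R_def A0_def algebra_simps)
  show "integrable ends \<Phi>" unfolding \<Phi> using iR i1 i2 by auto
  have "(\<integral>q. \<Phi> q \<partial>ends) = (\<integral>q. R q \<partial>ends) - t * (\<integral>x. V x \<partial>euclid d) + (\<integral>q. p_diff q * A2 q \<partial>ends) / 2"
    unfolding \<Phi> using iR i1 i2 action_mean(2)[folded A1_def] by simp
  moreover have "\<bar>(\<integral>q. p_diff q * A2 q \<partial>ends) - t\<^sup>2 * (\<integral>x. (V x)\<^sup>2 \<partial>euclid d)\<bar> \<le> t\<^sup>2 * holder_error"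
    using action_square_mean(2)[OF \<alpha>, folded A2_def] .
  ultimately show "\<bar>(\<integral>q. \<Phi> q \<partial>ends) + t * (\<integral>x. V x \<partial>euclid d) - t\<^sup>2 / 2 * (\<integral>x. (V x)\<^sup>2 \<partial>euclid d)\<bar>
      \<le> exp (t * K) * (t * K)\<^sup>2 / 2 * (t * L1_norm d V) + t\<^sup>2 / 2 * holder_error"
    using R_total unfolding c_def[symmetric] by (simp add: abs_le_iff field_simps)
qed

lemma heat_content_eq:
  assumes \<alpha>: "\<gamma> < \<alpha>"
  shows "heat_content d p P V t = (\<integral>q. p_diff q * (\<integral>\<omega>. exp (- action \<omega>) \<partial>bridge q) - p_diff q \<partial>ends)"
proof -
  let ?\<Phi> = "\<lambda>q. p_diff q * (\<integral>\<omega>. exp (- action \<omega>) \<partial>bridge q) - p_diff q"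
  have eq: "schroedinger_kernel d p P V t x y - p t (vdiff d x y) = ?\<Phi> (x, y)"
    if "x \<in> space (euclid d)" "y \<in> space (euclid d)" for x y
  proof -
    have q: "(x, y) \<in> space ends" using that by (simp add: space_pair_measure)
    have "(\<integral>\<omega>. exp (- (LINT s:{0..t}|lborel. V (\<omega> s))) \<partial>P t x y) = (\<integral>\<omega>. exp (- action \<omega>) \<partial>bridge (x, y))"
      unfolding bridge_def fst_conv snd_conv
    proof (rule Bochner_Integration.integral_cong[OF refl])
      fix \<omega> assume "\<omega> \<in> space (P t x y)"
      then have "\<omega> \<in> space (bridge (x, y))" by (simp add: bridge_def)
      from set_integral_eq_time_measure[OF V_path_time_measurable[OF q this]]
      show "exp (- (LINT s:{0..t}|lborel. V (\<omega> s))) = exp (- action \<omega>)" by (simp add: action_def)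
    qed
    then show ?thesis by (simp add: schroedinger_kernel_def p_diff_def)
  qed
  have int: "integrable ends (\<lambda>(x, y). ?\<Phi> (x, y))"
    using p_diff_exp_integral_bound(1)[OF \<alpha>] by (simp add: split_beta')
  have "heat_content d p P V t = (\<integral>y. \<integral>x. ?\<Phi> (x, y) \<partial>euclid d \<partial>euclid d)"
    unfolding heat_content_def
    by (rule Bochner_Integration.integral_cong[OF refl], rule Bochner_Integration.integral_cong[OF refl], rule eq)
  also have "\<dots> = (\<integral>q. ?\<Phi> q \<partial>ends)"
    using euclid2.integral_snd[OF int] by (simp add: split_beta')
  finally show ?thesis .
qed

end

text \<open>A Hoelder function is continuous, and an essential bound on a continuous function holds
  everywhere: an excess \<open>e\<close> at one point would persist as at least \<open>e / 2\<close>
  on a small cube of positive measure.\<close>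

lemma abs_le_Linfty_norm:
  assumes V: "in_Linfty d V" and Hoelder: "uniformly_Hoelder d M \<gamma> V" and pos: "0 < M" "0 < \<gamma>"
    and x: "x \<in> space (euclid d)"
  shows "\<bar>V x\<bar> \<le> Linfty_norm d V"
proof (rule ccontr)
  define S where "S = esssup (euclid d) (\<lambda>x. ereal \<bar>V x\<bar>)"
  define e where "e = \<bar>V x\<bar> - Linfty_norm d V"
  assume "\<not> \<bar>V x\<bar> \<le> Linfty_norm d V"
  then have e: "0 < e" by (simp add: e_def)
  \<comment> \<open>The radius at which the Hoelder modulus equals \<open>e / 2\<close>.\<close>
  define b where "b = (e / (2 * M)) powr (1 / \<gamma>)"
  have b: "0 < b" using e pos by (simp add: b_def)
  \<comment> \<open>A cube of half side \<open>\<delta>\<close> fits into the ball of radius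
    \<open>b\<close>, as its half diagonal is \<open>sqrt d * \<delta>\<close>; the added 1 avoids
    division by 0 for \<open>d = 0\<close>.\<close>
  define \<delta> where "\<delta> = b / (sqrt d + 1)"
  have \<delta>: "0 < \<delta>" using b by (simp add: \<delta>_def add_nonneg_pos)
  have \<delta>_le: "sqrt d * \<delta> \<le> b"
  proof -
    have "0 < sqrt d + 1" by (simp add: add_nonneg_pos)
    then have "sqrt d / (sqrt d + 1) \<le> 1" by (simp add: divide_le_eq)
    then have "b * (sqrt d / (sqrt d + 1)) \<le> b * 1" using b by (intro mult_left_mono) auto
    then show ?thesis by (simp add: \<delta>_def mult.commute)
  qed
  define A where "A = Pi\<^sub>E {..<d} (\<lambda>i. {x i - \<delta><..<x i + \<delta>})"
  have A: "A \<in> sets (euclid d)"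
    unfolding A_def euclid_def by (intro sets_PiM_I_finite) auto
  have "emeasure (euclid d) A = (\<Prod>i<d. ennreal (2 * \<delta>))"
    unfolding A_def euclid_def using \<delta> by (subst lborel_product.emeasure_PiM) auto
  also have "\<dots> = ennreal ((2 * \<delta>) ^ d)" using \<delta> by (simp add: ennreal_power)
  finally have "emeasure (euclid d) A \<noteq> 0" using \<delta> by simp
  moreover have "AE y in euclid d. y \<notin> A"
  proof -
    have "AE y in euclid d. ereal \<bar>V y\<bar> \<le> S" unfolding S_def by (rule esssup_AE)
    then show ?thesis
    proof (rule AE_mp, intro AE_I2 impI notI)
      fix y assume y: "y \<in> space (euclid d)" "ereal \<bar>V y\<bar> \<le> S" "y \<in> A"
      have Vy: "\<bar>V y\<bar> \<le> Linfty_norm d V"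
        using y(2) V unfolding in_Linfty_def Linfty_norm_def S_def[symmetric] by (cases S) auto
      have "(vnorm d (vdiff d x y))\<^sup>2 \<le> b\<^sup>2"
      proof -
        have "(vnorm d (vdiff d x y))\<^sup>2 = (\<Sum>i<d. (x i - y i)\<^sup>2)"
          by (simp add: vnorm_power2 vdiff_def)
        also have "\<dots> \<le> (\<Sum>i<d. \<delta>\<^sup>2)"
        proof (intro sum_mono)
          fix i assume "i \<in> {..<d}"
          then have "y i \<in> {x i - \<delta><..<x i + \<delta>}" using y(3) by (auto simp: A_def PiE_def Pi_def)
          then have "\<bar>x i - y i\<bar> \<le> \<bar>\<delta>\<bar>" by auto
          then show "(x i - y i)\<^sup>2 \<le> \<delta>\<^sup>2" by (rule abs_le_square_iff[THEN iffD1])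
        qed
        also have "\<dots> = (sqrt d * \<delta>)\<^sup>2" by (simp add: power_mult_distrib)
        also have "\<dots> \<le> b\<^sup>2" using \<delta>_le \<delta> by (intro power_mono) auto
        finally show ?thesis .
      qed
      then have "vnorm d (vdiff d x y) \<le> b" using b by (simp add: power2_le_iff_abs_le)
      then have "vnorm d (vdiff d x y) powr \<gamma> \<le> b powr \<gamma>" using pos by (intro powr_mono2) auto
      also have "\<dots> = e / (2 * M)" using e pos by (simp add: b_def powr_powr)
      finally have "M * vnorm d (vdiff d x y) powr \<gamma> \<le> e / 2" using pos by (simp add: field_simps)
      moreover have "\<bar>V x - V y\<bar> \<le> M * vnorm d (vdiff d x y) powr \<gamma>"
        using Hoelder x y(1) by (simp add: uniformly_Hoelder_def)
      ultimately have "\<bar>V x - V y\<bar> \<le> e / 2" by (rule order_trans[rotated])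
      moreover have "e \<le> \<bar>V x - V y\<bar>"
        using Vy abs_triangle_ineq2[of "V x" "V y"] by (simp add: e_def)
      ultimately have "e \<le> e / 2" by (rule order_trans[rotated])
      then show False using e by simp
    qed
  qed
  ultimately show False using A by (simp add: AE_iff_null_sets[symmetric] null_sets_def)
qed

context bridge_potential
begin

text \<open>The Taylor remainder carries the factor 1 and the Hoelder error the factor
  \<open>M\<close>; \<open>max 1 M\<close> covers both. The constant 84 is half of 168, from the
  factor \<open>t\<^sup>2 / 2\<close> of the quadratic term, and 1/2 comes from the cubic
  remainder.\<close>

lemma heat_content_expansion:
  assumes \<alpha>: "\<gamma> < \<alpha>"
  shows "\<bar>heat_content d p P V t + t * (\<integral>x. V x \<partial>euclid d) - t\<^sup>2 / 2 * (\<integral>x. (V x)\<^sup>2 \<partial>euclid d)\<bar>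
    \<le> (1 / 2 + 84 / (1 - 2 powr ((\<gamma> - \<alpha>) / 2))) * max 1 M * L1_norm d V
      * (K\<^sup>2 * exp (t * K) * t ^ 3 + t powr (\<gamma> / \<alpha> + 2))"
proof -
  define c where "c = 84 / (1 - 2 powr ((\<gamma> - \<alpha>) / 2))"
  have "2 powr ((\<gamma> - \<alpha>) / 2) < 1" using \<alpha> by (simp add: powr_less_one)
  then have c: "0 \<le> c" by (simp add: c_def)
  define X where "X = K\<^sup>2 * exp (t * K) * t ^ 3"
  define Y where "Y = t powr (\<gamma> / \<alpha> + 2)"
  define L where "L = L1_norm d V"
  have X: "0 \<le> X" and Y: "0 \<le> Y" and L: "0 \<le> L"
    using t_pos L1_norm_nonneg by (simp_all add: X_def Y_def L_def)
  have "t\<^sup>2 * t powr (\<gamma> / \<alpha>) = Y"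
    using t_pos by (simp add: Y_def powr_add mult.commute)
  then have Y_eq: "t\<^sup>2 / 2 * holder_error = c * (M * (L * Y))"
    by (simp add: holder_error_def c_def L_def field_simps)
  have X_eq: "exp (t * K) * (t * K)\<^sup>2 / 2 * (t * L1_norm d V) = 1 / 2 * (L * X)"
    by (simp add: X_def L_def power2_eq_square power3_eq_cube)
  have "\<bar>heat_content d p P V t + t * (\<integral>x. V x \<partial>euclid d) - t\<^sup>2 / 2 * (\<integral>x. (V x)\<^sup>2 \<partial>euclid d)\<bar>
      \<le> 1 / 2 * (L * X) + c * (M * (L * Y))"
    using p_diff_exp_integral_bound(2)[OF \<alpha>] unfolding heat_content_eq[OF \<alpha>] X_eq Y_eq .
  also have "\<dots> \<le> (1 / 2 + c) * (max 1 M * (L * (X + Y)))"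
  proof -
    have "1 * (L * X) \<le> max 1 M * (L * (X + Y))"
      using X Y L by (intro mult_mono mult_left_mono) auto
    moreover have "M * (L * Y) \<le> max 1 M * (L * (X + Y))"
      using X Y L by (intro mult_mono mult_left_mono) auto
    then have "c * (M * (L * Y)) \<le> c * (max 1 M * (L * (X + Y)))"
      using c by (rule mult_left_mono)
    ultimately show ?thesis by (simp add: distrib_right)
  qed
  finally show ?thesis unfolding c_def X_def Y_def L_def by (simp only: mult.assoc)
qed

end

theorem theorem1p2:
  fixes \<alpha> \<gamma> :: real
  assumes "0 < \<alpha>" and "\<alpha> \<le> 2" and "0 < \<gamma>" and "\<gamma> < min 1 \<alpha>"
  shows "\<exists>C :: real. \<forall>d\<ge>1. \<forall>p P V M.
    stable_densities d \<alpha> p \<and> stable_bridges d p P \<and>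
    in_Linfty d V \<and> integrable (euclid d) V \<and>
    M > 0 \<and> uniformly_Hoelder d M \<gamma> V \<longrightarrow>
      (\<forall>t>0.
        \<bar>heat_content d p P V t + t * (\<integral>x. V x \<partial>euclid d) - t\<^sup>2 / 2 * (\<integral>x. (V x)\<^sup>2 \<partial>euclid d)\<bar>
          \<le> C * max 1 M * L1_norm d V *
             ((Linfty_norm d V)\<^sup>2 * exp (t * Linfty_norm d V) * t ^ 3 + t powr (\<gamma> / \<alpha> + 2))) \<and>
      (\<lambda>t. heat_content d p P V t
             - (- t * (\<integral>x. V x \<partial>euclid d) + t\<^sup>2 / 2 * (\<integral>x. (V x)\<^sup>2 \<partial>euclid d)))
        \<in> O[at_right 0](\<lambda>t. t powr (\<gamma> / \<alpha> + 2))"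
proof -
  define C where "C = 1 / 2 + 84 / (1 - 2 powr ((\<gamma> - \<alpha>) / 2))"
  have \<alpha>: "\<gamma> < \<alpha>" and \<gamma>: "\<gamma> \<le> 1" using assms(4) by simp_all
  have "2 powr ((\<gamma> - \<alpha>) / 2) < 1" using \<alpha> by (simp add: powr_less_one)
  then have C: "0 \<le> C" by (simp add: C_def)
  show ?thesis
  proof (intro exI[of _ C] allI impI, elim conjE)
    fix d :: nat and p :: "real \<Rightarrow> (nat \<Rightarrow> real) \<Rightarrow> real"
      and P :: "real \<Rightarrow> (nat \<Rightarrow> real) \<Rightarrow> (nat \<Rightarrow> real) \<Rightarrow> (real \<Rightarrow> nat \<Rightarrow> real) measure"
      and V :: "(nat \<Rightarrow> real) \<Rightarrow> real" and M :: real
    assume p: "stable_densities d \<alpha> p" "stable_bridges d p P"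
      and V: "in_Linfty d V" "integrable (euclid d) V" "0 < M" "uniformly_Hoelder d M \<gamma> V"
    define K where "K = Linfty_norm d V"
    define D where "D t = heat_content d p P V t + t * (\<integral>x. V x \<partial>euclid d) - t\<^sup>2 / 2 * (\<integral>x. (V x)\<^sup>2 \<partial>euclid d)" for t
    interpret hoelder_potential d V M \<gamma> K
      using V assms(3) \<gamma> abs_le_Linfty_norm[OF V(1,4,3) assms(3)] by unfold_locales (auto simp: K_def)
    interpret stable_bridge_family d \<alpha> p P
      using p assms(1) by unfold_locales
    have bound: "\<bar>D t\<bar> \<le> C * max 1 M * L1_norm d V * (K\<^sup>2 * exp (t * K) * t ^ 3 + t powr (\<gamma> / \<alpha> + 2))"
      if t: "0 < t" for t
    proof -
      interpret bridge_potential d V M \<gamma> K \<alpha> p P t by unfold_locales (rule t)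
      show ?thesis unfolding D_def C_def by (rule heat_content_expansion[OF \<alpha>])
    qed
    have "D \<in> O[at_right 0](\<lambda>t. t powr (\<gamma> / \<alpha> + 2))"
    proof (rule bigoI[of _ "C * max 1 M * L1_norm d V * (K\<^sup>2 * exp K + 1)"])
      have "\<forall>\<^sub>F t in at_right 0. t \<in> {0<..<1::real}" by (rule eventually_at_right_real) simp
      then show "\<forall>\<^sub>F t in at_right 0. norm (D t) \<le> C * max 1 M * L1_norm d V * (K\<^sup>2 * exp K + 1) * norm (t powr (\<gamma> / \<alpha> + 2))"
      proof eventually_elim
        case (elim t)
        then have t: "0 < t" "t < 1" by simp_all
        \<comment> \<open>Because \<open>\<gamma> < \<alpha>\<close>, the cubic term is dominated by
          \<open>t powr (\<gamma> / \<alpha> + 2)\<close> for \<open>t < 1\<close> and is absorbed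
          into the constant, with \<open>exp (t * K) \<le> exp K\<close>.\<close>
        have "\<gamma> / \<alpha> + 2 \<le> 3" using \<alpha> assms(1) by simp
        then have "t powr 3 \<le> t powr (\<gamma> / \<alpha> + 2)" using t by (intro powr_mono') auto
        then have t3: "t ^ 3 \<le> t powr (\<gamma> / \<alpha> + 2)" using t by simp
        have "t * K \<le> 1 * K" using t K_nonneg by (intro mult_right_mono) auto
        then have "K\<^sup>2 * exp (t * K) * t ^ 3 \<le> K\<^sup>2 * exp K * t powr (\<gamma> / \<alpha> + 2)"
          using t t3 by (intro mult_mono) auto
        then have "K\<^sup>2 * exp (t * K) * t ^ 3 + t powr (\<gamma> / \<alpha> + 2) \<le> (K\<^sup>2 * exp K + 1) * t powr (\<gamma> / \<alpha> + 2)"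
          by (simp add: distrib_right)
        then have "C * max 1 M * L1_norm d V * (K\<^sup>2 * exp (t * K) * t ^ 3 + t powr (\<gamma> / \<alpha> + 2))
            \<le> C * max 1 M * L1_norm d V * ((K\<^sup>2 * exp K + 1) * t powr (\<gamma> / \<alpha> + 2))"
          using C L1_norm_nonneg by (intro mult_left_mono) auto
        with bound[OF t(1)] show ?case by (simp add: mult.assoc)
      qed
    qed
    moreover have "D = (\<lambda>t. heat_content d p P V t
        - (- t * (\<integral>x. V x \<partial>euclid d) + t\<^sup>2 / 2 * (\<integral>x. (V x)\<^sup>2 \<partial>euclid d)))"
      by (simp add: D_def fun_eq_iff)
    ultimately show "(\<forall>t>0.
        \<bar>heat_content d p P V t + t * (\<integral>x. V x \<partial>euclid d) - t\<^sup>2 / 2 * (\<integral>x. (V x)\<^sup>2 \<partial>euclid d)\<bar>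
          \<le> C * max 1 M * L1_norm d V *
             ((Linfty_norm d V)\<^sup>2 * exp (t * Linfty_norm d V) * t ^ 3 + t powr (\<gamma> / \<alpha> + 2))) \<and>
      (\<lambda>t. heat_content d p P V t
             - (- t * (\<integral>x. V x \<partial>euclid d) + t\<^sup>2 / 2 * (\<integral>x. (V x)\<^sup>2 \<partial>euclid d)))
        \<in> O[at_right 0](\<lambda>t. t powr (\<gamma> / \<alpha> + 2))"
      using bound[unfolded D_def K_def] by (intro conjI allI impI) simp_all
  qed
qed

end
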